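(* Let $\mathcal H$ be a homogeneous foliation of degree $d\ge3$ on $\mathbb P^2_{\mathbb C}$ defined by the $1$-form $$\omega=A(x,y)\mathrm dx+B(x,y)\mathrm dy,\qquad A,B\in\mathbb C[x,y]_d,\quad\gcd(A,B)=1,$$ where $\mathbb C[x,y]_d$ is the space of homogeneous polynomials of degree $d$. Suppose that $\mathcal H$ possesses a transverse inflection line $T$ of maximal order $d-1$, and put $T'=\mathcal G_{\mathcal H}(T)$. Then the curvature of $\mathrm{Leg}\,\mathcal H$ is holomorphic along $T'$ if and only if the $2$-form $\mathrm d\omega$ vanishes on the line $T$.
   Context: Foliations. A foliation of degree $d$ on $\mathbb P^2_{\mathbb C}$ is given in homogeneous coordinates $[x:y:z]$, up to a nonzero scalar, by a $1$-form $\alpha\,\mathrm dx+\beta\,\mathrm dy+\gamma\,\mathrm dz$ with homogeneous coefficients of degree $d+1$ without common factor satisfying $x\alpha+y\beta+z\gamma=0$; in the affine chart $z=1$ it is described by a polynomial $1$-form with coprime coefficients. It is homogeneous if in some affine chart $(x,y)$ it is invariant under all homotheties $(x,y)\mapsto\lambda(x,y)$; it is then described by $\omega=A\,\mathrm dx+B\,\mathrm dy$ with $A,B$ homogeneous of degree $d$ without common factor. For such $\mathcal H$ put $\mathrm C_{\mathcal H}=xA+yB$ and $\mathrm D_{\mathcal H}=A_xB_y-A_yB_x$. The inflection divisor of $\mathcal H$ is $z\,\mathrm C_{\mathcal H}\mathrm D_{\mathcal H}=0$. A transverse inflection line of order $m\geq 1$ is a line through the origin which is not $\mathcal H$-invariant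 and which divides $\mathrm D_{\mathcal H}$ with multiplicity exactly $m$; the order is at most $d-1$. Gauss map. $\mathcal G_{\mathcal H}:\mathbb P^2_{\mathbb C}\dashrightarrow\check{\mathbb P}^2_{\mathbb C}$ sends a non-singular point $m$ to the line tangent at $m$ to the leaf of $\mathcal H$ through $m$. For a curve $\mathcal C$, $\mathcal G_{\mathcal H}(\mathcal C)$ denotes the closure of $\mathcal G_{\mathcal H}(\mathcal C\setminus\mathrm{Sing}\,\mathcal H)$. "$\mathrm d\omega$ vanishes on $T$" means that the coefficient $B_x-A_y$ of $\mathrm d\omega=(B_x-A_y)\,\mathrm dx\wedge\mathrm dy$ vanishes at all points of $T$. Webs and Legendre transform. A $k$-web on a complex surface is given locally by a $k$-symmetric holomorphic $1$-form with isolated zeros (well defined up to units, compatible on overlaps) which at a generic point factors as a product of $k$ pairwise non-collinear linear forms. The set where this fails is the discriminant $\Delta(\mathcal W)$. The Legendre transform $\mathrm{Leg}\,\mathcal H$ is the $d$-web on the dual plane $\check{\mathbb P}^2_{\mathbb C}$ whose leaves are the families of tangent lines to the leaves of $\mathcal H$. In the affine chart $(p,q)$ of $\check{\mathbb P}^2_{\mathbb C}$ corresponding to the line $\{y=px-q\}$ it is given by $A(x,px-q)+pB(x,px-q)=0$ with $x=\frac{\mathrm dq}{\mathrm dp}$. Curvature. For a germ of web $\mathcal W=\mathcal F_1\boxtimes\cdots\boxtimes\mathcal F_k$ superposed from foliations defined by $1$-forms $\theta_i$ in coordinates $(u,v)$, write $\theta_i\wedge\theta_j=\delta_{ij}\,\mathrm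 du\wedge\mathrm dv$. For $r<s<t$ let $\eta_{rst}$ be the unique meromorphic $1$-form with $\mathrm d(\delta_{st}\theta_r)=\eta_{rst}\wedge\delta_{st}\theta_r$, $\mathrm d(\delta_{tr}\theta_s)=\eta_{rst}\wedge\delta_{tr}\theta_s$, $\mathrm d(\delta_{rs}\theta_t)=\eta_{rst}\wedge\delta_{rs}\theta_t$. The curvature $K(\mathcal W)=\mathrm d(\sum_{r<s<t}\eta_{rst})$ does not depend on choices. For a general web these local forms glue to a global meromorphic $2$-form with poles in $\Delta(\mathcal W)$. "Holomorphic along a curve" means holomorphic in a neighbourhood of the generic points of each irreducible component of that curve. *)

theory Defs
  imports "HOL-Analysis.Analysis" "HOL-Computational_Algebra.Polynomial"
begin

section \<open>Polynomials in two variables\<close>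

text \<open>
  Elements of \<open>\<complex>[x,y]\<close> are of type \<open>complex poly poly\<close>: the outer variable is \<open>x\<close>, the inner
  variable is \<open>y\<close>, so \<open>coeff (coeff P i) j\<close> is the coefficient of \<open>x^i y^j\<close>.
\<close>

definition eval2 :: "complex poly poly \<Rightarrow> complex \<Rightarrow> complex \<Rightarrow> complex" where
  "eval2 P x y = poly (poly P [:x:]) y"

definition homog :: "nat \<Rightarrow> complex poly poly \<Rightarrow> bool" where
  "homog d P \<longleftrightarrow> (\<forall>i j. coeff (coeff P i) j \<noteq> 0 \<longrightarrow> i + j = d)"

definition Dx :: "complex poly poly \<Rightarrow> complex poly poly" where
  "Dx P = pderiv P"

definition Dy :: "complex poly poly \<Rightarrow> complex poly poly" where
  "Dy P = map_poly pderiv P"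

definition linform :: "complex \<Rightarrow> complex \<Rightarrow> complex poly poly" where
  "linform a b = [: [:0, b:], [:a:] :]"

lemma eval2_linform: "eval2 (linform a b) x y = a * x + b * y"
  by (simp add: eval2_def linform_def algebra_simps)


section \<open>Homogeneous foliations\<close>

text \<open>The form \<open>\<omega> = A dx + B dy\<close> is represented by the pair \<open>A\<close>, \<open>B\<close>.\<close>

definition homogeneous_foliation ::
    "nat \<Rightarrow> complex poly poly \<Rightarrow> complex poly poly \<Rightarrow> bool" where
  "homogeneous_foliation d A B \<longleftrightarrow> homog d A \<and> homog d B \<and> coprime A B"

definition D_inv :: "complex poly poly \<Rightarrow> complex poly poly \<Rightarrow> complex poly poly" where
  "D_inv A B = Dx A * Dy B - Dy A * Dx B"

text \<open>
  The line \<open>ax + by = 0\<close> is invariant if its direction \<open>(-b, a)\<close> is in the kernel of \<open>\<omega>\<close> at each of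
  its points.
\<close>

definition invariant_line ::
    "complex poly poly \<Rightarrow> complex poly poly \<Rightarrow> complex \<Rightarrow> complex \<Rightarrow> bool" where
  "invariant_line A B a b \<longleftrightarrow>
     (\<forall>x y. a * x + b * y = 0 \<longrightarrow> eval2 A x y * (- b) + eval2 B x y * a = 0)"

definition transverse_inflection_line ::
    "complex poly poly \<Rightarrow> complex poly poly \<Rightarrow> complex \<Rightarrow> complex \<Rightarrow> nat \<Rightarrow> bool" where
  "transverse_inflection_line A B a b m \<longleftrightarrow>
     (a, b) \<noteq> (0, 0) \<and> m \<ge> 1 \<and> \<not> invariant_line A B a b \<and>
     linform a b ^ m dvd D_inv A B \<and> \<not> linform a b ^ (m + 1) dvd D_inv A B"

definition domega_vanishes_on ::
    "complex poly poly \<Rightarrow> complex poly poly \<Rightarrow> complex \<Rightarrow> complex \<Rightarrow> bool" where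
  "domega_vanishes_on A B a b \<longleftrightarrow>
     (\<forall>x y. a * x + b * y = 0 \<longrightarrow> eval2 (Dx B - Dy A) x y = 0)"


section \<open>The Gauss map\<close>

text \<open>
  Subsets of the projective plane and of its dual are represented by their cones in
  \<open>\<complex>\<^sup>3 - {0}\<close>; the triple \<open>(u, v, w)\<close> in the dual space stands for the line \<open>uX + vY + wZ = 0\<close>.
\<close>

type_synonym triple = "complex \<times> complex \<times> complex"

text \<open>
  The homogeneous \<open>1\<close>-form on \<open>\<complex>\<^sup>3\<close> obtained from \<open>A dx + B dy\<close> by putting \<open>x/z\<close>, \<open>y/z\<close> for
  \<open>x\<close>, \<open>y\<close> and clearing denominators. Its zeros are the singular points, and elsewhere its
  coefficients are the dual coordinates of the tangent line.
\<close>

fun proj_form :: "complex poly poly \<Rightarrow> complex poly poly \<Rightarrow> triple \<Rightarrow> triple" where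
  "proj_form A B (x, y, z) =
     (z * eval2 A x y, z * eval2 B x y, - (x * eval2 A x y + y * eval2 B x y))"

definition proj_line :: "complex \<Rightarrow> complex \<Rightarrow> triple set" where
  "proj_line a b = {(x, y, z). a * x + b * y = 0 \<and> (x, y, z) \<noteq> (0, 0, 0)}"

text \<open>
  The closure in the dual plane corresponds to the closure of the cone in \<open>\<complex>\<^sup>3 - {0}\<close>, because
  the projection onto the projective plane is an open quotient map.
\<close>

definition gauss_image ::
    "complex poly poly \<Rightarrow> complex poly poly \<Rightarrow> triple set \<Rightarrow> triple set" where
  "gauss_image A B S =
     closure {(c * u, c * v, c * w) | c u v w m.
                c \<noteq> 0 \<and> m \<in> S \<and> proj_form A B m = (u, v, w) \<and> (u, v, w) \<noteq> (0, 0, 0)}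
     - {(0, 0, 0)}"


section \<open>Holomorphic functions and forms in two variables\<close>

text \<open>
  A \<open>1\<close>-form \<open>f du + g dv\<close> on an open subset of \<open>\<complex>\<^sup>2\<close> is the function with value \<open>(f, g)\<close>; a
  \<open>2\<close>-form is the coefficient of \<open>du \<and> dv\<close>.
\<close>

type_synonym point2 = "complex \<times> complex"
type_synonym form1 = "point2 \<Rightarrow> complex \<times> complex"

definition holo2 :: "(point2 \<Rightarrow> complex) \<Rightarrow> point2 set \<Rightarrow> bool" where
  "holo2 f U \<longleftrightarrow>
     (\<forall>m\<in>U. \<exists>a b. (f has_derivative (\<lambda>(h, k). a * h + b * k)) (at m))"

definition pdu :: "(point2 \<Rightarrow> complex) \<Rightarrow> point2 \<Rightarrow> complex" where
  "pdu f m = deriv (\<lambda>s. f (s, snd m)) (fst m)"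

definition pdv :: "(point2 \<Rightarrow> complex) \<Rightarrow> point2 \<Rightarrow> complex" where
  "pdv f m = deriv (\<lambda>s. f (fst m, s)) (snd m)"

definition ext_d :: "form1 \<Rightarrow> point2 \<Rightarrow> complex" where
  "ext_d \<theta> m = pdu (\<lambda>z. snd (\<theta> z)) m - pdv (\<lambda>z. fst (\<theta> z)) m"

definition wedge :: "form1 \<Rightarrow> form1 \<Rightarrow> point2 \<Rightarrow> complex" where
  "wedge \<theta> \<theta>' m = fst (\<theta> m) * snd (\<theta>' m) - snd (\<theta> m) * fst (\<theta>' m)"

definition fmult :: "(point2 \<Rightarrow> complex) \<Rightarrow> form1 \<Rightarrow> form1" where
  "fmult f \<theta> = (\<lambda>m. (f m * fst (\<theta> m), f m * snd (\<theta> m)))"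


section \<open>Webs and their curvature\<close>

text \<open>
  A \<open>k\<close>-symmetric \<open>1\<close>-form \<open>W\<close> is given by its values \<open>W m (\<xi>, \<zeta>)\<close> on tangent vectors, that is,
  by putting \<open>(du, dv) = (\<xi>, \<zeta>)\<close> at the point \<open>m\<close>.
\<close>

type_synonym symform = "point2 \<Rightarrow> complex \<times> complex \<Rightarrow> complex"

text \<open>
  On \<open>U\<close> the web is the superposition of the foliations \<open>\<theta> 0, \<dots>, \<theta> (k-1)\<close>, pairwise transverse at
  each point. The discriminant consists of the points which have no such neighbourhood. The
  equality of the symmetric form with the product is no restriction: units can be absorbed in
  one factor.
\<close>

definition local_factorization ::
    "symform \<Rightarrow> nat \<Rightarrow> point2 set \<Rightarrow> (nat \<Rightarrow> form1) \<Rightarrow> bool" where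
  "local_factorization W k U \<theta> \<longleftrightarrow>
     open U \<and>
     (\<forall>i<k. holo2 (\<lambda>m. fst (\<theta> i m)) U \<and> holo2 (\<lambda>m. snd (\<theta> i m)) U) \<and>
     (\<forall>m\<in>U. \<forall>\<xi> \<zeta>. W m (\<xi>, \<zeta>) = (\<Prod>i<k. fst (\<theta> i m) * \<xi> + snd (\<theta> i m) * \<zeta>)) \<and>
     (\<forall>m\<in>U. \<forall>i<k. \<forall>j<k. i \<noteq> j \<longrightarrow> wedge (\<theta> i) (\<theta> j) m \<noteq> 0)"

definition eta_form ::
    "form1 \<Rightarrow> form1 \<Rightarrow> form1 \<Rightarrow> point2 set \<Rightarrow> form1 \<Rightarrow> bool" where
  "eta_form \<theta>r \<theta>s \<theta>t U \<eta> \<longleftrightarrow> (\<forall>m\<in>U.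
     ext_d (fmult (wedge \<theta>s \<theta>t) \<theta>r) m = wedge \<eta> (fmult (wedge \<theta>s \<theta>t) \<theta>r) m \<and>
     ext_d (fmult (wedge \<theta>t \<theta>r) \<theta>s) m = wedge \<eta> (fmult (wedge \<theta>t \<theta>r) \<theta>s) m \<and>
     ext_d (fmult (wedge \<theta>r \<theta>s) \<theta>t) m = wedge \<eta> (fmult (wedge \<theta>r \<theta>s) \<theta>t) m)"

text \<open>
  \<open>curvature_at W k m \<kappa>\<close>: the point \<open>m\<close> is outside the discriminant and the curvature of the web at
  \<open>m\<close> is \<open>\<kappa> du \<and> dv\<close>. The value \<open>\<kappa>\<close> does not depend on the local data.
\<close>

definition curvature_at :: "symform \<Rightarrow> nat \<Rightarrow> point2 \<Rightarrow> complex \<Rightarrow> bool" where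
  "curvature_at W k m \<kappa> \<longleftrightarrow>
     (\<exists>U \<theta> \<eta>. m \<in> U \<and> local_factorization W k U \<theta> \<and>
        (\<forall>r s t. r < s \<and> s < t \<and> t < k \<longrightarrow> eta_form (\<theta> r) (\<theta> s) (\<theta> t) U (\<eta> r s t)) \<and>
        \<kappa> = ext_d (\<lambda>z. \<Sum>(r, s, t)\<in>{(r, s, t). r < s \<and> s < t \<and> t < k}. \<eta> r s t z) m)"

text \<open>
  The curvature, a holomorphic \<open>2\<close>-form outside the discriminant, extends to a holomorphic
  \<open>2\<close>-form in a neighbourhood of \<open>m\<close>.
\<close>

definition curvature_holomorphic_at :: "symform \<Rightarrow> nat \<Rightarrow> point2 \<Rightarrow> bool" where
  "curvature_holomorphic_at W k m \<longleftrightarrow>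
     (\<exists>V h. open V \<and> m \<in> V \<and> holo2 h V \<and>
        (\<forall>m'\<in>V. \<forall>\<kappa>. curvature_at W k m' \<kappa> \<longrightarrow> h m' = \<kappa>))"

text \<open>
  For an algebraic curve \<open>S\<close>, the generic points of its irreducible components are all points of
  \<open>S\<close> up to finitely many.
\<close>

definition curvature_holomorphic_along :: "symform \<Rightarrow> nat \<Rightarrow> point2 set \<Rightarrow> bool" where
  "curvature_holomorphic_along W k S \<longleftrightarrow>
     (\<exists>F. finite F \<and> (\<forall>m\<in>S - F. curvature_holomorphic_at W k m))"


section \<open>The Legendre transform of a homogeneous foliation\<close>

text \<open>
  In the chart \<open>(p, q)\<close> of the lines \<open>y = px - q\<close>, with dual coordinates \<open>(p, -1, -q)\<close>, the
  Legendre transform is \<open>A(x, px - q) + p B(x, px - q) = 0\<close> with \<open>x = dq/dp\<close>; the symmetric form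
  is obtained by multiplication with \<open>dp^d\<close> (see \<open>leg_y_eq\<close> below).
\<close>

fun leg_y :: "complex poly poly \<Rightarrow> complex poly poly \<Rightarrow> symform" where
  "leg_y A B (p, q) (dp, dq) =
     eval2 A dq (p * dq - q * dp) + p * eval2 B dq (p * dq - q * dp)"

text \<open>
  In the chart \<open>(p, q)\<close> of the lines \<open>x = py - q\<close>, with dual coordinates \<open>(-1, p, -q)\<close>, it is
  \<open>B(py - q, y) + p A(py - q, y) = 0\<close> with \<open>y = dq/dp\<close>.
\<close>

fun leg_x :: "complex poly poly \<Rightarrow> complex poly poly \<Rightarrow> symform" where
  "leg_x A B (p, q) (dp, dq) =
     eval2 B (p * dq - q * dp) dq + p * eval2 A (p * dq - q * dp) dq"

text \<open>
  The two charts cover the dual plane except for one point, the line at infinity \<open>Z = 0\<close>. A single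
  point is irrelevant for holomorphy at the generic points of a curve.
\<close>

definition legendre_curvature_holomorphic_along ::
    "complex poly poly \<Rightarrow> complex poly poly \<Rightarrow> nat \<Rightarrow> triple set \<Rightarrow> bool" where
  "legendre_curvature_holomorphic_along A B d S \<longleftrightarrow>
     curvature_holomorphic_along (leg_y A B) d {(p, q). (p, -1, -q) \<in> S} \<and>
     curvature_holomorphic_along (leg_x A B) d {(p, q). (-1, p, -q) \<in> S}"

lemma eval2_sum: "eval2 P x y = (\<Sum>i\<le>degree P. \<Sum>j\<le>degree (coeff P i). coeff (coeff P i) j * x ^ i * y ^ j)"
proof -
  have "eval2 P x y = (\<Sum>i\<le>degree P. poly (coeff P i) y * x ^ i)"
    by (simp add: eval2_def poly_altdef[of P] poly_sum poly_power)
  then show ?thesis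
    by (simp add: poly_altdef sum_distrib_left sum_distrib_right mult_ac)
qed

lemma eval2_homog:
  assumes "homog d P"
  shows "eval2 P (c * x) (c * y) = c ^ d * eval2 P x y"
proof -
  have "coeff (coeff P i) j * (c * x) ^ i * (c * y) ^ j =
        c ^ d * (coeff (coeff P i) j * x ^ i * y ^ j)" for i j
  proof (cases "coeff (coeff P i) j = 0")
    case False
    then have "d = i + j" using assms by (auto simp: homog_def)
    then show ?thesis by (simp add: power_mult_distrib power_add)
  qed simp
  then show ?thesis by (simp only: eval2_sum sum_distrib_left)
qed

lemma leg_y_eq:
  assumes "homog d A" "homog d B" "dp \<noteq> 0" and x: "x = dq / dp"
  shows "leg_y A B (p, q) (dp, dq) =
     dp ^ d * (eval2 A x (p * x - q) + p * eval2 B x (p * x - q))"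
proof -
  have "dq = dp * x" "p * dq - q * dp = dp * (p * x - q)"
    using assms by (simp_all add: field_simps)
  then show ?thesis
    by (simp add: eval2_homog[OF assms(1)] eval2_homog[OF assms(2)] distrib_left mult.left_commute)
qed

lemma leg_x_eq:
  assumes "homog d A" "homog d B" "dp \<noteq> 0" and y: "y = dq / dp"
  shows "leg_x A B (p, q) (dp, dq) =
     dp ^ d * (eval2 B (p * y - q) y + p * eval2 A (p * y - q) y)"
proof -
  have "dq = dp * y" "p * dq - q * dp = dp * (p * y - q)"
    using assms by (simp_all add: field_simps)
  then show ?thesis
    by (simp add: eval2_homog[OF assms(1)] eval2_homog[OF assms(2)] distrib_left mult.left_commute)
qed

end

theory Submission
  imports Defs "HOL-Complex_Analysis.Conformal_Mappings"
begin

text \<open>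
  Dividing by \<open>q\<close>, the leaves of the Legendre transform through \<open>(p, q)\<close> have slopes
  \<open>dq/dp = q \<lambda>\<^sub>i(p)\<close>, where \<open>\<lambda>\<^sub>1, \<dots>, \<lambda>\<^sub>d\<close> are the roots of a polynomial equation
  \<open>A(\<lambda>, p\<lambda> - 1) + p B(\<lambda>, p\<lambda> - 1) = 0\<close> in which \<open>q\<close> does not occur: this is what homogeneity of the
  foliation means for the web. Writing \<open>\<theta>\<^sub>i = u\<^sub>i (dq - q \<lambda>\<^sub>i dp)\<close>, the system for \<open>\<eta>\<^sub>r\<^sub>s\<^sub>t\<close> is a linear
  interpolation problem, and its \<open>dq\<close>-coefficient is \<open>1/q\<close> times minus the second divided difference
  of \<open>\<lambda>'\<close> at the nodes \<open>\<lambda>\<^sub>r, \<lambda>\<^sub>s, \<lambda>\<^sub>t\<close>, up to a constant and a logarithmic derivative of the units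
  (\<open>eta_solution\<close>). Summed over all triples, the units contribute only through the product of all
  \<open>u\<^sub>i\<close>, which is a known function of \<open>p\<close>, so that the curvature is \<open>E'(p)/q dp \<and> dq\<close> with
  \<open>E = - \<Sum>\<^sub>i \<lambda>\<^sub>i' e\<^sub>2(1/(\<lambda>\<^sub>i - \<lambda>\<^sub>j) : j \<noteq> i)\<close> (\<open>curvature_value\<close>). The symmetric function \<open>e\<^sub>2\<close> is the
  quotient of the cubic and the linear Taylor coefficient of the polynomial at \<open>\<lambda>\<^sub>i\<close>.

  A transverse inflection line \<open>ax + by = 0\<close> of order \<open>d - 1\<close> is one over which the slope map of the
  foliation is totally ramified: some constant combination of \<open>A\<close> and \<open>B\<close> equals \<open>c (ax + by)\<^sup>d\<close>
  (\<open>flat_combination\<close>). The dual curve of the line is \<open>p = p\<^sub>0\<close>, and the equation becomes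
  \<open>c ((a + bp)\<lambda> - b)\<^sup>d + (p - p\<^sub>0) B(\<lambda>, p\<lambda> - 1) = 0\<close>. All its roots near \<open>p\<^sub>0\<close> are the values of one
  holomorphic function \<open>L\<close> at the \<open>d\<close>-th roots \<open>w\<close> of \<open>p - p\<^sub>0\<close> (\<open>uniformisation\<close>). The summand of \<open>E\<close>
  that belongs to \<open>w\<close> has a pole of order \<open>d + 1\<close> at \<open>w = 0\<close>, and summing over the roots of unity
  keeps only the exponents divisible by \<open>d\<close> (\<open>sum_over_roots_Laurent\<close>). Hence \<open>E\<close> has at most a simple
  pole at \<open>p\<^sub>0\<close>, and \<open>E'\<close> is holomorphic there exactly if the residue vanishes.

  The residue is \<open>d\<close> times the second coefficient of the numerator of that summand as a power
  series in \<open>w\<close>. In the logarithmic derivative of the numerator at \<open>0\<close> the second order terms of \<open>L\<close>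
  cancel, and what remains is a nonzero multiple of the derivative of \<open>B\<close> along \<open>(1, p\<^sub>0)\<close> at a point
  of the line (\<open>deriv_branch_term_0\<close>); the first coefficient contains the binomial coefficient
  \<open>d choose 3\<close>, which is not zero as \<open>d \<ge> 3\<close>. Since \<open>A + p\<^sub>0 B\<close> vanishes to order
  at least two on the line, \<open>B\<^sub>x + p\<^sub>0 B\<^sub>y = B\<^sub>x - A\<^sub>y\<close> there, and this is the coefficient of \<open>d\<omega>\<close>. The two
  affine charts of the dual plane are exchanged by swapping the coordinates and the roles of
  \<open>A\<close> and \<open>B\<close>, so that one analysis, carried out in the locale \<open>dual_web\<close>, serves both.
\<close>

section \<open>Divided differences and the system for the connection forms\<close>

text \<open>
  Turns the sum of the connection forms over increasing triples into a sum over single indices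
  with an inner sum over ordered pairs, the shape in which elementary symmetric functions appear.
\<close>

lemma sum_triples_symmetrise:
  fixes \<Phi> :: "nat \<Rightarrow> nat \<Rightarrow> nat \<Rightarrow> complex"
  assumes sym: "\<And>i j l. \<Phi> i j l = \<Phi> i l j"
  shows "2 * (\<Sum>(r, s, t)\<in>{(r, s, t). r < s \<and> s < t \<and> t < k}. \<Phi> r s t + \<Phi> s r t + \<Phi> t r s) =
    (\<Sum>i<k. \<Sum>j\<in>{..<k} - {i}. \<Sum>l\<in>{..<k} - {i} - {j}. \<Phi> i j l)"
proof -
  define S where "S f = (\<Sum>i<k. \<Sum>j<k. \<Sum>l<k. f i j l)" for f :: "nat \<Rightarrow> nat \<Rightarrow> nat \<Rightarrow> complex"
  have swap12: "S f = S (\<lambda>i j l. f j i l)" for f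
    unfolding S_def by (rule sum.swap)
  have swap23: "S f = S (\<lambda>i j l. f i l j)" for f
    unfolding S_def by (intro sum.cong sum.swap refl)
  have add: "S (\<lambda>i j l. f i j l + g i j l) = S f + S g" for f g
    by (simp add: S_def sum.distrib)
  have triples: "(\<Sum>(r, s, t)\<in>{(r, s, t). r < s \<and> s < t \<and> t < k}. f r s t) =
      S (\<lambda>r s t. if r < s \<and> s < t then f r s t else 0)" for f
  proof -
    have "{(r, s, t). r < s \<and> s < t \<and> t < k} =
        {x \<in> {..<k} \<times> {..<k} \<times> {..<k}. case x of (r, s, t) \<Rightarrow> r < s \<and> s < t}"
      by auto
    then show ?thesis
      by (simp add: S_def sum.inter_filter sum.cartesian_product split_def)
  qed
  let ?g = "\<lambda>P i j l. if P i j l then \<Phi> i j l else 0"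
  have "(\<Sum>i<k. \<Sum>j\<in>{..<k} - {i}. \<Sum>l\<in>{..<k} - {i} - {j}. \<Phi> i j l) =
      S (?g (\<lambda>i j l. i \<noteq> j \<and> i \<noteq> l \<and> j \<noteq> l))"
  proof -
    have "(\<Sum>j\<in>{..<k} - {i}. \<Sum>l\<in>{..<k} - {i} - {j}. \<Phi> i j l) =
        (\<Sum>j<k. \<Sum>l<k. ?g (\<lambda>i j l. i \<noteq> j \<and> i \<noteq> l \<and> j \<noteq> l) i j l)" for i
    proof -
      have l: "(\<Sum>l\<in>{..<k} - {i} - {j}. \<Phi> i j l) = (\<Sum>l<k. if i \<noteq> l \<and> j \<noteq> l then \<Phi> i j l else 0)" for j
        by (rule sum.mono_neutral_cong_left) auto
      show ?thesis
        unfolding l by (rule sum.mono_neutral_cong_left) (auto intro: sum.cong)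
    qed
    then show ?thesis by (simp add: S_def)
  qed
  also have "\<dots> = S (\<lambda>i j l. ?g (\<lambda>i j l. i < j \<and> j < l) i j l + (?g (\<lambda>i j l. i < l \<and> l < j) i j l
      + (?g (\<lambda>i j l. j < i \<and> i < l) i j l + (?g (\<lambda>i j l. l < i \<and> i < j) i j l
      + (?g (\<lambda>i j l. j < l \<and> l < i) i j l + ?g (\<lambda>i j l. l < j \<and> j < i) i j l)))))"
    unfolding S_def by (intro sum.cong refl) auto
  also have "\<dots> = S (?g (\<lambda>i j l. i < j \<and> j < l)) + (S (?g (\<lambda>i j l. i < l \<and> l < j))
      + (S (?g (\<lambda>i j l. j < i \<and> i < l)) + (S (?g (\<lambda>i j l. l < i \<and> i < j))
      + (S (?g (\<lambda>i j l. j < l \<and> l < i)) + S (?g (\<lambda>i j l. l < j \<and> j < i))))))"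
    unfolding add ..
  also have "S (?g (\<lambda>i j l. i < l \<and> l < j)) = S (?g (\<lambda>i j l. i < j \<and> j < l))"
    by (subst swap23) (simp add: sym cong: if_cong)
  also have "S (?g (\<lambda>i j l. l < i \<and> i < j)) = S (?g (\<lambda>i j l. j < i \<and> i < l))"
    by (subst swap23) (simp add: sym cong: if_cong)
  also have "S (?g (\<lambda>i j l. l < j \<and> j < i)) = S (?g (\<lambda>i j l. j < l \<and> l < i))"
    by (subst swap23) (simp add: sym cong: if_cong)
  also have "S (?g (\<lambda>i j l. j < i \<and> i < l)) = S (\<lambda>r s t. if r < s \<and> s < t then \<Phi> s r t else 0)"
    by (rule swap12)
  also have "S (?g (\<lambda>i j l. j < l \<and> l < i)) = S (\<lambda>r s t. if r < s \<and> s < t then \<Phi> t r s else 0)"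
    by (subst swap12, subst swap23) (rule refl)
  finally show ?thesis
    by (simp add: sum.distrib triples[symmetric] split_def distrib_left)
qed

text \<open>
  The double sum is twice the second elementary symmetric function of the inverses of the \<open>y j\<close>;
  written over ordered pairs it matches the result of the previous lemma.
\<close>

lemma coeff_2_prod_linear:
  fixes y :: "'i \<Rightarrow> complex"
  assumes "finite S" "\<And>j. j \<in> S \<Longrightarrow> y j \<noteq> 0"
  shows "2 * coeff (\<Prod>j\<in>S. [:y j, 1:]) 2 =
    coeff (\<Prod>j\<in>S. [:y j, 1:]) 0 * (\<Sum>j\<in>S. \<Sum>l\<in>S - {j}. 1 / (y j * y l))"
proof -
  have "coeff (\<Prod>j\<in>S. [:y j, 1:]) 0 = (\<Prod>j\<in>S. y j) \<and>
    coeff (\<Prod>j\<in>S. [:y j, 1:]) 1 = (\<Prod>j\<in>S. y j) * (\<Sum>j\<in>S. 1 / y j) \<and>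
    2 * coeff (\<Prod>j\<in>S. [:y j, 1:]) 2 = (\<Prod>j\<in>S. y j) * ((\<Sum>j\<in>S. 1 / y j)\<^sup>2 - (\<Sum>j\<in>S. 1 / (y j)\<^sup>2))"
    using assms
  proof (induction S rule: finite_induct)
    case empty
    then show ?case by simp
  next
    case (insert x S)
    let ?P = "\<Prod>j\<in>S. [:y j, 1:]"
    let ?s1 = "\<Sum>j\<in>S. 1 / y j" and ?s2 = "\<Sum>j\<in>S. 1 / (y j)\<^sup>2"
    have nz: "y x \<noteq> 0" using insert by auto
    have IH: "coeff ?P 0 = (\<Prod>j\<in>S. y j)" "coeff ?P 1 = (\<Prod>j\<in>S. y j) * ?s1"
      "2 * coeff ?P 2 = (\<Prod>j\<in>S. y j) * (?s1\<^sup>2 - ?s2)"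
      using insert by auto
    have "2 * (y x * coeff ?P 2 + coeff ?P 1) = y x * (2 * coeff ?P 2) + 2 * coeff ?P 1" by simp
    also have "\<dots> = y x * (\<Prod>j\<in>S. y j) * ((1 / y x + ?s1)\<^sup>2 - (1 / (y x)\<^sup>2 + ?s2))"
      unfolding IH using nz by (simp add: power2_eq_square field_simps)
    finally have c2: "2 * (y x * coeff ?P 2 + coeff ?P 1) = \<dots>" .
    have "coeff ([:y x, 1:] * ?P) 0 = y x * coeff ?P 0"
      "coeff ([:y x, 1:] * ?P) 1 = y x * coeff ?P 1 + coeff ?P 0"
      "coeff ([:y x, 1:] * ?P) 2 = y x * coeff ?P 2 + coeff ?P 1"
      by (simp_all add: numeral_2_eq_2 coeff_pCons)
    then show ?case
      unfolding prod.insert[OF insert(1,2)] sum.insert[OF insert(1,2)]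
      using c2 nz IH by (intro conjI) (simp_all only:, simp_all add: field_simps)
  qed
  moreover have "(\<Sum>j\<in>S. \<Sum>l\<in>S - {j}. 1 / (y j * y l)) = (\<Sum>j\<in>S. 1 / y j)\<^sup>2 - (\<Sum>j\<in>S. 1 / (y j)\<^sup>2)"
  proof -
    have "(\<Sum>l\<in>S - {j}. 1 / (y j * y l)) = 1 / y j * (\<Sum>l\<in>S. 1 / y l) - 1 / (y j)\<^sup>2" if "j \<in> S" for j
      using that assms(1) by (simp add: sum_diff1 sum_distrib_left power2_eq_square)
    then show ?thesis
      by (simp add: sum_subtractf power2_eq_square sum_distrib_right)
  qed
  ultimately show ?thesis by simp
qed

text \<open>
  Minus the second divided difference, at the nodes \<open>r\<close>, \<open>s\<close>, \<open>t\<close>, of a function with the values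
  \<open>r'\<close>, \<open>s'\<close>, \<open>t'\<close>.
\<close>

definition neg_divided_diff :: "complex \<Rightarrow> complex \<Rightarrow> complex \<Rightarrow> complex \<Rightarrow> complex \<Rightarrow> complex \<Rightarrow> complex" where
  "neg_divided_diff r s t r' s' t' =
    - (r' / ((r - s) * (r - t)) + s' / ((s - r) * (s - t)) + t' / ((t - r) * (t - s)))"

text \<open>
  If \<open>\<gamma>\<^sub>0 + \<gamma>\<^sub>1 X + \<gamma>\<^sub>2 X\<^sup>2\<close> interpolates the values, the slope of the chord over two nodes is
  \<open>\<gamma>\<^sub>1 + \<gamma>\<^sub>2\<close> times the sum of these two, which is affine in the third node with leading
  coefficient \<open>- \<gamma>\<^sub>2\<close>. So all three expressions are \<open>\<gamma>\<^sub>1 + \<gamma>\<^sub>2 (r + s + t)\<close>.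
\<close>

lemma neg_divided_diff_affine:
  assumes "r \<noteq> s" "s \<noteq> t" "r \<noteq> t"
  shows "(t' - s') / (t - s) - neg_divided_diff r s t r' s' t' * r =
         (r' - t') / (r - t) - neg_divided_diff r s t r' s' t' * s"
    "(t' - s') / (t - s) - neg_divided_diff r s t r' s' t' * r =
         (s' - r') / (s - r) - neg_divided_diff r s t r' s' t' * t"
proof -
  have nz: "r - s \<noteq> 0" "r - t \<noteq> 0" "s - t \<noteq> 0" "s - r \<noteq> 0" "t - r \<noteq> 0" "t - s \<noteq> 0" using assms by auto
  have m: "s - r = - (r - s)" "t - r = - (r - t)" "t - s = - (s - t)" by auto
  show "(t' - s') / (t - s) - neg_divided_diff r s t r' s' t' * r =
         (r' - t') / (r - t) - neg_divided_diff r s t r' s' t' * s"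
    unfolding neg_divided_diff_def m using nz
    by (simp add: divide_simps del: minus_diff_eq) (simp add: algebra_simps)
  show "(t' - s') / (t - s) - neg_divided_diff r s t r' s' t' * r =
         (s' - r') / (s - r) - neg_divided_diff r s t r' s' t' * t"
    unfolding neg_divided_diff_def m using nz
    by (simp add: divide_simps del: minus_diff_eq) (simp add: algebra_simps)
qed

text \<open>
  The three equations defining a connection form, overdetermined but consistent by the previous
  lemma. In the application \<open>X\<close> and \<open>Y\<close> are the logarithmic derivatives of the units with respect
  to \<open>p\<close> and \<open>q\<close>.
\<close>

lemma eta_system_solution:
  assumes "r \<noteq> s" "s \<noteq> t" "r \<noteq> t" "q \<noteq> 0"
  shows "(\<alpha> + \<beta> * q * r = X + (t' - s') / (t - s) + (q * Y + 2) * r \<and>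
      \<alpha> + \<beta> * q * s = X + (r' - t') / (r - t) + (q * Y + 2) * s \<and>
      \<alpha> + \<beta> * q * t = X + (s' - r') / (s - r) + (q * Y + 2) * t) \<longleftrightarrow>
    (\<alpha> = X + ((t' - s') / (t - s) - neg_divided_diff r s t r' s' t' * r) \<and>
     \<beta> = (2 + neg_divided_diff r s t r' s' t') / q + Y)"
    (is "?L \<longleftrightarrow> ?R")
proof -
  define D where "D = neg_divided_diff r s t r' s' t'"
  define f where "f = (t' - s') / (t - s)"
  have a: "(r' - t') / (r - t) = f - D * r + D * s" "(s' - r') / (s - r) = f - D * r + D * t"
    using neg_divided_diff_affine[OF assms(1-3), of t' s' r'] by (auto simp: D_def f_def algebra_simps)
  have "?L \<longleftrightarrow> \<alpha> - X - f + D * r = - (\<beta> * q - q * Y - 2 - D) * r \<and>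
      \<alpha> - X - f + D * r = - (\<beta> * q - q * Y - 2 - D) * s \<and>
      \<alpha> - X - f + D * r = - (\<beta> * q - q * Y - 2 - D) * t"
    unfolding a f_def[symmetric] by (intro arg_cong2[where f = "(\<and>)"]; algebra)
  also have "\<dots> \<longleftrightarrow> \<alpha> - X - f + D * r = 0 \<and> \<beta> * q - q * Y - 2 - D = 0"
    using assms(1) by auto
  also have "\<dots> \<longleftrightarrow> ?R"
    using assms(4) unfolding f_def[symmetric] D_def[symmetric]
    by (intro arg_cong2[where f = "(\<and>)"]) (auto simp: field_simps; algebra)+
  finally show ?thesis .
qed

section \<open>Binary forms and a uniformising parameter\<close>

definition form_eval :: "nat \<Rightarrow> (nat \<Rightarrow> complex) \<Rightarrow> complex \<Rightarrow> complex \<Rightarrow> complex" where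
  "form_eval d \<beta> x y = (\<Sum>i\<le>d. \<beta> i * x ^ i * y ^ (d - i))"

lemma form_eval_scale: "form_eval d \<beta> (r * x) (r * y) = r ^ d * form_eval d \<beta> x y"
proof -
  have "\<beta> i * (r * x) ^ i * (r * y) ^ (d - i) = r ^ d * (\<beta> i * x ^ i * y ^ (d - i))" if "i \<le> d" for i
  proof -
    have "r ^ d = r ^ i * r ^ (d - i)" using that by (simp flip: power_add)
    then show ?thesis by (simp add: power_mult_distrib)
  qed
  then show ?thesis unfolding form_eval_def sum_distrib_left by (intro sum.cong) auto
qed

lemma form_eval_divide:
  "form_eval d \<beta> (x / r) (y / r) = form_eval d \<beta> x y / r ^ d"
  using form_eval_scale[of d \<beta> "1 / r" x y] by (simp add: power_divide)

lemma holomorphic_on_form_eval [holomorphic_intros]: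
  "f holomorphic_on S \<Longrightarrow> g holomorphic_on S \<Longrightarrow> (\<lambda>w. form_eval d \<beta> (f w) (g w)) holomorphic_on S"
  unfolding form_eval_def by (intro holomorphic_intros)

lemma nonzero_on_smaller_ball:
  assumes "isCont f (0::complex)" "f 0 \<noteq> (0::complex)" "r > 0"
  obtains r' where "r' > 0" "r' \<le> r" "\<And>w. w \<in> ball 0 r' \<Longrightarrow> f w \<noteq> 0"
proof -
  obtain e where "e > 0" "\<And>w. dist 0 w < e \<Longrightarrow> f w \<noteq> 0"
    using continuous_at_avoid[OF assms(1,2)] by blast
  then show thesis using assms(3) by (intro that[of "min e r"]) auto
qed

lemma holomorphic_nth_root_on_ball:
  assumes "f holomorphic_on ball z r" "\<And>w. w \<in> ball z r \<Longrightarrow> f w \<noteq> 0" "d > 0"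
  obtains k where "k holomorphic_on ball z r" "\<And>w. w \<in> ball z r \<Longrightarrow> k w ^ d = f w"
proof -
  obtain g where g: "g holomorphic_on ball z r" "\<And>w. w \<in> ball z r \<Longrightarrow> f w = exp (g w)"
    using contractible_imp_holomorphic_log[OF assms(1) convex_imp_contractible[OF convex_ball] assms(2)]
    by blast
  show thesis
  proof
    show "(\<lambda>w. exp (g w / d)) holomorphic_on ball z r"
      using assms(3) by (intro holomorphic_intros g(1)) auto
    show "exp (g w / d) ^ d = f w" if "w \<in> ball z r" for w
      using assms(3) g(2)[OF that] by (simp flip: exp_of_nat_mult)
  qed
qed

text \<open>
  With \<open>e = a + b p0\<close>, let \<open>X\<close> be the first coordinate of the intersection of the line through the
  origin and the point \<open>(\<lambda>, p\<lambda> - 1)\<close> with the fixed line \<open>Y = p0 X - 1\<close>; then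
  \<open>\<lambda> = X / (1 + (p - p0) X)\<close>. In terms of \<open>\<mu> = X - b/e\<close> the equation of the slopes reads
  \<open>c e\<^sup>d \<mu>\<^sup>d + (p - p0) f(\<mu>) = 0\<close> with \<open>f 0 \<noteq> 0\<close>, so \<open>\<mu>\<close> times a holomorphic \<open>d\<close>-th root of
  \<open>- c e\<^sup>d / f(\<mu>)\<close> is a local coordinate whose \<open>d\<close>-th power is \<open>p - p0\<close>. The function \<open>g\<close> is the linear
  form \<open>(a + bp)\<lambda> - b\<close> divided by this coordinate.
\<close>

lemma uniformisation:
  fixes a b c p0 :: complex and \<beta> :: "nat \<Rightarrow> complex"
  assumes d: "d \<ge> 2" and c: "c \<noteq> 0" and e: "a + b * p0 \<noteq> 0"
    and B: "form_eval d \<beta> (- b) a \<noteq> 0"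
  obtains \<rho> g L where "\<rho> > 0" "g holomorphic_on ball 0 \<rho>" "L holomorphic_on ball 0 \<rho>"
    "inj_on L (ball 0 \<rho>)"
    "\<And>w. w \<in> ball 0 \<rho> \<Longrightarrow> a + b * (p0 + w ^ d) \<noteq> 0"
    "\<And>w. w \<in> ball 0 \<rho> \<Longrightarrow> g w \<noteq> 0"
    "\<And>w. w \<in> ball 0 \<rho> \<Longrightarrow> (a + b * (p0 + w ^ d)) * L w = b + w * g w"
    "\<And>w. w \<in> ball 0 \<rho> \<Longrightarrow> c * g w ^ d = - form_eval d \<beta> (L w) ((p0 + w ^ d) * L w - 1)"
proof -
  define e where "e = a + b * p0"
  have e0: "e \<noteq> 0" using e by (simp add: e_def)
  define f where "f \<mu> = form_eval d \<beta> (b / e + \<mu>) (p0 * (b / e + \<mu>) - 1)" for \<mu>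
  have f_hol: "f holomorphic_on S" for S
    unfolding f_def by (intro holomorphic_intros)
  have "f 0 = form_eval d \<beta> ((- b) / (- e)) (a / (- e))"
  proof -
    have "p0 * (b / e + 0) - 1 = a / (- e)" using e0 by (simp add: field_simps) (simp add: e_def algebra_simps)
    then show ?thesis unfolding f_def by simp
  qed
  also have "\<dots> \<noteq> 0" unfolding form_eval_divide using B e0 by simp
  finally have f0: "f 0 \<noteq> 0" .
  have isCont_hol: "isCont h 0" if "h holomorphic_on ball 0 r" "r > 0" for h :: "complex \<Rightarrow> complex" and r
    using holomorphic_on_imp_continuous_on[OF that(1)] that(2)
    by (simp add: continuous_on_eq_continuous_at)
  obtain r where r: "r > 0" "\<And>w. w \<in> ball 0 r \<Longrightarrow> f w \<noteq> 0"
    using nonzero_on_smaller_ball[OF isCont_hol[OF f_hol[of "ball 0 1"]] f0, of 1] by auto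
  have "(\<lambda>w. - c * e ^ d / f w) holomorphic_on ball 0 r"
    using r by (intro holomorphic_intros f_hol) auto
  moreover have "- c * e ^ d / f w \<noteq> 0" if "w \<in> ball 0 r" for w using c e0 r that by auto
  ultimately obtain k where k: "k holomorphic_on ball 0 r"
      "\<And>w. w \<in> ball 0 r \<Longrightarrow> k w ^ d = - c * e ^ d / f w"
    using holomorphic_nth_root_on_ball[of "\<lambda>w. - c * e ^ d / f w" 0 r d] d by auto
  have k_nz: "k w \<noteq> 0" if "w \<in> ball 0 r" for w
  proof
    assume "k w = 0"
    then have "k w ^ d = 0" using d by simp
    then show False using k(2)[OF that] c e0 r(2)[OF that] by simp
  qed
  define H where "H \<mu> = \<mu> * k \<mu>" for \<mu>
  have H_hol: "H holomorphic_on ball 0 r" unfolding H_def by (intro holomorphic_intros k)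
  have dk: "(k has_field_derivative deriv k 0) (at 0)"
    using holomorphic_derivI[OF k(1) open_ball] r by simp
  have "(H has_field_derivative k 0) (at 0)"
    unfolding H_def by (rule derivative_eq_intros dk refl | simp)+
  then have "deriv H 0 = k 0" by (rule DERIV_imp_deriv)
  then have dH: "deriv H 0 \<noteq> 0" using k_nz r by simp
  have in_r: "(0::complex) \<in> ball 0 r" using r(1) by simp
  obtain r' where r': "r' > 0" "ball 0 r' \<subseteq> ball (0::complex) r" "open (H ` ball 0 r')" "inj_on H (ball 0 r')"
    using has_complex_derivative_locally_invertible[OF H_hol in_r open_ball dH] by blast
  obtain \<phi> where \<phi>: "\<phi> holomorphic_on H ` ball 0 r'" "\<And>z. z \<in> ball 0 r' \<Longrightarrow> \<phi> (H z) = z"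
    using holomorphic_has_inverse[OF holomorphic_on_subset[OF H_hol r'(2)] open_ball r'(4)] by metis
  have "0 \<in> H ` ball 0 r'" using r'(1) by (intro image_eqI[of _ _ 0]) (auto simp: H_def)
  then obtain \<rho>1 where \<rho>1: "\<rho>1 > 0" "ball 0 \<rho>1 \<subseteq> H ` ball 0 r'"
    using r'(3) openE by metis
  have \<phi>_ball: "\<phi> w \<in> ball 0 r \<and> H (\<phi> w) = w" if "w \<in> ball 0 \<rho>1" for w
    using \<phi>(2) \<rho>1(2) that r'(2) by force
  have \<phi>_hol: "\<phi> holomorphic_on ball 0 \<rho>1" using \<phi>(1) \<rho>1(2) holomorphic_on_subset by blast
  have \<phi>0: "\<phi> 0 = 0" using \<phi>(2)[of 0] r'(1) by (simp add: H_def)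
  define X where "X w = b / e + \<phi> w" for w
  define Dn where "Dn w = 1 + w ^ d * X w" for w
  define En where "En w = e + b * w ^ d" for w
  have X_hol: "X holomorphic_on ball 0 \<rho>1" unfolding X_def by (intro holomorphic_intros \<phi>_hol)
  have Dn_hol: "Dn holomorphic_on ball 0 \<rho>1" unfolding Dn_def by (intro holomorphic_intros X_hol)
  have En_hol: "En holomorphic_on ball 0 \<rho>1" unfolding En_def by (intro holomorphic_intros)
  have 0: "(0::complex) ^ d = 0" using d by simp
  obtain \<rho>2 where \<rho>2: "\<rho>2 > 0" "\<rho>2 \<le> \<rho>1" "\<And>w. w \<in> ball 0 \<rho>2 \<Longrightarrow> Dn w \<noteq> 0"
    using nonzero_on_smaller_ball[OF isCont_hol[OF Dn_hol \<rho>1(1)] _ \<rho>1(1)] 0 by (auto simp: Dn_def)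
  obtain \<rho>3 where \<rho>3: "\<rho>3 > 0" "\<rho>3 \<le> \<rho>2" "\<And>w. w \<in> ball 0 \<rho>3 \<Longrightarrow> En w \<noteq> 0"
    using nonzero_on_smaller_ball[OF isCont_hol[OF En_hol \<rho>1(1)] _ \<rho>2(1)] 0 e0 by (auto simp: En_def)
  have sub: "ball 0 \<rho>3 \<subseteq> ball (0::complex) \<rho>1" using \<rho>2 \<rho>3 by auto
  define L where "L w = X w / Dn w" for w
  define g where "g w = e / (k (\<phi> w) * Dn w)" for w
  have Dn3: "Dn w \<noteq> 0" if "w \<in> ball 0 \<rho>3" for w using that \<rho>2 \<rho>3 by auto
  have k3: "k (\<phi> w) \<noteq> 0" "\<phi> w * k (\<phi> w) = w" "\<phi> w \<in> ball 0 r" if "w \<in> ball 0 \<rho>3" for w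
    using \<phi>_ball[OF subsetD[OF sub that]] k_nz[of "\<phi> w"] by (auto simp: H_def)
  have L_hol: "L holomorphic_on ball 0 \<rho>3" unfolding L_def
    using Dn3 by (intro holomorphic_intros holomorphic_on_subset[OF X_hol sub] holomorphic_on_subset[OF Dn_hol sub]) auto
  have im: "\<phi> ` ball 0 \<rho>3 \<subseteq> ball 0 r" using k3(3) by blast
  have k\<phi>: "(\<lambda>w. k (\<phi> w)) holomorphic_on ball 0 \<rho>3"
    using holomorphic_on_compose_gen[OF holomorphic_on_subset[OF \<phi>_hol sub] k(1) im]
    by (simp add: o_def)
  have g_hol: "g holomorphic_on ball 0 \<rho>3" unfolding g_def
    using Dn3 k3 by (intro holomorphic_intros holomorphic_on_subset[OF Dn_hol sub] k\<phi>) auto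
  have g_nz: "g w \<noteq> 0" if "w \<in> ball 0 \<rho>3" for w using Dn3 k3 e0 that by (auto simp: g_def)
  have eX: "e * X w = b + e * \<phi> w" for w using e0 by (simp add: X_def field_simps)
  have EL: "(a + b * (p0 + w ^ d)) * L w = b + w * g w" if w: "w \<in> ball 0 \<rho>3" for w
  proof -
    have "w * g w = e * \<phi> w / Dn w"
      using k3[OF w] Dn3[OF w] by (simp add: g_def field_simps)
    then have "b + w * g w = (b * Dn w + e * \<phi> w) / Dn w" using Dn3[OF w] by (simp add: field_simps)
    also have "b * Dn w + e * \<phi> w = (e + b * w ^ d) * X w"
      unfolding distrib_right eX by (simp add: Dn_def algebra_simps)
    finally show ?thesis by (simp add: L_def e_def add_divide_distrib algebra_simps)
  qed
  have gB: "c * g w ^ d = - form_eval d \<beta> (L w) ((p0 + w ^ d) * L w - 1)" if w: "w \<in> ball 0 \<rho>3" for w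
  proof -
    have "(p0 + w ^ d) * L w - 1 = (p0 * X w - 1) / Dn w"
      using Dn3[OF w] by (simp add: L_def field_simps) (simp add: Dn_def algebra_simps)
    then have "form_eval d \<beta> (L w) ((p0 + w ^ d) * L w - 1) = f (\<phi> w) / Dn w ^ d"
      by (simp add: L_def form_eval_divide f_def X_def)
    moreover have "g w ^ d = e ^ d / ((- c * e ^ d / f (\<phi> w)) * Dn w ^ d)"
      using k(2)[OF k3(3)[OF w]] by (simp add: g_def power_divide power_mult_distrib)
    then have "c * g w ^ d = - (f (\<phi> w) / Dn w ^ d)"
      using c e0 r(2)[OF k3(3)[OF w]] Dn3[OF w] by (simp add: field_simps)
    ultimately show ?thesis by simp
  qed
  have L': "(L has_field_derivative deriv L 0) (at 0)"
    using holomorphic_derivI[OF L_hol open_ball] \<rho>3 by simp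
  have g': "(g has_field_derivative deriv g 0) (at 0)"
    using holomorphic_derivI[OF g_hol open_ball] \<rho>3 by simp
  have "((\<lambda>w. b + w * g w) has_field_derivative g 0) (at 0)"
    by (rule derivative_eq_intros g' refl | simp)+
  moreover have "((\<lambda>w. (a + b * (p0 + w ^ d)) * L w) has_field_derivative e * deriv L 0) (at 0)"
    by (rule derivative_eq_intros L' refl | (use d in \<open>simp add: e_def power_0_left\<close>))+
  then have "((\<lambda>w. b + w * g w) has_field_derivative e * deriv L 0) (at 0)"
    by (rule has_field_derivative_transform_within_open[OF _ open_ball[of 0 \<rho>3]])
      (use \<rho>3(1) EL in auto)
  ultimately have "g 0 = e * deriv L 0" by (rule DERIV_unique)
  then have dL: "deriv L 0 \<noteq> 0" using g_nz[of 0] \<rho>3(1) by auto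
  have in_\<rho>3: "(0::complex) \<in> ball 0 \<rho>3" using \<rho>3(1) by simp
  obtain \<rho> where \<rho>: "\<rho> > 0" "ball 0 \<rho> \<subseteq> ball (0::complex) \<rho>3" "inj_on L (ball 0 \<rho>)"
    using has_complex_derivative_locally_injective[OF L_hol in_\<rho>3 open_ball dL] by blast
  show thesis
  proof
    show "\<rho> > 0" "inj_on L (ball 0 \<rho>)" by fact+
    show "g holomorphic_on ball 0 \<rho>" "L holomorphic_on ball 0 \<rho>"
      using g_hol L_hol \<rho>(2) holomorphic_on_subset by blast+
    fix w assume "w \<in> ball (0::complex) \<rho>"
    then have w: "w \<in> ball 0 \<rho>3" using \<rho>(2) by blast
    show "a + b * (p0 + w ^ d) \<noteq> 0" using \<rho>3(3)[OF w] by (simp add: En_def e_def algebra_simps)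
    show "g w \<noteq> 0" "(a + b * (p0 + w ^ d)) * L w = b + w * g w"
      "c * g w ^ d = - form_eval d \<beta> (L w) ((p0 + w ^ d) * L w - 1)"
      using g_nz EL gB w by blast+
  qed
qed

section \<open>Sums over the roots of a complex number\<close>

lemma sum_powers_of_roots:
  fixes s :: complex
  assumes "d > 0" "s \<noteq> 0"
  shows "(\<Sum>w | w ^ d = s. w ^ n) = (if d dvd n then of_nat d * s ^ (n div d) else 0)"
proof (cases "d dvd n")
  case True
  then obtain k where n: "n = d * k" by blast
  have "(\<Sum>w | w ^ d = s. w ^ n) = (\<Sum>w | w ^ d = s. s ^ k)"
    by (intro sum.cong) (auto simp: n power_mult)
  then show ?thesis using True assms by (simp add: n card_nth_roots)
next
  case False
  define \<omega> where "\<omega> = exp (2 * of_real pi * \<i> * of_nat 1 / of_nat d)"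
  have \<omega>d: "\<omega> ^ d = 1" unfolding \<omega>_def using assms(1) by (intro complex_root_unity) auto
  have "\<omega> ^ n = exp (2 * of_real pi * \<i> * of_nat n / of_nat d)"
    by (simp add: \<omega>_def mult_ac flip: exp_of_nat_mult)
  then have \<omega>n: "\<omega> ^ n \<noteq> 1" using complex_root_unity_eq_1[of d n] assms(1) False by simp
  have nz: "\<omega> \<noteq> 0" by (simp add: \<omega>_def)
  let ?S = "\<Sum>w | w ^ d = s. w ^ n"
  have "bij_betw ((*) \<omega>) {w. w ^ d = s} {w. w ^ d = s}"
    by (rule bij_betw_byWitness[where f' = "\<lambda>w. w / \<omega>"])
      (use nz \<omega>d in \<open>auto simp: power_mult_distrib power_divide\<close>)
  then have "?S = (\<Sum>w | w ^ d = s. (\<omega> * w) ^ n)"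
    by (rule sum.reindex_bij_betw[symmetric])
  also have "\<dots> = \<omega> ^ n * ?S" by (simp add: power_mult_distrib sum_distrib_left)
  finally have "(1 - \<omega> ^ n) * ?S = 0" by (simp add: algebra_simps)
  then show ?thesis using \<omega>n False by simp
qed

lemma norm_root_less:
  fixes w :: complex
  assumes "w ^ d = s" "norm s < \<rho> ^ d" "\<rho> > 0"
  shows "w \<in> ball 0 \<rho>"
proof -
  have "norm w ^ d < \<rho> ^ d" using assms by (simp flip: norm_power)
  then have "norm w < \<rho>" using assms(3) by (meson less_eq_real_def power_less_imp_less_base)
  then show ?thesis by simp
qed

text \<open>
  Averaging over the \<open>d\<close>-th roots of \<open>s\<close> keeps the powers of \<open>w\<close> whose exponent is divisible by \<open>d\<close>. Of
  the polar part of \<open>\<Psi> w / w ^ (d + 1)\<close> only the exponent \<open>- d\<close> survives, and its coefficient is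
  \<open>deriv \<Psi> 0\<close>.
\<close>

lemma sum_over_roots_Laurent:
  fixes \<Psi> :: "complex \<Rightarrow> complex"
  assumes \<Psi>: "\<Psi> holomorphic_on ball 0 \<rho>" and d: "d \<ge> 2" and \<rho>: "\<rho> > 0"
  obtains G where "G holomorphic_on ball 0 (\<rho> ^ d)"
    "\<And>s. s \<noteq> 0 \<Longrightarrow> norm s < \<rho> ^ d \<Longrightarrow>
      (\<Sum>w | w ^ d = s. \<Psi> w / w ^ (d + 1)) = of_nat d * deriv \<Psi> 0 / s + G s"
proof -
  define a where "a n = (deriv ^^ n) \<Psi> 0 / fact n" for n
  define E where "E s = (\<Sum>w | w ^ d = s. \<Psi> w / w ^ (d + 1))" for s
  define cf where "cf k = of_nat d * a (1 + Suc k * d)" for k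
  have series: "(\<lambda>k. cf k * s ^ k) sums (E s - of_nat d * a 1 / s)" if s: "s \<noteq> 0" "norm s < \<rho> ^ d" for s
  proof -
    let ?R = "{w. w ^ d = s}"
    have w_nz: "w \<noteq> 0" if "w ^ d = s" for w using that s(1) d by (auto simp: power_0_left)
    \<comment> \<open>Multiplication by \<open>s\<^sup>2 = w ^ (2 * d)\<close> clears the denominators, so that only nonnegative powers
  have to be summed.\<close>
    have "(\<lambda>n. a n * w ^ (n + d - 1)) sums (\<Psi> w * w ^ (d - 1))" if w: "w \<in> ?R" for w
    proof -
      have "(\<lambda>n. a n * w ^ n) sums \<Psi> w"
        using holomorphic_power_series[OF \<Psi> norm_root_less[of w d s \<rho>]] w s \<rho> by (simp add: a_def)
      then have "(\<lambda>n. a n * w ^ n * w ^ (d - 1)) sums (\<Psi> w * w ^ (d - 1))" by (rule sums_mult2)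
      then show ?thesis using d by (simp add: mult.assoc flip: power_add)
    qed
    then have "(\<lambda>n. \<Sum>w\<in>?R. a n * w ^ (n + d - 1)) sums (\<Sum>w\<in>?R. \<Psi> w * w ^ (d - 1))"
      by (rule sums_sum)
    also have "(\<Sum>w\<in>?R. \<Psi> w * w ^ (d - 1)) = s\<^sup>2 * E s"
      unfolding E_def sum_distrib_left
    proof (intro sum.cong refl)
      fix w assume "w \<in> ?R"
      then have w: "w ^ d = s" "w \<noteq> 0" using w_nz by auto
      have "d - 1 + (d + 1) = d + d" using d by simp
      then have "w ^ (d - 1) * w ^ (d + 1) = s\<^sup>2"
        by (simp only: flip: power_add) (simp add: power_add w power2_eq_square)
      then show "\<Psi> w * w ^ (d - 1) = s\<^sup>2 * (\<Psi> w / w ^ (d + 1))"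
        using w(2) by (simp flip: \<open>w ^ (d - 1) * w ^ (d + 1) = s\<^sup>2\<close>)
    qed
    finally have "(\<lambda>n. a n * (\<Sum>w\<in>?R. w ^ (n + d - 1))) sums (s\<^sup>2 * E s)"
      by (simp add: sum_distrib_left)
    moreover have "strict_mono (\<lambda>k. 1 + k * d)" using d by (simp add: strict_mono_Suc_iff)
    moreover have "a n * (\<Sum>w\<in>?R. w ^ (n + d - 1)) = 0" if n: "n \<notin> range (\<lambda>k. 1 + k * d)" for n
    proof -
      have "\<not> d dvd n + d - 1"
      proof
        assume dv: "d dvd n + d - 1"
        show False
        proof (cases n)
          case 0
          then show ?thesis using dv d by (auto dest: dvd_imp_le)
        next
          case (Suc m)
          then have "d dvd m" using dv by simp
          then obtain k where "m = d * k" by blast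
          then have "n = 1 + k * d" using Suc by simp
          then show ?thesis using n by blast
        qed
      qed
      then show ?thesis using sum_powers_of_roots[of d s "n + d - 1"] d s by simp
    qed
    ultimately have "(\<lambda>k. a (1 + k * d) * (\<Sum>w\<in>?R. w ^ (1 + k * d + d - 1))) sums (s\<^sup>2 * E s)"
      by (subst sums_mono_reindex[of "\<lambda>k. 1 + k * d" "\<lambda>n. a n * (\<Sum>w\<in>?R. w ^ (n + d - 1))"]) auto
    moreover have "(\<Sum>w\<in>?R. w ^ (1 + k * d + d - 1)) = of_nat d * s ^ Suc k" for k
    proof -
      have "1 + k * d + d - 1 = d * Suc k" by (simp add: mult.commute)
      moreover have "(\<Sum>w\<in>?R. w ^ (d * Suc k)) = of_nat d * s ^ Suc k"
        using sum_powers_of_roots[of d s "d * Suc k"] d s(1)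
        by (subst (asm) if_P) (auto simp del: mult_Suc_right power_Suc)
      ultimately show ?thesis by (simp only:)
    qed
    ultimately have "(\<lambda>k. a (1 + k * d) * (of_nat d * s ^ Suc k)) sums (s\<^sup>2 * E s)" by simp
    then have "(\<lambda>k. a (1 + Suc k * d) * (of_nat d * s ^ Suc (Suc k))) sums (s\<^sup>2 * E s - a 1 * (of_nat d * s))"
      by (subst sums_Suc_iff) simp
    then have "(\<lambda>k. a (1 + Suc k * d) * (of_nat d * s ^ Suc (Suc k)) / s\<^sup>2) sums
        ((s\<^sup>2 * E s - a 1 * (of_nat d * s)) / s\<^sup>2)"
      by (rule sums_divide)
    moreover have "(s\<^sup>2 * E s - a 1 * (of_nat d * s)) / s\<^sup>2 = E s - of_nat d * a 1 / s"
      using s(1) by (simp add: power2_eq_square diff_divide_distrib)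
    ultimately show ?thesis
      using s(1) by (simp add: cf_def power2_eq_square mult_ac)
  qed
  define G where "G s = (\<Sum>k. cf k * s ^ k)" for s
  have "(\<lambda>k. cf k * (s - 0) ^ k) sums G s" if "s \<in> ball 0 (\<rho> ^ d)" for s
  proof (cases "s = 0")
    case True
    then show ?thesis
      unfolding G_def using powser_sums_zero[of cf] by (simp add: powser_zero)
  next
    case False
    then have "summable (\<lambda>k. cf k * s ^ k)" using series[of s] that sums_summable by auto
    then show ?thesis unfolding G_def by (simp add: summable_sums)
  qed
  then have "G holomorphic_on ball 0 (\<rho> ^ d)" by (rule power_series_holomorphic)
  moreover have "E s = of_nat d * deriv \<Psi> 0 / s + G s" if "s \<noteq> 0" "norm s < \<rho> ^ d" for s
    using sums_unique[OF series[OF that]] by (simp add: G_def a_def diff_eq_eq add.commute)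
  ultimately show thesis using that unfolding E_def by blast
qed

section \<open>The slopes of the web\<close>

definition form_poly :: "nat \<Rightarrow> (nat \<Rightarrow> complex) \<Rightarrow> complex poly \<Rightarrow> complex poly \<Rightarrow> complex poly" where
  "form_poly d \<beta> X Y = (\<Sum>i\<le>d. smult (\<beta> i) (X ^ i * Y ^ (d - i)))"

lemma poly_form_poly: "poly (form_poly d \<beta> X Y) h = form_eval d \<beta> (poly X h) (poly Y h)"
  by (simp add: form_poly_def form_eval_def poly_sum algebra_simps)

lemma coeff_power_linear_top:
  fixes x y :: complex
  shows "coeff ([:x, y:] ^ n) n = y ^ n" "degree ([:x, y:] ^ n) \<le> n"
proof -
  show "coeff ([:x, y:] ^ n) n = y ^ n" by (simp add: coeff_linear_poly_power)
  have "degree [:x, y:] \<le> 1" by simp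
  then show "degree ([:x, y:] ^ n) \<le> n" using degree_power_le[of "[:x, y:]" n]
    by (metis le_trans mult_le_mono1 nat_mult_1)
qed

lemma coeff_mult_top:
  fixes P Q :: "complex poly"
  assumes "degree P \<le> m" "degree Q \<le> n"
  shows "coeff (P * Q) (m + n) = coeff P m * coeff Q n"
proof -
  have "coeff P i * coeff Q (m + n - i) = 0" if "i \<noteq> m" for i
    using that assms by (cases "i < m") (auto simp: coeff_eq_0)
  then have "coeff (P * Q) (m + n) = (\<Sum>i\<in>{m}. coeff P i * coeff Q (m + n - i))"
    unfolding coeff_mult by (intro sum.mono_neutral_right) auto
  then show ?thesis by simp
qed

lemma form_poly_linear_top:
  "coeff (form_poly d \<beta> [:x0, x1:] [:y0, y1:]) d = form_eval d \<beta> x1 y1"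
  "degree (form_poly d \<beta> [:x0, x1:] [:y0, y1:]) \<le> d"
proof -
  have deg: "degree ([:x0, x1:] ^ i * [:y0, y1:] ^ (d - i)) \<le> d" if "i \<le> d" for i
    using degree_mult_le[of "[:x0, x1:] ^ i" "[:y0, y1:] ^ (d - i)"]
      coeff_power_linear_top(2)[of x0 x1 i] coeff_power_linear_top(2)[of y0 y1 "d - i"] that
    by linarith
  then show "degree (form_poly d \<beta> [:x0, x1:] [:y0, y1:]) \<le> d"
    unfolding form_poly_def by (intro degree_sum_le) (auto intro: order_trans[OF degree_smult_le])
  have "coeff ([:x0, x1:] ^ i * [:y0, y1:] ^ (d - i)) d = x1 ^ i * y1 ^ (d - i)" if "i \<le> d" for i
  proof -
    have "coeff ([:x0, x1:] ^ i * [:y0, y1:] ^ (d - i)) (i + (d - i)) =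
        coeff ([:x0, x1:] ^ i) i * coeff ([:y0, y1:] ^ (d - i)) (d - i)"
      by (intro coeff_mult_top coeff_power_linear_top)
    then show ?thesis using that by (simp add: coeff_power_linear_top)
  qed
  then show "coeff (form_poly d \<beta> [:x0, x1:] [:y0, y1:]) d = form_eval d \<beta> x1 y1"
    by (simp add: form_poly_def form_eval_def coeff_sum mult.assoc)
qed

text \<open>
  The binary form at \<open>(z + h, p (z + h) - 1)\<close> as a polynomial in \<open>h\<close>.
\<close>

definition taylor_form :: "nat \<Rightarrow> (nat \<Rightarrow> complex) \<Rightarrow> complex \<Rightarrow> complex \<Rightarrow> complex poly" where
  "taylor_form d \<beta> p z = form_poly d \<beta> [:z, 1:] [:p * z - 1, p:]"

lemma poly_taylor_form: "poly (taylor_form d \<beta> p z) h = form_eval d \<beta> (z + h) (p * (z + h) - 1)"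
  by (simp add: taylor_form_def poly_form_poly algebra_simps)

lemma taylor_form_top:
  "coeff (taylor_form d \<beta> p z) d = form_eval d \<beta> 1 p" "degree (taylor_form d \<beta> p z) \<le> d"
  by (simp_all add: taylor_form_def form_poly_linear_top)

text \<open>
  The common shape of the Legendre transform in both charts. The dual curve of the inflection line
  \<open>ax + by = 0\<close> is \<open>p = p0\<close>, and \<open>\<beta>\<close> lists the coefficients of the coefficient form that does not
  vanish on the line. The hypothesis \<open>a + b * p0 \<noteq> 0\<close> says that the line is not invariant.
\<close>

locale dual_web =
  fixes d :: nat and a b c p0 :: complex and \<beta> :: "nat \<Rightarrow> complex"
  assumes d3: "d \<ge> 3" and c0: "c \<noteq> 0" and e0: "a + b * p0 \<noteq> 0"
    and B0: "form_eval d \<beta> (- b) a \<noteq> 0"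
begin

definition web_form :: symform where
  "web_form m t = c * (a * snd t + b * (fst m * snd t - snd m * fst t)) ^ d +
     (fst m - p0) * form_eval d \<beta> (snd t) (fst m * snd t - snd m * fst t)"

text \<open>
  The equation of the slopes: the direction \<open>dq = q z dp\<close> is tangent to the web at \<open>(p, q)\<close> if and
  only if \<open>slope_fun p z = 0\<close>, for \<open>q \<noteq> 0\<close>. Its leading coefficient as a polynomial in \<open>z\<close> is
  \<open>slope_lead p\<close>.
\<close>

definition slope_fun :: "complex \<Rightarrow> complex \<Rightarrow> complex" where
  "slope_fun p z = c * ((a + b * p) * z - b) ^ d + (p - p0) * form_eval d \<beta> z (p * z - 1)"

definition slope_lead :: "complex \<Rightarrow> complex" where
  "slope_lead p = c * (a + b * p) ^ d + (p - p0) * form_eval d \<beta> 1 p"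

lemma web_form_slope: "web_form (p, q) (x, q * x * z) = (q * x) ^ d * slope_fun p z"
proof -
  have "a * (q * x * z) + b * (p * (q * x * z) - q * x) = (q * x) * ((a + b * p) * z - b)"
    "p * (q * x * z) - q * x = (q * x) * (p * z - 1)"
    by (simp_all add: algebra_simps)
  then show ?thesis
    using form_eval_scale[of d \<beta> "q * x" z "p * z - 1"]
    by (simp add: web_form_def slope_fun_def power_mult_distrib distrib_left mult.assoc mult.left_commute)
qed

lemma web_form_vertical: "web_form (p, q) (0, y) = y ^ d * slope_lead p"
proof -
  have "a * y + b * (p * y) = y * (a + b * p)" by (simp add: algebra_simps)
  then have "(a * y + b * (p * y)) ^ d = y ^ d * (a + b * p) ^ d" by (simp only: power_mult_distrib)
  then show ?thesis
    using form_eval_scale[of d \<beta> y 1 p]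
    by (simp add: web_form_def slope_lead_def distrib_left mult.commute mult.left_commute)
qed

text \<open>\<open>slope_fun p (z + h)\<close> as a polynomial in \<open>h\<close>.\<close>

definition slope_taylor :: "complex \<Rightarrow> complex \<Rightarrow> complex poly" where
  "slope_taylor p z = smult c ([:(a + b * p) * z - b, a + b * p:] ^ d) + smult (p - p0) (taylor_form d \<beta> p z)"

lemma poly_slope_taylor: "poly (slope_taylor p z) h = slope_fun p (z + h)"
  by (simp add: slope_taylor_def slope_fun_def poly_taylor_form algebra_simps)

lemma slope_taylor_top: "coeff (slope_taylor p z) d = slope_lead p" "degree (slope_taylor p z) \<le> d"
proof -
  show "coeff (slope_taylor p z) d = slope_lead p"
    by (simp add: slope_taylor_def slope_lead_def taylor_form_top coeff_power_linear_top)
  show "degree (slope_taylor p z) \<le> d" unfolding slope_taylor_def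
    by (intro degree_add_le order_trans[OF degree_smult_le] taylor_form_top coeff_power_linear_top)
qed

lemma slope_fun_eq_prod:
  assumes "\<And>i. i < d \<Longrightarrow> slope_fun p (l i) = 0" "inj_on l {..<d}"
  shows "slope_fun p z = slope_lead p * (\<Prod>i<d. z - l i)"
proof -
  let ?P = "smult (slope_lead p) (\<Prod>i<d. [:- l i, 1:])"
  have "degree (\<Prod>i<d. [:- l i, 1:]) = d" "lead_coeff (\<Prod>i<d. [:- l i, 1:]) = 1"
    by (subst degree_prod_eq_sum_degree) (auto simp: lead_coeff_prod)
  then have "slope_taylor p 0 = ?P"
    using assms
    by (intro poly_eqI_degree_lead_coeff[of _ d _ "l ` {..<d}"])
      (auto simp: slope_taylor_top card_image poly_slope_taylor poly_prod intro: order_trans[OF degree_smult_le])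
  then have "poly (slope_taylor p 0) z = poly ?P z" by simp
  then show ?thesis by (simp add: poly_slope_taylor poly_prod)
qed

text \<open>
  At a root \<open>l i\<close> the Taylor polynomial is \<open>h\<close> times the product of the factors \<open>h + (l i - l j)\<close>,
  whose coefficients are elementary symmetric functions of the differences.
\<close>

lemma slope_taylor_coeffs:
  assumes slope_fun: "\<And>z. slope_fun p z = slope_lead p * (\<Prod>i<d. z - l i)" and inj: "inj_on l {..<d}" and i: "i < d"
    and slope_lead: "slope_lead p \<noteq> 0"
  shows "coeff (slope_taylor p (l i)) 1 \<noteq> 0"
    "(\<Sum>j\<in>{..<d} - {i}. \<Sum>k\<in>{..<d} - {i} - {j}. 1 / ((l i - l j) * (l i - l k))) =
      2 * (coeff (slope_taylor p (l i)) 3 / coeff (slope_taylor p (l i)) 1)"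
proof -
  let ?S = "{..<d} - {i}"
  let ?Q = "\<Prod>j\<in>?S. [:l i - l j, 1:]"
  have nz: "l i - l j \<noteq> 0" if "j \<in> ?S" for j using that inj i by (auto dest: inj_onD)
  have "poly (slope_taylor p (l i)) h = poly (smult (slope_lead p) (pCons 0 ?Q)) h" for h
  proof -
    have "poly (slope_taylor p (l i)) h = slope_lead p * (\<Prod>j<d. h + (l i - l j))"
      by (simp add: poly_slope_taylor slope_fun algebra_simps)
    also have "(\<Prod>j<d. h + (l i - l j)) = h * (\<Prod>j\<in>?S. h + (l i - l j))"
      using i by (subst prod.remove[of _ i]) auto
    finally show ?thesis by (simp add: poly_prod algebra_simps)
  qed
  then have slope_taylor: "slope_taylor p (l i) = smult (slope_lead p) (pCons 0 ?Q)"
    using poly_eq_poly_eq_iff by blast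
  have Q0: "coeff ?Q 0 \<noteq> 0"
    using nz by (simp add: poly_0_coeff_0[symmetric] poly_prod)
  have c1: "coeff (slope_taylor p (l i)) 1 = slope_lead p * coeff ?Q 0" unfolding slope_taylor by simp
  have c3: "coeff (slope_taylor p (l i)) 3 = slope_lead p * coeff ?Q 2" unfolding slope_taylor by (simp add: numeral_3_eq_3 numeral_2_eq_2)
  show "coeff (slope_taylor p (l i)) 1 \<noteq> 0" using c1 slope_lead Q0 by simp
  have e2: "2 * coeff ?Q 2 = coeff ?Q 0 * (\<Sum>j\<in>?S. \<Sum>k\<in>?S - {j}. 1 / ((l i - l j) * (l i - l k)))"
    by (rule coeff_2_prod_linear) (use nz in auto)
  have "2 * (coeff (slope_taylor p (l i)) 3 / coeff (slope_taylor p (l i)) 1) = 2 * coeff ?Q 2 / coeff ?Q 0"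
    unfolding c1 c3 using slope_lead by simp
  also have "\<dots> = (\<Sum>j\<in>?S. \<Sum>k\<in>?S - {j}. 1 / ((l i - l j) * (l i - l k)))"
    using Q0 by (simp add: e2)
  finally show "(\<Sum>j\<in>?S. \<Sum>k\<in>?S - {j}. 1 / ((l i - l j) * (l i - l k))) =
      2 * (coeff (slope_taylor p (l i)) 3 / coeff (slope_taylor p (l i)) 1)" ..
qed

end

section \<open>Curvature in terms of the slopes\<close>

lemma holo2_partial_derivatives:
  assumes "holo2 f U" "(p, q) \<in> U"
  shows "((\<lambda>s. f (s, q)) has_field_derivative pdu f (p, q)) (at p)"
    "((\<lambda>s. f (p, s)) has_field_derivative pdv f (p, q)) (at q)"
proof -
  obtain \<alpha> \<gamma> where f: "(f has_derivative (\<lambda>(h, k). \<alpha> * h + \<gamma> * k)) (at (p, q))"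
    using assms by (auto simp: holo2_def)
  have "((\<lambda>s. (s, q)) has_derivative (\<lambda>h. (h, 0))) (at p)"
    by (auto intro!: derivative_eq_intros)
  from has_derivative_compose[OF this f]
  have u: "((\<lambda>s. f (s, q)) has_field_derivative \<alpha>) (at p)"
    by (simp add: has_field_derivative_def)
  then show "((\<lambda>s. f (s, q)) has_field_derivative pdu f (p, q)) (at p)"
    by (simp add: pdu_def DERIV_imp_deriv)
  have "((\<lambda>s. (p, s)) has_derivative (\<lambda>h. (0, h))) (at q)"
    by (auto intro!: derivative_eq_intros)
  from has_derivative_compose[OF this f]
  have v: "((\<lambda>s. f (p, s)) has_field_derivative \<gamma>) (at q)"
    by (simp add: has_field_derivative_def)
  then show "((\<lambda>s. f (p, s)) has_field_derivative pdv f (p, q)) (at q)"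
    by (simp add: pdv_def DERIV_imp_deriv)
qed

text \<open>
  Equal to the sum of \<open>neg_divided_diff\<close> over all triples of slopes; see \<open>sum_bterm\<close>.
\<close>

definition (in dual_web) root_sum :: "(nat \<Rightarrow> complex \<Rightarrow> complex) \<Rightarrow> complex \<Rightarrow> complex" where
  "root_sum l p = - (\<Sum>i<d. deriv (l i) p * (coeff (slope_taylor p (l i p)) 3 / coeff (slope_taylor p (l i p)) 1))"

text \<open>
  A factorization of the web near a point with \<open>q \<noteq> 0\<close>, normalised as \<open>\<theta> i = u (dq - q (l i p) dp)\<close>
  with a unit \<open>u\<close> that may depend on \<open>i\<close>, \<open>p\<close> and \<open>q\<close>.
\<close>

locale local_web = dual_web +
  fixes \<theta> :: "nat \<Rightarrow> form1" and P Q :: "complex set" and l :: "nat \<Rightarrow> complex \<Rightarrow> complex"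
  assumes oP: "open P" and oQ: "open Q" and Q0: "0 \<notin> Q"
    and snd_hol: "\<And>i. i < d \<Longrightarrow> holo2 (\<lambda>m. snd (\<theta> i m)) (P \<times> Q)"
    and l_hol: "\<And>i. i < d \<Longrightarrow> l i holomorphic_on P"
    and snd_nz: "\<And>i p q. i < d \<Longrightarrow> p \<in> P \<Longrightarrow> q \<in> Q \<Longrightarrow> snd (\<theta> i (p, q)) \<noteq> 0"
    and fst_eq: "\<And>i p q. i < d \<Longrightarrow> p \<in> P \<Longrightarrow> q \<in> Q \<Longrightarrow>
      fst (\<theta> i (p, q)) = - q * l i p * snd (\<theta> i (p, q))"
    and prod_snd: "\<And>p q. p \<in> P \<Longrightarrow> q \<in> Q \<Longrightarrow> (\<Prod>i<d. snd (\<theta> i (p, q))) = slope_lead p"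
    and l_inj: "\<And>p. p \<in> P \<Longrightarrow> inj_on (\<lambda>i. l i p) {..<d}"
    and slope_fun_prod: "\<And>p z. p \<in> P \<Longrightarrow> slope_fun p z = slope_lead p * (\<Prod>i<d. z - l i p)"
begin

definition dlog_u :: "nat \<Rightarrow> point2 \<Rightarrow> complex" where
  "dlog_u i m = pdu (\<lambda>m. snd (\<theta> i m)) m / snd (\<theta> i m)"

definition dlog_v :: "nat \<Rightarrow> point2 \<Rightarrow> complex" where
  "dlog_v i m = pdv (\<lambda>m. snd (\<theta> i m)) m / snd (\<theta> i m)"

lemma l_neq: "p \<in> P \<Longrightarrow> i < d \<Longrightarrow> j < d \<Longrightarrow> i \<noteq> j \<Longrightarrow> l i p \<noteq> l j p"
  using l_inj[of p] by (auto dest: inj_onD)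

text \<open>
  Both sides are divided by the common factor \<open>M\<close> in the proof, the product of the three units,
  of \<open>q\<close> and of \<open>l k p - l j p\<close>. The summand \<open>2\<close> next to \<open>q * Y\<close> comes from the two factors \<open>q\<close> that
  \<open>\<delta> * fst (\<theta> i)\<close> contains.
\<close>

lemma eta_equation:
  assumes ijk: "i < d" "j < d" "k < d" "j \<noteq> k" and p: "p \<in> P" and q: "q \<in> Q"
  shows "ext_d (fmult (wedge (\<theta> j) (\<theta> k)) (\<theta> i)) (p, q) =
      wedge \<eta> (fmult (wedge (\<theta> j) (\<theta> k)) (\<theta> i)) (p, q) \<longleftrightarrow>
    fst (\<eta> (p, q)) + snd (\<eta> (p, q)) * q * l i p =
      (dlog_u i (p, q) + dlog_u j (p, q) + dlog_u k (p, q)) +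
      (deriv (l k) p - deriv (l j) p) / (l k p - l j p) +
      (q * (dlog_v i (p, q) + dlog_v j (p, q) + dlog_v k (p, q)) + 2) * l i p"
proof -
  define u where "u i m = snd (\<theta> i m)" for i m
  define \<delta> where "\<delta> = wedge (\<theta> j) (\<theta> k)"
  have \<delta>: "\<delta> (s, t) = t * (l k s - l j s) * (u j (s, t) * u k (s, t))" if "s \<in> P" "t \<in> Q" for s t
    using fst_eq[OF ijk(2) that] fst_eq[OF ijk(3) that]
    by (simp add: \<delta>_def wedge_def u_def algebra_simps)
  have nz: "u i (p, q) \<noteq> 0" "u j (p, q) \<noteq> 0" "u k (p, q) \<noteq> 0"
    using snd_nz p q ijk by (auto simp: u_def)
  have dl: "(l i has_field_derivative deriv (l i) p) (at p)" if "i < d" for i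
    using holomorphic_derivI[OF l_hol[OF that] oP p] .
  have du: "((\<lambda>s. u i (s, q)) has_field_derivative dlog_u i (p, q) * u i (p, q)) (at p)"
    "((\<lambda>s. u i (p, s)) has_field_derivative dlog_v i (p, q) * u i (p, q)) (at q)" if "i < d" for i
    using holo2_partial_derivatives[OF snd_hol[OF that], of p q] snd_nz[OF that p q] p q
    by (simp_all add: u_def dlog_u_def dlog_v_def)
  define G where "G = u i (p, q) * u j (p, q) * u k (p, q)"
  define X where "X = dlog_u i (p, q) + dlog_u j (p, q) + dlog_u k (p, q)"
  define Y where "Y = dlog_v i (p, q) + dlog_v j (p, q) + dlog_v k (p, q)"
  define dl' where "dl' = deriv (l k) p - deriv (l j) p"
  have "((\<lambda>s. q * (l k s - l j s) * (u i (s, q) * u j (s, q) * u k (s, q))) has_field_derivative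
      q * dl' * G + q * (l k p - l j p) * (X * G)) (at p)"
    unfolding dl'_def X_def G_def
    by (rule derivative_eq_intros dl du ijk refl | simp add: algebra_simps)+
  then have "((\<lambda>s. snd (fmult \<delta> (\<theta> i) (s, q))) has_field_derivative
      q * dl' * G + q * (l k p - l j p) * (X * G)) (at p)"
    by (rule has_field_derivative_transform_within_open[OF _ oP p])
      (simp add: fmult_def \<delta> q, simp add: u_def)
  then have pu: "pdu (\<lambda>m. snd (fmult \<delta> (\<theta> i) m)) (p, q) =
      q * dl' * G + q * (l k p - l j p) * (X * G)"
    by (simp add: pdu_def DERIV_imp_deriv)
  have "((\<lambda>t. - (t\<^sup>2 * ((l k p - l j p) * l i p)) * (u i (p, t) * u j (p, t) * u k (p, t))) has_field_derivative
      - (l k p - l j p) * l i p * (2 * q * G + q\<^sup>2 * (Y * G))) (at q)"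
    unfolding Y_def G_def
    by (rule derivative_eq_intros du ijk refl | simp add: algebra_simps power2_eq_square)+
  then have "((\<lambda>t. fst (fmult \<delta> (\<theta> i) (p, t))) has_field_derivative
      - (l k p - l j p) * l i p * (2 * q * G + q\<^sup>2 * (Y * G))) (at q)"
    by (rule has_field_derivative_transform_within_open[OF _ oQ q])
      (simp add: fmult_def \<delta> p fst_eq ijk, simp add: u_def power2_eq_square algebra_simps)
  then have pv: "pdv (\<lambda>m. fst (fmult \<delta> (\<theta> i) m)) (p, q) =
      - (l k p - l j p) * l i p * (2 * q * G + q\<^sup>2 * (Y * G))"
    by (simp add: pdv_def DERIV_imp_deriv)
  define M where "M = G * q * (l k p - l j p)"
  have lnz: "l k p - l j p \<noteq> 0" using l_neq[OF p ijk(3,2)] ijk by auto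
  have "q \<noteq> 0" using q Q0 by auto
  then have M: "M \<noteq> 0" using nz lnz by (simp add: M_def G_def)
  have "ext_d (fmult \<delta> (\<theta> i)) (p, q) = M * (X + dl' / (l k p - l j p) + (q * Y + 2) * l i p)"
  proof -
    have "M * (dl' / (l k p - l j p)) = q * dl' * G" using lnz by (simp add: M_def)
    then show ?thesis unfolding ext_d_def pu pv distrib_left
      by (simp add: M_def algebra_simps power2_eq_square)
  qed
  moreover have "wedge \<eta> (fmult \<delta> (\<theta> i)) (p, q) = M * (fst (\<eta> (p, q)) + snd (\<eta> (p, q)) * q * l i p)"
    using fst_eq[OF ijk(1) p q]
    by (simp add: wedge_def fmult_def \<delta> p q M_def G_def flip: u_def) (simp add: algebra_simps)
  ultimately show ?thesis
    using M unfolding \<delta>_def[symmetric] X_def[symmetric] Y_def[symmetric] dl'_def[symmetric]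
    by (metis mult_cancel_left)
qed

text \<open>
  Together with \<open>aterm\<close> the part of the connection form that does not involve the units; both are
  symmetric in the three indices.
\<close>

definition bterm :: "nat \<Rightarrow> nat \<Rightarrow> nat \<Rightarrow> complex \<Rightarrow> complex" where
  "bterm r s t p = neg_divided_diff (l r p) (l s p) (l t p) (deriv (l r) p) (deriv (l s) p) (deriv (l t) p)"

definition aterm :: "nat \<Rightarrow> nat \<Rightarrow> nat \<Rightarrow> complex \<Rightarrow> complex" where
  "aterm r s t p = (deriv (l t) p - deriv (l s) p) / (l t p - l s p) - bterm r s t p * l r p"

lemma eta_solution:
  assumes rst: "r < s" "s < t" "t < d" and p: "p \<in> P" and q: "q \<in> Q"
  shows "eta_form (\<theta> r) (\<theta> s) (\<theta> t) {(p, q)} \<eta> \<longleftrightarrow>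
    fst (\<eta> (p, q)) = (dlog_u r (p, q) + dlog_u s (p, q) + dlog_u t (p, q)) + aterm r s t p \<and>
    snd (\<eta> (p, q)) = (2 + bterm r s t p) / q + (dlog_v r (p, q) + dlog_v s (p, q) + dlog_v t (p, q))"
proof -
  have lt: "r < d" "s < d" "t < d" "s \<noteq> t" "t \<noteq> r" "r \<noteq> s" using rst by auto
  have "q \<noteq> 0" using q Q0 by auto
  have X: "dlog_u s (p, q) + dlog_u t (p, q) + dlog_u r (p, q) = dlog_u r (p, q) + dlog_u s (p, q) + dlog_u t (p, q)"
    "dlog_u t (p, q) + dlog_u r (p, q) + dlog_u s (p, q) = dlog_u r (p, q) + dlog_u s (p, q) + dlog_u t (p, q)"
    "dlog_v s (p, q) + dlog_v t (p, q) + dlog_v r (p, q) = dlog_v r (p, q) + dlog_v s (p, q) + dlog_v t (p, q)"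
    "dlog_v t (p, q) + dlog_v r (p, q) + dlog_v s (p, q) = dlog_v r (p, q) + dlog_v s (p, q) + dlog_v t (p, q)"
    by simp_all
  show ?thesis
    unfolding eta_form_def ball_simps
    using eta_equation[of r s t p q \<eta>] eta_equation[of s t r p q \<eta>] eta_equation[of t r s p q \<eta>] lt p q
      eta_system_solution[of "l r p" "l s p" "l t p" q "fst (\<eta> (p, q))" "snd (\<eta> (p, q))"
        "dlog_u r (p, q) + dlog_u s (p, q) + dlog_u t (p, q)" "deriv (l t) p" "deriv (l s) p"
        "dlog_v r (p, q) + dlog_v s (p, q) + dlog_v t (p, q)" "deriv (l r) p"]
      l_neq[of p r s] l_neq[of p s t] l_neq[of p r t] \<open>q \<noteq> 0\<close>
    unfolding X aterm_def bterm_def by simp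
qed

abbreviation triples :: "(nat \<times> nat \<times> nat) set" where
  "triples \<equiv> {(r, s, t). r < s \<and> s < t \<and> t < d}"

lemma slope_lead_nz: assumes "p \<in> P" "Q \<noteq> {}" shows "slope_lead p \<noteq> 0"
proof -
  obtain q where "q \<in> Q" using assms by blast
  then show ?thesis using prod_snd[of p q] snd_nz assms(1) by (auto simp flip: prod_snd)
qed

lemma sum_bterm:
  assumes p: "p \<in> P" and Q: "Q \<noteq> {}"
  shows "(\<Sum>(r, s, t)\<in>triples. bterm r s t p) = root_sum l p"
proof -
  define \<Phi> where "\<Phi> i j k = - (deriv (l i) p * (1 / ((l i p - l j p) * (l i p - l k p))))" for i j k
  have "2 * (\<Sum>(r, s, t)\<in>triples. bterm r s t p) =
      2 * (\<Sum>(r, s, t)\<in>triples. \<Phi> r s t + \<Phi> s r t + \<Phi> t r s)"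
    by (intro arg_cong2[where f = "(*)"] sum.cong refl) (auto simp: bterm_def neg_divided_diff_def \<Phi>_def)
  also have "\<dots> = (\<Sum>i<d. \<Sum>j\<in>{..<d} - {i}. \<Sum>k\<in>{..<d} - {i} - {j}. \<Phi> i j k)"
    by (rule sum_triples_symmetrise) (simp add: \<Phi>_def mult.commute)
  also have "\<dots> = (\<Sum>i<d. - (deriv (l i) p * (\<Sum>j\<in>{..<d} - {i}. \<Sum>k\<in>{..<d} - {i} - {j}.
      1 / ((l i p - l j p) * (l i p - l k p)))))"
    by (simp add: \<Phi>_def sum_distrib_left sum_negf)
  also have "\<dots> = (\<Sum>i<d. - (deriv (l i) p * (2 * (coeff (slope_taylor p (l i p)) 3 / coeff (slope_taylor p (l i p)) 1))))"
    using slope_taylor_coeffs(2)[of p "\<lambda>i. l i p", OF slope_fun_prod[OF p] l_inj[OF p] _ slope_lead_nz[OF p Q]]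
    by (intro sum.cong refl) simp
  also have "\<dots> = 2 * root_sum l p"
    by (simp add: root_sum_def sum_distrib_left sum_negf mult.left_commute)
  finally show ?thesis by simp
qed

lemma sum_triples_cyclic:
  fixes x :: "nat \<Rightarrow> complex"
  shows "2 * (\<Sum>(r, s, t)\<in>triples. x r + x s + x t) = of_nat ((d - 1) * (d - 2)) * (\<Sum>i<d. x i)"
proof -
  have "2 * (\<Sum>(r, s, t)\<in>triples. x r + x s + x t) =
      (\<Sum>i<d. \<Sum>j\<in>{..<d} - {i}. \<Sum>k\<in>{..<d} - {i} - {j}. x i)"
    by (rule sum_triples_symmetrise[of "\<lambda>i j k. x i"]) simp
  also have "\<dots> = (\<Sum>i<d. of_nat ((d - 1) * (d - 2)) * x i)"
    using d3 by (intro sum.cong refl) (simp add: card_Diff_singleton_if mult.assoc of_nat_diff)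
  finally show ?thesis by (simp add: sum_distrib_left)
qed

text \<open>
  The units enter the curvature only through these two sums, because the connection forms are summed
  over all triples; and the product of the units does not involve \<open>q\<close>.
\<close>

lemma sum_dlog:
  assumes p: "p \<in> P" and q: "q \<in> Q"
  shows "(\<Sum>i<d. dlog_u i (p, q)) = deriv slope_lead p / slope_lead p" "(\<Sum>i<d. dlog_v i (p, q)) = 0"
proof -
  have Nnz: "slope_lead p \<noteq> 0" using slope_lead_nz p q by auto
  have "((\<lambda>s. \<Prod>i<d. snd (\<theta> i (s, q))) has_field_derivative
      (\<Prod>i<d. snd (\<theta> i (p, q))) * (\<Sum>i<d. dlog_u i (p, q))) (at p)"
    unfolding dlog_u_def
    by (rule has_field_derivative_prod')
      (use snd_nz p q holo2_partial_derivatives[OF snd_hol] in auto)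
  then have "((\<lambda>s. \<Prod>i<d. snd (\<theta> i (s, q))) has_field_derivative
      slope_lead p * (\<Sum>i<d. dlog_u i (p, q))) (at p)"
    by (simp add: prod_snd p q)
  then have "(slope_lead has_field_derivative slope_lead p * (\<Sum>i<d. dlog_u i (p, q))) (at p)"
    by (rule has_field_derivative_transform_within_open[OF _ oP p]) (simp add: prod_snd q)
  then show "(\<Sum>i<d. dlog_u i (p, q)) = deriv slope_lead p / slope_lead p"
    using Nnz by (simp add: DERIV_imp_deriv)
  have "((\<lambda>s. \<Prod>i<d. snd (\<theta> i (p, s))) has_field_derivative
      (\<Prod>i<d. snd (\<theta> i (p, q))) * (\<Sum>i<d. dlog_v i (p, q))) (at q)"
    unfolding dlog_v_def
    by (rule has_field_derivative_prod')
      (use snd_nz p q holo2_partial_derivatives[OF snd_hol] in auto)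
  then have "((\<lambda>s. \<Prod>i<d. snd (\<theta> i (p, s))) has_field_derivative
      slope_lead p * (\<Sum>i<d. dlog_v i (p, q))) (at q)"
    by (simp add: prod_snd p q)
  then have "((\<lambda>s. slope_lead p) has_field_derivative slope_lead p * (\<Sum>i<d. dlog_v i (p, q))) (at q)"
    by (rule has_field_derivative_transform_within_open[OF _ oQ q]) (simp add: prod_snd p)
  then have "slope_lead p * (\<Sum>i<d. dlog_v i (p, q)) = 0"
    by (rule DERIV_unique[OF _ DERIV_const])
  then show "(\<Sum>i<d. dlog_v i (p, q)) = 0" using Nnz by simp
qed

text \<open>
  The \<open>dp\<close>-coefficient of the sum of the connection forms depends on \<open>p\<close> alone and drops out of the
  exterior derivative.
\<close>

lemma curvature_value:
  assumes eta: "\<And>r s t. r < s \<Longrightarrow> s < t \<Longrightarrow> t < d \<Longrightarrow> eta_form (\<theta> r) (\<theta> s) (\<theta> t) (P \<times> Q) (\<eta> r s t)"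
    and p: "p \<in> P" and q: "q \<in> Q" and E': "(root_sum l has_field_derivative E') (at p)"
  shows "ext_d (\<lambda>z. \<Sum>(r, s, t)\<in>triples. \<eta> r s t z) (p, q) = E' / q"
proof -
  define K where "K = of_nat ((d - 1) * (d - 2)) / (2 :: complex)"
  define \<alpha> where "\<alpha> x = K * (deriv slope_lead x / slope_lead x) + (\<Sum>(r, s, t)\<in>triples. aterm r s t x)" for x
  define n where "n = (2 * of_nat (card triples) :: complex)"
  have sol: "fst (\<eta> r s t (x, y)) = (dlog_u r (x, y) + dlog_u s (x, y) + dlog_u t (x, y)) + aterm r s t x"
    "snd (\<eta> r s t (x, y)) = (2 + bterm r s t x) / y + (dlog_v r (x, y) + dlog_v s (x, y) + dlog_v t (x, y))"
    if "r < s \<and> s < t \<and> t < d" "x \<in> P" "y \<in> Q" for r s t x y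
    using eta_solution[of r s t x y "\<eta> r s t"] eta[of r s t] that by (auto simp: eta_form_def)
  have cyc: "(\<Sum>(r, s, t)\<in>triples. x r + x s + x t) = K * (\<Sum>i<d. x i)" for x :: "nat \<Rightarrow> complex"
    using sum_triples_cyclic[of x] by (simp add: K_def mult.commute)
  have fst_sum: "fst (\<Sum>(r, s, t)\<in>triples. \<eta> r s t (x, y)) = \<alpha> x" if "x \<in> P" "y \<in> Q" for x y
  proof -
    have "fst (\<Sum>(r, s, t)\<in>triples. \<eta> r s t (x, y)) = (\<Sum>(r, s, t)\<in>triples.
        (dlog_u r (x, y) + dlog_u s (x, y) + dlog_u t (x, y)) + aterm r s t x)"
      unfolding fst_sum using sol(1)[OF _ that] by (intro sum.cong refl) auto
    also have "\<dots> = \<alpha> x"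
      using cyc[of "\<lambda>i. dlog_u i (x, y)"] sum_dlog(1)[OF that]
      by (simp add: \<alpha>_def sum.distrib split_def)
    finally show ?thesis .
  qed
  have snd_sum: "snd (\<Sum>(r, s, t)\<in>triples. \<eta> r s t (x, y)) = (n + root_sum l x) / y" if "x \<in> P" "y \<in> Q" for x y
  proof -
    have "snd (\<Sum>(r, s, t)\<in>triples. \<eta> r s t (x, y)) = (\<Sum>(r, s, t)\<in>triples.
        (2 + bterm r s t x) / y + (dlog_v r (x, y) + dlog_v s (x, y) + dlog_v t (x, y)))"
      unfolding snd_sum using sol(2)[OF _ that] by (intro sum.cong refl) auto
    also have "\<dots> = (\<Sum>(r, s, t)\<in>triples. (2 + bterm r s t x) / y) +
        (\<Sum>(r, s, t)\<in>triples. dlog_v r (x, y) + dlog_v s (x, y) + dlog_v t (x, y))"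
      by (simp only: split_def sum.distrib)
    also have "\<dots> = (\<Sum>(r, s, t)\<in>triples. 2 + bterm r s t x) / y"
      using cyc[of "\<lambda>i. dlog_v i (x, y)"] sum_dlog(2)[OF that]
      by (simp add: split_def sum_divide_distrib)
    also have "(\<Sum>(r, s, t)\<in>triples. 2 + bterm r s t x) = n + root_sum l x"
      using sum_bterm[OF that(1)] that(2) by (auto simp: sum.distrib split_def n_def)
    finally show ?thesis .
  qed
  have "((\<lambda>s. (n + root_sum l s) / q) has_field_derivative E' / q) (at p)"
    using DERIV_cdivide[OF DERIV_add[OF DERIV_const[of n] E'], of q] by simp
  then have "((\<lambda>s. snd (\<Sum>(r, s', t)\<in>triples. \<eta> r s' t (s, q))) has_field_derivative E' / q) (at p)"
    by (rule has_field_derivative_transform_within_open[OF _ oP p]) (simp add: snd_sum q)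
  moreover have "((\<lambda>t'. fst (\<Sum>(r, s', t)\<in>triples. \<eta> r s' t (p, t'))) has_field_derivative 0) (at q)"
    by (rule has_field_derivative_transform_within_open[OF DERIV_const[of "\<alpha> p"] oQ q]) (simp add: fst_sum p)
  ultimately show ?thesis by (simp add: ext_d_def pdu_def pdv_def DERIV_imp_deriv)
qed

end

section \<open>The curvature sum in the uniformising parameter\<close>

text \<open>Polynomials in an auxiliary variable that depend holomorphically on \<open>w\<close>.\<close>

definition hol_coeffs :: "complex set \<Rightarrow> (complex \<Rightarrow> complex poly) \<Rightarrow> bool" where
  "hol_coeffs S P \<longleftrightarrow> (\<forall>n. (\<lambda>w. coeff (P w) n) holomorphic_on S)"

lemma hol_coeffs_linear:
  assumes "x holomorphic_on S" "y holomorphic_on S"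
  shows "hol_coeffs S (\<lambda>w. [:x w, y w:])"
  unfolding hol_coeffs_def
proof
  fix n
  show "(\<lambda>w. coeff [:x w, y w:] n) holomorphic_on S"
    using assms by (cases n; cases "n - 1") (auto simp: coeff_pCons)
qed

lemma hol_coeffs_mult: "hol_coeffs S P \<Longrightarrow> hol_coeffs S R \<Longrightarrow> hol_coeffs S (\<lambda>w. P w * R w)"
  unfolding hol_coeffs_def coeff_mult by (auto intro!: holomorphic_intros)

lemma hol_coeffs_power: "hol_coeffs S P \<Longrightarrow> hol_coeffs S (\<lambda>w. P w ^ n)"
proof (induction n)
  case 0
  then show ?case by (simp add: hol_coeffs_def)
qed (auto intro: hol_coeffs_mult)

lemma hol_coeffs_taylor_form:
  assumes "p holomorphic_on S" "z holomorphic_on S"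
  shows "hol_coeffs S (\<lambda>w. taylor_form d \<beta> (p w) (z w))"
proof -
  have "hol_coeffs S (\<lambda>w. [:z w, 1:] ^ i * [:p w * z w - 1, p w:] ^ (d - i))" for i
    using assms by (intro hol_coeffs_mult hol_coeffs_power hol_coeffs_linear holomorphic_intros)
  then show ?thesis
    unfolding taylor_form_def form_poly_def hol_coeffs_def coeff_sum coeff_smult by (auto intro!: holomorphic_intros)
qed

locale uniformised_web = dual_web +
  fixes \<rho> :: real and g L :: "complex \<Rightarrow> complex"
  assumes \<rho>: "\<rho> > 0" and g_hol: "g holomorphic_on ball 0 \<rho>" and L_hol: "L holomorphic_on ball 0 \<rho>"
    and L_inj: "inj_on L (ball 0 \<rho>)"
    and denom_nz: "\<And>w. w \<in> ball 0 \<rho> \<Longrightarrow> a + b * (p0 + w ^ d) \<noteq> 0"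
    and g_nz: "\<And>w. w \<in> ball 0 \<rho> \<Longrightarrow> g w \<noteq> 0"
    and L_eq: "\<And>w. w \<in> ball 0 \<rho> \<Longrightarrow> (a + b * (p0 + w ^ d)) * L w = b + w * g w"
    and g_eq: "\<And>w. w \<in> ball 0 \<rho> \<Longrightarrow> c * g w ^ d = - form_eval d \<beta> (L w) ((p0 + w ^ d) * L w - 1)"
begin

text \<open>
  With \<open>p = p0 + w ^ d\<close>, the linear and the cubic Taylor coefficient of the equation at the root \<open>L w\<close>
  are divisible by \<open>w ^ (d - 1)\<close> and \<open>w ^ (d - 3)\<close>. The cofactors are \<open>reduced1\<close> and \<open>reduced3\<close>, and
  \<open>branch_term w / w ^ (d + 1)\<close> is the summand of \<open>root_sum\<close> that belongs to the root \<open>L w\<close>.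
\<close>

definition rem_coeff :: "nat \<Rightarrow> complex \<Rightarrow> complex" where
  "rem_coeff n w = coeff (taylor_form d \<beta> (p0 + w ^ d) (L w)) n"

definition reduced1 :: "complex \<Rightarrow> complex" where
  "reduced1 w = c * of_nat d * g w ^ (d - 1) * (a + b * (p0 + w ^ d)) + w * rem_coeff 1 w"

definition reduced3 :: "complex \<Rightarrow> complex" where
  "reduced3 w = c * of_nat (d choose 3) * g w ^ (d - 3) * (a + b * (p0 + w ^ d)) ^ 3 + w ^ 3 * rem_coeff 3 w"

definition branch_term :: "complex \<Rightarrow> complex" where
  "branch_term w = - (deriv L w * reduced3 w / (of_nat d * reduced1 w))"

lemma rem_coeff_hol: "(\<lambda>w. rem_coeff n w) holomorphic_on ball 0 \<rho>"
proof -
  have "hol_coeffs (ball 0 \<rho>) (\<lambda>w. taylor_form d \<beta> (p0 + w ^ d) (L w))"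
    by (intro hol_coeffs_taylor_form holomorphic_intros L_hol)
  then have "(\<lambda>w. coeff (taylor_form d \<beta> (p0 + w ^ d) (L w)) n) holomorphic_on ball 0 \<rho>"
    by (simp add: hol_coeffs_def)
  then show ?thesis unfolding rem_coeff_def .
qed

lemma reduced1_hol: "reduced1 holomorphic_on ball 0 \<rho>"
  unfolding reduced1_def by (intro holomorphic_intros g_hol rem_coeff_hol)

lemma reduced3_hol: "reduced3 holomorphic_on ball 0 \<rho>"
  unfolding reduced3_def by (intro holomorphic_intros g_hol rem_coeff_hol)

lemma d0: "d > 0" "(0::complex) ^ d = 0" using d3 by auto

lemma slope_taylor_at_root:
  assumes w: "w \<in> ball 0 \<rho>"
  shows "coeff (slope_taylor (p0 + w ^ d) (L w)) 1 = w ^ (d - 1) * reduced1 w"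
    "coeff (slope_taylor (p0 + w ^ d) (L w)) 3 = w ^ (d - 3) * reduced3 w"
    "slope_fun (p0 + w ^ d) (L w) = 0"
proof -
  have slope_taylor: "slope_taylor (p0 + w ^ d) (L w) = smult c ([:w * g w, a + b * (p0 + w ^ d):] ^ d) +
      smult (w ^ d) (taylor_form d \<beta> (p0 + w ^ d) (L w))"
    by (simp add: slope_taylor_def L_eq[OF w])
  have coeff_T: "coeff (slope_taylor (p0 + w ^ d) (L w)) n =
      w ^ (d - n) * (c * of_nat (d choose n) * g w ^ (d - n) * (a + b * (p0 + w ^ d)) ^ n) + w ^ d * rem_coeff n w" if "n \<le> d" for n
    unfolding slope_taylor coeff_add coeff_smult coeff_linear_poly_power[OF that] rem_coeff_def power_mult_distrib
    by (simp only: mult_ac)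
  have pow: "w ^ d = w ^ (d - 1) * w" "w ^ d = w ^ (d - 3) * w ^ 3"
    using d3 by (simp_all flip: power_add power_Suc2)
  have "w ^ d * rem_coeff 1 w = w ^ (d - 1) * (w * rem_coeff 1 w)" "w ^ d * rem_coeff 3 w = w ^ (d - 3) * (w ^ 3 * rem_coeff 3 w)"
    unfolding mult.assoc[symmetric] pow(1)[symmetric] pow(2)[symmetric] by simp_all
  then show "coeff (slope_taylor (p0 + w ^ d) (L w)) 1 = w ^ (d - 1) * reduced1 w"
    "coeff (slope_taylor (p0 + w ^ d) (L w)) 3 = w ^ (d - 3) * reduced3 w"
    using coeff_T[of 1] coeff_T[of 3] d3 by (simp_all only: reduced1_def reduced3_def distrib_left choose_one power_one_right)
  show "slope_fun (p0 + w ^ d) (L w) = 0"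
  proof -
    have "slope_fun (p0 + w ^ d) (L w) = w ^ d * (c * g w ^ d) + w ^ d * form_eval d \<beta> (L w) ((p0 + w ^ d) * L w - 1)"
      by (simp add: slope_fun_def L_eq[OF w] power_mult_distrib)
    then show ?thesis unfolding g_eq[OF w] by simp
  qed
qed

text \<open>
  Up to terms of order at least two, \<open>branch_term\<close> is a constant times the quotient of
  \<open>(g + w g') g\<^sup>d\<^sup>-\<^sup>3\<close> by \<open>c d e g\<^sup>d\<^sup>-\<^sup>1 + w (rem_coeff 1)\<close>. Its logarithmic derivative at \<open>0\<close> contains
  \<open>g'/g\<close> with the factor \<open>2 + (d - 3) - (d - 1) = 0\<close>, and only the term with \<open>rem_coeff 1\<close> remains.
\<close>

lemma deriv_branch_term_0:
  assumes "reduced1 0 \<noteq> 0"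
  shows "deriv branch_term 0 = 0 \<longleftrightarrow> rem_coeff 1 0 = 0"
proof -
  obtain n where d: "d = Suc (Suc (Suc n))"
    using d3 by (intro that[of "d - 3"]) auto
  then have dm: "d - 1 = n + 2" "d - Suc 0 = n + 2" "d - 3 = n" by auto
  define e where "e = a + b * p0"
  have e0: "e \<noteq> 0" using e0 by (simp add: e_def)
  have in0: "0 \<in> ball (0::complex) \<rho>" using \<rho> by simp
  define U where "U w = g w + w * deriv g w - b * of_nat d * w ^ (n + 2) * L w" for w
  define En where "En w = e + b * w ^ d" for w
  have En: "a + b * (p0 + w ^ d) = En w" for w by (simp add: En_def e_def algebra_simps)
  have U: "En w * deriv L w = U w" if w: "w \<in> ball 0 \<rho>" for w
  proof -
    have L': "(L has_field_derivative deriv L w) (at w)"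
      and g': "(g has_field_derivative deriv g w) (at w)"
      using holomorphic_derivI[OF _ open_ball w] L_hol g_hol by auto
    have "((\<lambda>w. En w * L w) has_field_derivative
        b * (of_nat d * w ^ (n + 2)) * L w + En w * deriv L w) (at w)"
      unfolding En_def by (rule derivative_eq_intros L' refl | simp add: d)+
    moreover have "((\<lambda>w. b + w * g w) has_field_derivative g w + w * deriv g w) (at w)"
      by (rule derivative_eq_intros g' refl | simp)+
    then have "((\<lambda>w. En w * L w) has_field_derivative g w + w * deriv g w) (at w)"
      by (rule has_field_derivative_transform_within_open[OF _ open_ball w])
        (use L_eq in \<open>simp add: En\<close>)
    ultimately have "b * (of_nat d * w ^ (n + 2)) * L w + En w * deriv L w = g w + w * deriv g w"
      by (rule DERIV_unique)
    then show ?thesis unfolding U_def by (metis add_diff_cancel_left' mult.assoc)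
  qed
  have branch_term: "branch_term w = - (U w * reduced3 w / (of_nat d * (reduced1 w * En w)))" if w: "w \<in> ball 0 \<rho>" for w
    using denom_nz[OF w] unfolding branch_term_def U[OF w, symmetric] En by simp
  define g0 where "g0 = g 0"
  define g1 where "g1 = deriv g 0"
  have g0: "g0 \<noteq> 0" using g_nz[OF in0] by (simp add: g0_def)
  have g': "(g has_field_derivative g1) (at 0)"
    using holomorphic_derivI[OF g_hol open_ball in0] by (simp add: g1_def)
  have g'': "(deriv g has_field_derivative deriv (deriv g) 0) (at 0)"
    using holomorphic_derivI[OF holomorphic_deriv[OF g_hol open_ball] open_ball in0] .
  have L': "(L has_field_derivative deriv L 0) (at 0)"
    using holomorphic_derivI[OF L_hol open_ball in0] .
  have R': "(rem_coeff i has_field_derivative deriv (rem_coeff i) 0) (at 0)" for i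
    using holomorphic_derivI[OF rem_coeff_hol open_ball in0] .
  have En': "(En has_field_derivative 0) (at 0)"
    unfolding En_def by (rule derivative_eq_intros refl | simp add: d)+
  have U': "(U has_field_derivative 2 * g1) (at 0)"
    unfolding U_def
    by (rule derivative_eq_intros g' g'' L' refl | simp add: g1_def)+
  define K where "K = c * of_nat (d choose 3)"
  have reduced3_eq: "reduced3 = (\<lambda>w. K * g w ^ n * En w ^ 3 + w ^ 3 * rem_coeff 3 w)"
    by (simp add: fun_eq_iff reduced3_def K_def dm En)
  have reduced3': "(reduced3 has_field_derivative K * (of_nat n * g0 ^ (n - 1) * g1) * e ^ 3) (at 0)"
    unfolding reduced3_eq
    by (rule derivative_eq_intros g' En' R' refl | simp add: g0_def En_def d)+
  have reduced1_eq: "reduced1 = (\<lambda>w. c * of_nat d * g w ^ (n + 2) * En w + w * rem_coeff 1 w)"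
    by (simp add: fun_eq_iff reduced1_def dm En)
  have reduced1': "(reduced1 has_field_derivative c * of_nat d * (of_nat (n + 2) * g0 ^ (n + 1) * g1) * e + rem_coeff 1 0) (at 0)"
    unfolding reduced1_eq
    by (rule derivative_eq_intros g' En' R' refl | simp add: g0_def En_def d)+
  have at0: "U 0 = g0" "En 0 = e" "reduced3 0 = K * g0 ^ n * e ^ 3" "reduced1 0 = c * of_nat d * g0 ^ (n + 2) * e"
    by (simp_all add: U_def En_def reduced3_eq reduced1_eq g0_def d0)
  have K: "K \<noteq> 0" using c0 by (simp add: K_def d)
  let ?D = "of_nat d * (reduced1 0 * En 0)"
  let ?reduced1' = "c * of_nat d * (of_nat (n + 2) * g0 ^ (n + 1) * g1) * e + rem_coeff 1 0"
  let ?reduced3' = "K * (of_nat n * g0 ^ (n - 1) * g1) * e ^ 3"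
  have D: "?D \<noteq> 0" using assms e0 d0 by (simp add: at0)
  have "((\<lambda>w. - (U w * reduced3 w / (of_nat d * (reduced1 w * En w)))) has_field_derivative
     - (((2 * g1 * reduced3 0 + U 0 * ?reduced3') * ?D - U 0 * reduced3 0 * (of_nat d * (?reduced1' * En 0))) / (?D * ?D))) (at 0)"
    by (rule derivative_eq_intros U' reduced3' reduced1' En' refl | use D in \<open>simp add: algebra_simps\<close>)+
  then have "(branch_term has_field_derivative
     - (((2 * g1 * reduced3 0 + U 0 * ?reduced3') * ?D - U 0 * reduced3 0 * (of_nat d * (?reduced1' * En 0))) / (?D * ?D))) (at 0)"
    by (rule has_field_derivative_transform_within_open[OF _ open_ball in0]) (simp add: branch_term)
  moreover have "(2 * g1 * reduced3 0 + U 0 * ?reduced3') * ?D - U 0 * reduced3 0 * (of_nat d * (?reduced1' * En 0)) =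
      - (g0 ^ (n + 1) * K * e ^ 4 * of_nat d * rem_coeff 1 0)"
  proof -
    have n: "g0 * (of_nat n * g0 ^ (n - 1)) = of_nat n * g0 ^ n" by (cases n) auto
    have "U 0 * ?reduced3' = K * (g0 * (of_nat n * g0 ^ (n - 1))) * g1 * e ^ 3" by (simp add: at0)
    also have "\<dots> = K * of_nat n * g0 ^ n * g1 * e ^ 3" unfolding n by simp
    finally have num: "2 * g1 * reduced3 0 + U 0 * ?reduced3' = K * of_nat (n + 2) * g0 ^ n * g1 * e ^ 3"
      by (simp add: at0 algebra_simps)
    show ?thesis
      unfolding num unfolding at0 by (simp add: algebra_simps power_add power2_eq_square eval_nat_numeral)
  qed
  ultimately have "deriv branch_term 0 = g0 ^ (n + 1) * K * e ^ 4 * of_nat d * rem_coeff 1 0 / (?D * ?D)"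
    by (simp add: DERIV_imp_deriv)
  then show ?thesis using g0 K e0 d0 D by simp
qed

text \<open>
  The \<open>d\<close> numbers \<open>L w\<close> with \<open>w ^ d = p - p0\<close> are distinct roots, hence all the slopes. Near \<open>p\<close> each
  slope is \<open>L\<close> composed with a branch of the \<open>d\<close>-th root, recovered as the local inverse \<open>M\<close> of \<open>L\<close> applied
  to the slope; differentiating \<open>M (l i p) ^ d = p - p0\<close> gives the derivative of the slope.
\<close>

lemma root_sum_eq:
  assumes lw: "local_web d a b c p0 \<beta> \<theta> P Q l" and Q: "Q \<noteq> {}" and p: "p \<in> P"
    and P: "P \<subseteq> {p. p \<noteq> p0 \<and> norm (p - p0) < \<rho> ^ d}"
  shows "root_sum l p = (\<Sum>w | w ^ d = p - p0. branch_term w / w ^ (d + 1))"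
proof -
  interpret local_web d a b c p0 \<beta> \<theta> P Q l by (fact lw)
  define R where "R x = {w. w ^ d = x - p0}" for x
  have R_ball: "R x \<subseteq> ball 0 \<rho>" if "x \<in> P" for x
    using norm_root_less[of _ d "x - p0" \<rho>] P that \<rho> unfolding R_def by auto
  have zeros: "L ` R x = (\<lambda>i. l i x) ` {..<d}" if x: "x \<in> P" for x
  proof (rule card_subset_eq)
    show "L ` R x \<subseteq> (\<lambda>i. l i x) ` {..<d}"
    proof
      fix z assume "z \<in> L ` R x"
      then obtain w where w: "w \<in> R x" "z = L w" by blast
      then have "x = p0 + w ^ d" by (simp add: R_def)
      then have "slope_fun x z = 0" using slope_taylor_at_root(3)[of w] R_ball[OF x] w by auto
      then show "z \<in> (\<lambda>i. l i x) ` {..<d}"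
        using slope_fun_prod[OF x, of z] slope_lead_nz[OF x Q] by auto
    qed
    have "card (L ` R x) = card (R x)"
      by (rule card_image[OF inj_on_subset[OF L_inj R_ball[OF x]]])
    also have "\<dots> = d" unfolding R_def using P x d0 by (intro card_nth_roots) auto
    finally show "card (L ` R x) = card ((\<lambda>i. l i x) ` {..<d})"
      using l_inj[OF x] by (simp add: card_image)
  qed simp
  obtain M where M: "M holomorphic_on (L ` ball 0 \<rho>)"
      "\<And>z. z \<in> ball 0 \<rho> \<Longrightarrow> deriv L z * deriv M (L z) = 1"
      "\<And>z. z \<in> ball 0 \<rho> \<Longrightarrow> M (L z) = z"
    using holomorphic_has_inverse[OF L_hol open_ball L_inj] by blast
  have oL: "open (L ` ball 0 \<rho>)" by (rule open_mapping_thm3[OF L_hol open_ball L_inj])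
  have Ml: "M (l i x) \<in> R x" "L (M (l i x)) = l i x" if x: "x \<in> P" and i: "i < d" for i x
  proof -
    obtain w where w: "w \<in> R x" "l i x = L w" using zeros[OF x] i by blast
    then show "M (l i x) \<in> R x" "L (M (l i x)) = l i x"
      using M(3)[of w] R_ball[OF x] by auto
  qed
  have dl: "deriv (l i) p = deriv L (M (l i p)) / (of_nat d * M (l i p) ^ (d - 1))" if i: "i < d" for i
  proof -
    define w where "w = M (l i p)"
    have w: "w \<in> R p" "L w = l i p" using Ml[OF p i] by (auto simp: w_def)
    have wb: "w \<in> ball 0 \<rho>" using w(1) R_ball[OF p] by blast
    have "(M has_field_derivative deriv M (l i p)) (at (l i p))"
      using holomorphic_derivI[OF M(1) oL, of "l i p"] w(2) wb by force
    moreover have "(l i has_field_derivative deriv (l i) p) (at p)"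
      using holomorphic_derivI[OF l_hol[OF i] oP p] .
    ultimately have "((\<lambda>x. M (l i x)) has_field_derivative deriv M (l i p) * deriv (l i) p) (at p)"
      by (rule DERIV_chain2)
    from DERIV_power[OF this, of d]
    have "((\<lambda>x. M (l i x) ^ d) has_field_derivative
        of_nat d * (deriv M (l i p) * deriv (l i) p * w ^ (d - 1))) (at p)"
      by (simp add: w_def)
    then have "((\<lambda>x. x - p0) has_field_derivative
        of_nat d * (deriv M (l i p) * deriv (l i) p * w ^ (d - 1))) (at p)"
      by (rule has_field_derivative_transform_within_open[OF _ oP p]) (use Ml i in \<open>auto simp: R_def\<close>)
    moreover have "((\<lambda>x. x - p0) has_field_derivative 1) (at p)"
      by (rule derivative_eq_intros refl | simp)+
    ultimately have 1: "of_nat d * (deriv M (l i p) * deriv (l i) p * w ^ (d - 1)) = 1"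
      by (rule DERIV_unique)
    have 2: "deriv L w * deriv M (l i p) = 1" using M(2)[OF wb] w(2) by simp
    have "deriv L w = deriv L w * (of_nat d * (deriv M (l i p) * deriv (l i) p * w ^ (d - 1)))"
      unfolding 1 by simp
    also have "\<dots> = (deriv L w * deriv M (l i p)) * (of_nat d * deriv (l i) p * w ^ (d - 1))"
      by (simp add: mult_ac)
    finally have 3: "deriv L w = of_nat d * deriv (l i) p * w ^ (d - 1)" unfolding 2 by simp
    have "p \<noteq> p0" "w ^ d = p - p0" using w(1) P p by (auto simp: R_def)
    then have "w \<noteq> 0" using d0(2) by (metis right_minus_eq)
    then have "of_nat d * w ^ (d - 1) \<noteq> 0" using d0 by simp
    then show ?thesis unfolding w_def[symmetric] 3 by (simp add: field_simps)
  qed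
  define h where "h z = - (deriv L (M z) / (of_nat d * M z ^ (d - 1)) *
    (coeff (slope_taylor p z) 3 / coeff (slope_taylor p z) 1))" for z
  have "root_sum l p = (\<Sum>i<d. h (l i p))"
    unfolding root_sum_def h_def sum_negf using dl by simp
  also have "\<dots> = (\<Sum>z\<in>(\<lambda>i. l i p) ` {..<d}. h z)"
    using l_inj[OF p] by (simp add: sum.reindex)
  also have "\<dots> = (\<Sum>w\<in>R p. h (L w))"
    unfolding zeros[OF p, symmetric]
    using sum.reindex[OF inj_on_subset[OF L_inj R_ball[OF p]], of h] by simp
  also have "\<dots> = (\<Sum>w\<in>R p. branch_term w / w ^ (d + 1))"
  proof (intro sum.cong refl)
    fix w assume w: "w \<in> R p"
    then have wb: "w \<in> ball 0 \<rho>" and pw: "p = p0 + w ^ d" using R_ball[OF p] by (auto simp: R_def)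
    have w0: "w \<noteq> 0" using pw P p d0 by auto
    have e: "w ^ (d - 1) * w ^ (d - 1) = w ^ (d - 3) * w ^ (d + 1)"
    proof -
      have "d - 1 + (d - 1) = d - 3 + (d + 1)" using d3 by simp
      then show ?thesis by (simp only: flip: power_add)
    qed
    have "h (L w) = - (deriv L w / (of_nat d * w ^ (d - 1)) * (w ^ (d - 3) * reduced3 w / (w ^ (d - 1) * reduced1 w)))"
      unfolding h_def M(3)[OF wb] unfolding pw slope_taylor_at_root[OF wb] ..
    also have "\<dots> = - (deriv L w * reduced3 w * w ^ (d - 3)) / (of_nat d * reduced1 w * (w ^ (d - 1) * w ^ (d - 1)))"
      by (simp add: mult_ac)
    also have "\<dots> = branch_term w / w ^ (d + 1)"
      unfolding e branch_term_def using w0 by (simp add: mult_ac)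
    finally show "h (L w) = branch_term w / w ^ (d + 1)" .
  qed
  finally show ?thesis unfolding R_def .
qed

end

section \<open>Slopes of an arbitrary local factorization\<close>

lemma holo2_fst: assumes "f holomorphic_on P" "open P" shows "holo2 (\<lambda>m. f (fst m)) (P \<times> Q)"
  unfolding holo2_def
proof
  fix m assume "m \<in> P \<times> Q"
  then have "(f has_field_derivative deriv f (fst m)) (at (fst m))"
    using holomorphic_derivI[OF assms] by auto
  then have "(f has_derivative (*) (deriv f (fst m))) (at (fst m))"
    by (simp add: has_field_derivative_def)
  from has_derivative_compose[OF has_derivative_fst[OF has_derivative_ident] this, of UNIV]
  have "((\<lambda>m. f (fst m)) has_derivative (\<lambda>(h, k). deriv f (fst m) * h + 0 * k)) (at m)"
    by (simp add: split_def)
  then show "\<exists>a b. ((\<lambda>m. f (fst m)) has_derivative (\<lambda>(h, k). a * h + b * k)) (at m)" by blast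
qed

lemma holo2_snd: assumes "f holomorphic_on Q" "open Q" shows "holo2 (\<lambda>m. f (snd m)) (P \<times> Q)"
  unfolding holo2_def
proof
  fix m assume "m \<in> P \<times> Q"
  then have "(f has_field_derivative deriv f (snd m)) (at (snd m))"
    using holomorphic_derivI[OF assms] by auto
  then have "(f has_derivative (*) (deriv f (snd m))) (at (snd m))"
    by (simp add: has_field_derivative_def)
  from has_derivative_compose[OF has_derivative_snd[OF has_derivative_ident] this, of UNIV]
  have "((\<lambda>m. f (snd m)) has_derivative (\<lambda>(h, k). 0 * h + deriv f (snd m) * k)) (at m)"
    by (simp add: split_def)
  then show "\<exists>a b. ((\<lambda>m. f (snd m)) has_derivative (\<lambda>(h, k). a * h + b * k)) (at m)" by blast
qed

lemma holo2_mult: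
  assumes "holo2 f U" "holo2 g U" shows "holo2 (\<lambda>m. f m * g m) U"
  unfolding holo2_def
proof
  fix m assume m: "m \<in> U"
  obtain a b where f: "(f has_derivative (\<lambda>(h, k). a * h + b * k)) (at m)"
    using assms(1) m by (auto simp: holo2_def)
  obtain a' b' where g: "(g has_derivative (\<lambda>(h, k). a' * h + b' * k)) (at m)"
    using assms(2) m by (auto simp: holo2_def)
  from has_derivative_mult[OF f g]
  have "((\<lambda>m. f m * g m) has_derivative
      (\<lambda>(h, k). (f m * a' + a * g m) * h + (f m * b' + b * g m) * k)) (at m)"
    by (rule has_derivative_eq_rhs) (auto simp: fun_eq_iff algebra_simps)
  then show "\<exists>a b. ((\<lambda>m. f m * g m) has_derivative (\<lambda>(h, k). a * h + b * k)) (at m)" by blast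
qed

context dual_web begin

text \<open>
  The quotients \<open>- fst (\<theta> i) / (q * snd (\<theta> i))\<close> are roots of \<open>slope_fun p\<close>. For fixed \<open>p\<close> they depend
  continuously on \<open>q\<close> and take finitely many values, so they are constant in \<open>q\<close>.
\<close>

lemma local_web_of_factorization:
  assumes fac: "local_factorization web_form d U \<theta>" and PQ: "P \<times> Q \<subseteq> U" and oP: "open P" and oQ: "open Q"
    and cQ: "connected Q" and q1: "q1 \<in> Q" and Q0: "0 \<notin> Q" and NP: "\<And>p. p \<in> P \<Longrightarrow> slope_lead p \<noteq> 0"
  obtains l where "local_web d a b c p0 \<beta> \<theta> P Q l"
proof -
  define \<mu> where "\<mu> i p q = - fst (\<theta> i (p, q)) / (q * snd (\<theta> i (p, q)))" for i p q
  have hol: "holo2 (\<lambda>m. fst (\<theta> i m)) U" "holo2 (\<lambda>m. snd (\<theta> i m)) U" if "i < d" for i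
    using fac that by (auto simp: local_factorization_def)
  have Wprod: "web_form (p, q) (\<xi>, \<zeta>) = (\<Prod>i<d. fst (\<theta> i (p, q)) * \<xi> + snd (\<theta> i (p, q)) * \<zeta>)"
    if "p \<in> P" "q \<in> Q" for p q \<xi> \<zeta>
    using fac PQ that by (auto simp: local_factorization_def)
  have prod: "(\<Prod>i<d. snd (\<theta> i (p, q))) = slope_lead p" if "p \<in> P" "q \<in> Q" for p q
    using Wprod[OF that, of 0 1] by (simp add: web_form_vertical)
  have snz: "snd (\<theta> i (p, q)) \<noteq> 0" if "i < d" "p \<in> P" "q \<in> Q" for i p q
  proof
    assume "snd (\<theta> i (p, q)) = 0"
    then have "(\<Prod>i<d. snd (\<theta> i (p, q))) = 0" using that(1) by (intro prod_zero) auto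
    then show False using prod[OF that(2,3)] NP[OF that(2)] by simp
  qed
  have q_nz: "q \<noteq> 0" if "q \<in> Q" for q using that Q0 by auto
  have fst_eq: "fst (\<theta> i (p, q)) = - q * \<mu> i p q * snd (\<theta> i (p, q))"
    if "i < d" "p \<in> P" "q \<in> Q" for i p q
    using snz[OF that] q_nz[OF that(3)] by (simp add: \<mu>_def)
  have slope_fun: "slope_fun p z = slope_lead p * (\<Prod>i<d. z - \<mu> i p q)" if pq: "p \<in> P" "q \<in> Q" for p q z
  proof -
    have "q ^ d * slope_fun p z = web_form (p, q) (1, q * z)" using web_form_slope[of p q 1 z] by simp
    also have "\<dots> = (\<Prod>i<d. q * (snd (\<theta> i (p, q)) * (z - \<mu> i p q)))"
      unfolding Wprod[OF pq] by (intro prod.cong refl) (simp add: fst_eq pq algebra_simps)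
    also have "\<dots> = q ^ d * (slope_lead p * (\<Prod>i<d. z - \<mu> i p q))"
      by (simp add: prod.distrib prod[OF pq])
    finally show ?thesis using q_nz[OF pq(2)] by simp
  qed
  have const: "\<mu> i p q = \<mu> i p q1" if i: "i < d" and pq: "p \<in> P" "q \<in> Q" for i p q
  proof -
    have "\<mu> i p constant_on Q"
    proof (rule continuous_finite_range_constant[OF cQ])
      show "continuous_on Q (\<mu> i p)"
      proof (rule continuous_at_imp_continuous_on, rule ballI)
        fix q assume q: "q \<in> Q"
        have mU: "(p, q) \<in> U" using PQ pq(1) q by blast
        show "isCont (\<mu> i p) q" unfolding \<mu>_def
          using snz[OF i pq(1) q] q_nz[OF q]
          by (intro continuous_intros DERIV_isCont[OF holo2_partial_derivatives(2)[OF hol(1)[OF i] mU]]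
              DERIV_isCont[OF holo2_partial_derivatives(2)[OF hol(2)[OF i] mU]]) auto
      qed
      have "\<mu> i p ` Q \<subseteq> (\<lambda>j. \<mu> j p q1) ` {..<d}"
      proof
        fix z assume "z \<in> \<mu> i p ` Q"
        then obtain q where q: "q \<in> Q" "z = \<mu> i p q" by blast
        have "slope_fun p z = 0" unfolding slope_fun[OF pq(1) q(1)] using i q by (auto intro: prod_zero)
        then show "z \<in> (\<lambda>j. \<mu> j p q1) ` {..<d}"
          unfolding slope_fun[OF pq(1) q1] using NP[OF pq(1)] by auto
      qed
      then show "finite (\<mu> i p ` Q)" by (rule finite_subset) simp
    qed
    then show ?thesis using pq(2) q1 by (auto simp: constant_on_def)
  qed
  define l where "l i p = \<mu> i p q1" for i p
  have "local_web d a b c p0 \<beta> \<theta> P Q l"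
  proof
    show "open P" "open Q" "0 \<notin> Q" by fact+
    fix i assume i: "i < d"
    show "holo2 (\<lambda>m. snd (\<theta> i m)) (P \<times> Q)" using hol(2)[OF i] PQ by (auto simp: holo2_def)
    have "l i field_differentiable (at p)" if p: "p \<in> P" for p
    proof -
      have mU: "(p, q1) \<in> U" using PQ p q1 by blast
      have "(\<lambda>p. fst (\<theta> i (p, q1))) field_differentiable (at p)"
        "(\<lambda>p. snd (\<theta> i (p, q1))) field_differentiable (at p)"
        using holo2_partial_derivatives(1)[OF hol(1)[OF i] mU] holo2_partial_derivatives(1)[OF hol(2)[OF i] mU]
        by (auto simp: field_differentiable_def)
      then show ?thesis unfolding l_def \<mu>_def using snz[OF i p q1] q_nz[OF q1]
        by (intro field_differentiable_divide field_differentiable_minus field_differentiable_mult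
            field_differentiable_const) auto
    qed
    then show "l i holomorphic_on P"
      by (auto simp: holomorphic_on_def intro: field_differentiable_at_within)
    fix p q assume pq: "p \<in> P" "q \<in> Q"
    show "snd (\<theta> i (p, q)) \<noteq> 0" by (rule snz[OF i pq])
    show "fst (\<theta> i (p, q)) = - q * l i p * snd (\<theta> i (p, q))"
      using fst_eq[OF i pq] const[OF i pq] by (simp add: l_def)
  next
    fix p q assume pq: "p \<in> P" "q \<in> Q"
    show "(\<Prod>i<d. snd (\<theta> i (p, q))) = slope_lead p" by (rule prod[OF pq])
  next
    fix p assume p: "p \<in> P"
    show "slope_fun p z = slope_lead p * (\<Prod>i<d. z - l i p)" for z unfolding l_def by (rule slope_fun[OF p q1])
    show "inj_on (\<lambda>i. l i p) {..<d}"
    proof (rule inj_onI, rule ccontr)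
      fix i j assume ij: "i \<in> {..<d}" "j \<in> {..<d}" "l i p = l j p" "i \<noteq> j"
      then have "wedge (\<theta> i) (\<theta> j) (p, q1) = 0"
        using fst_eq[of i p q1] fst_eq[of j p q1] p q1 by (simp add: wedge_def l_def)
      then show False using fac PQ p q1 ij by (auto simp: local_factorization_def)
    qed
  qed
  then show thesis by (rule that)
qed

text \<open>
  At \<open>p = p0\<close> the symmetric form is a \<open>d\<close>-th power, so any two factors are proportional: the dual line
  lies in the discriminant.
\<close>

lemma no_curvature_on_dual_line: "\<not> curvature_at web_form d (p0, q0) \<kappa>"
proof
  assume "curvature_at web_form d (p0, q0) \<kappa>"
  then obtain U \<theta> where U: "(p0, q0) \<in> U" and fac: "local_factorization web_form d U \<theta>"
    by (auto simp: curvature_at_def)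
  have w: "wedge (\<theta> 0) (\<theta> 1) (p0, q0) \<noteq> 0"
    using fac U d3 by (auto simp: local_factorization_def)
  have kernel: "(a + b * p0) * fst (\<theta> i (p0, q0)) = - (b * q0 * snd (\<theta> i (p0, q0)))" if i: "i < d" for i
  proof -
    let ?f = "fst (\<theta> i (p0, q0))" and ?g = "snd (\<theta> i (p0, q0))"
    have "web_form (p0, q0) (?g, - ?f) = (\<Prod>j<d. fst (\<theta> j (p0, q0)) * ?g + snd (\<theta> j (p0, q0)) * (- ?f))"
      using fac U unfolding local_factorization_def by blast
    also have "\<dots> = 0" using i by (intro prod_zero bexI[of _ i]) auto
    finally have "a * (- ?f) + b * (p0 * (- ?f) - q0 * ?g) = 0"
      using c0 d3 by (simp add: web_form_def)
    then show ?thesis by algebra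
  qed
  have "(a + b * p0) * wedge (\<theta> 0) (\<theta> 1) (p0, q0) =
      ((a + b * p0) * fst (\<theta> 0 (p0, q0))) * snd (\<theta> 1 (p0, q0)) -
      snd (\<theta> 0 (p0, q0)) * ((a + b * p0) * fst (\<theta> 1 (p0, q0)))"
    by (simp add: wedge_def algebra_simps)
  also have "\<dots> = 0" using kernel[of 0] kernel[of 1] d3 by simp
  finally show False using w e0 by simp
qed

end

lemma (in local_web) factorization_of_slopes:
  assumes "\<And>i. i < d \<Longrightarrow> holo2 (\<lambda>m. fst (\<theta> i m)) (P \<times> Q)"
  shows "local_factorization web_form d (P \<times> Q) \<theta>"
  unfolding local_factorization_def
proof (intro conjI ballI allI impI)
  show "open (P \<times> Q)" using oP oQ by (rule open_Times)
  show "holo2 (\<lambda>m. fst (\<theta> i m)) (P \<times> Q)" "holo2 (\<lambda>m. snd (\<theta> i m)) (P \<times> Q)" if "i < d" for i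
    using assms snd_hol that by auto
  fix m assume "m \<in> P \<times> Q"
  then obtain p q where m: "m = (p, q)" "p \<in> P" "q \<in> Q" by auto
  have q: "q \<noteq> 0" using m Q0 by auto
  have snd_prod: "slope_lead p * (\<Prod>i<d. x i) = (\<Prod>i<d. snd (\<theta> i (p, q)) * x i)" for x
    by (simp add: prod.distrib prod_snd m)
  show "web_form m (\<xi>, \<zeta>) = (\<Prod>i<d. fst (\<theta> i m) * \<xi> + snd (\<theta> i m) * \<zeta>)" for \<xi> \<zeta>
  proof -
    have "web_form m (\<xi>, \<zeta>) = slope_lead p * (\<Prod>i<d. \<zeta> - q * l i p * \<xi>)"
    proof (cases "\<xi> = 0")
      case True
      then show ?thesis by (simp add: m web_form_vertical)
    next
      case False
      have "web_form m (\<xi>, \<zeta>) = (q * \<xi>) ^ d * slope_fun p (\<zeta> / (q * \<xi>))"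
        using web_form_slope[of p q \<xi> "\<zeta> / (q * \<xi>)"] False q by (simp add: m)
      also have "\<dots> = slope_lead p * (\<Prod>i<d. (q * \<xi>) * (\<zeta> / (q * \<xi>) - l i p))"
        by (simp add: slope_fun_prod m prod.distrib)
      also have "\<dots> = slope_lead p * (\<Prod>i<d. \<zeta> - q * l i p * \<xi>)"
        using False q by (intro arg_cong2[where f = "(*)"] prod.cong refl) (simp add: algebra_simps)
      finally show ?thesis .
    qed
    also have "\<dots> = (\<Prod>i<d. fst (\<theta> i m) * \<xi> + snd (\<theta> i m) * \<zeta>)"
      unfolding snd_prod by (intro prod.cong refl) (simp add: m fst_eq algebra_simps)
    finally show ?thesis .
  qed
  fix i j assume ij: "i < d" "j < d" "i \<noteq> j"
  have "wedge (\<theta> i) (\<theta> j) m = q * (l j p - l i p) * (snd (\<theta> i m) * snd (\<theta> j m))"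
    using ij m by (simp add: wedge_def fst_eq algebra_simps)
  then show "wedge (\<theta> i) (\<theta> j) m \<noteq> 0"
    using q l_neq[of p j i] ij m snd_nz by auto
qed

lemma (in local_web) curvature_exists:
  assumes fst_hol: "\<And>i. i < d \<Longrightarrow> holo2 (\<lambda>m. fst (\<theta> i m)) (P \<times> Q)" and m: "m \<in> P \<times> Q"
  shows "\<exists>\<kappa>. curvature_at web_form d m \<kappa>"
proof -
  define \<eta> where "\<eta> r s t = (\<lambda>m.
    ((dlog_u r m + dlog_u s m + dlog_u t m) + aterm r s t (fst m),
     (2 + bterm r s t (fst m)) / snd m + (dlog_v r m + dlog_v s m + dlog_v t m)))" for r s t
  have "eta_form (\<theta> r) (\<theta> s) (\<theta> t) (P \<times> Q) (\<eta> r s t)" if "r < s \<and> s < t \<and> t < d" for r s t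
  proof -
    have "eta_form (\<theta> r) (\<theta> s) (\<theta> t) {m} (\<eta> r s t)" if "m \<in> P \<times> Q" for m
      using that eta_solution[of r s t "fst m" "snd m" "\<eta> r s t"] \<open>r < s \<and> s < t \<and> t < d\<close>
      by (auto simp: \<eta>_def)
    then show ?thesis by (auto simp: eta_form_def)
  qed
  then have "curvature_at web_form d m (ext_d (\<lambda>z. \<Sum>(r, s, t)\<in>triples. \<eta> r s t z) m)"
    unfolding curvature_at_def
    by (intro exI[of _ "P \<times> Q"] exI[of _ \<theta>] exI[of _ \<eta>] conjI m allI
        factorization_of_slopes[OF fst_hol]) auto
  then show ?thesis by (rule exI)
qed

section \<open>Holomorphy of the curvature along the dual line\<close>

text \<open>
  The radius is small enough that \<open>branch_term\<close> is holomorphic and that all \<open>d\<close> slopes are finite.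
\<close>

locale regular_web = uniformised_web +
  assumes slope_lead_regular: "\<And>w. w \<in> ball 0 \<rho> \<Longrightarrow> slope_lead (p0 + w ^ d) \<noteq> 0"
    and reduced1_regular: "\<And>w. w \<in> ball 0 \<rho> \<Longrightarrow> reduced1 w \<noteq> 0"
begin

definition near_p0 :: "complex set" where
  "near_p0 = {p. p \<noteq> p0 \<and> norm (p - p0) < \<rho> ^ d}"

lemma open_near_p0: "open near_p0"
proof -
  have "near_p0 = ball p0 (\<rho> ^ d) - {p0}" by (auto simp: near_p0_def dist_norm norm_minus_commute)
  then show ?thesis by (simp add: open_delete)
qed

lemma root_in_near_p0:
  assumes "p \<in> near_p0" obtains w where "w \<in> ball 0 \<rho>" "p = p0 + w ^ d"
proof -
  have "card {w. w ^ d = p - p0} = d" using assms d0 by (intro card_nth_roots) (auto simp: near_p0_def)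
  then obtain w where "w ^ d = p - p0" using d0 by fastforce
  then show thesis
    using that[of w] norm_root_less[of w d "p - p0" \<rho>] assms \<rho> by (simp add: near_p0_def)
qed

lemma slope_lead_near_p0: "p \<in> near_p0 \<Longrightarrow> slope_lead p \<noteq> 0"
  using root_in_near_p0 slope_lead_regular by metis

lemma branch_term_hol: "branch_term holomorphic_on ball 0 \<rho>"
  unfolding branch_term_def using reduced1_regular d0
  by (intro holomorphic_intros holomorphic_deriv L_hol reduced3_hol reduced1_hol open_ball) auto

text \<open>
  A local branch of the \<open>d\<close>-th root of \<open>p - p0\<close>, multiplied by the \<open>d\<close>-th roots of unity, gives the slopes
  through \<open>L\<close>; the leading coefficient is absorbed in the factor with index \<open>0\<close>.
\<close>

lemma curvature_exists_near:
  assumes "p1 \<in> near_p0" "q1 \<noteq> 0"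
  shows "\<exists>\<kappa>. curvature_at web_form d (p1, q1) \<kappa>"
proof -
  obtain r where r: "r > 0" "ball p1 r \<subseteq> near_p0" using open_near_p0 assms(1) openE by blast
  have "(\<lambda>p. p - p0) holomorphic_on ball p1 r" by (intro holomorphic_intros)
  moreover have "p - p0 \<noteq> 0" if "p \<in> ball p1 r" for p using r that by (auto simp: near_p0_def)
  ultimately obtain \<omega> where \<omega>: "\<omega> holomorphic_on ball p1 r" "\<And>p. p \<in> ball p1 r \<Longrightarrow> \<omega> p ^ d = p - p0"
    using holomorphic_nth_root_on_ball[of "\<lambda>p. p - p0" p1 r d] d0 by blast
  have "card {z::complex. z ^ d = 1} = d" "finite {z::complex. z ^ d = 1}"
    using card_nth_roots[of 1 d] d0 finite_nth_roots by auto
  then obtain \<epsilon> where \<epsilon>: "bij_betw \<epsilon> {0..<d} {z::complex. z ^ d = 1}"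
    using ex_bij_betw_nat_finite[of "{z::complex. z ^ d = 1}"] by auto
  have \<epsilon>1: "\<epsilon> i ^ d = 1" if "i < d" for i using bij_betwE[OF \<epsilon>] that by auto
  define l where "l i p = L (\<epsilon> i * \<omega> p)" for i p
  define u where "u i p = (if i = 0 then slope_lead p else 1)" for i :: nat and p
  define \<theta> :: "nat \<Rightarrow> form1" where
    "\<theta> i m = ((- snd m) * (l i (fst m) * u i (fst m)), u i (fst m))" for i m
  define P where "P = ball p1 r"
  define Q where "Q = UNIV - {0 :: complex}"
  have PD: "p \<in> near_p0" if "p \<in> P" for p using r that by (auto simp: P_def)
  have root: "\<epsilon> i * \<omega> p \<in> ball 0 \<rho>" "p = p0 + (\<epsilon> i * \<omega> p) ^ d" if "i < d" "p \<in> P" for i p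
  proof -
    have e: "(\<epsilon> i * \<omega> p) ^ d = p - p0" using \<epsilon>1 \<omega>(2) that by (simp add: power_mult_distrib P_def)
    show "\<epsilon> i * \<omega> p \<in> ball 0 \<rho>"
      using norm_root_less[OF e _ \<rho>] PD[OF that(2)] by (simp add: near_p0_def)
    show "p = p0 + (\<epsilon> i * \<omega> p) ^ d" using e by simp
  qed
  have l_hol: "l i holomorphic_on P" if i: "i < d" for i
  proof -
    have "(\<lambda>p. \<epsilon> i * \<omega> p) holomorphic_on P" unfolding P_def by (intro holomorphic_intros \<omega>)
    moreover have "(\<lambda>p. \<epsilon> i * \<omega> p) ` P \<subseteq> ball 0 \<rho>" using root(1)[OF i] by blast
    ultimately show ?thesis
      using holomorphic_on_compose_gen[OF _ L_hol] by (fastforce simp: o_def l_def[abs_def])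
  qed
  have slope_lead_hol: "slope_lead holomorphic_on P"
    unfolding slope_lead_def by (intro holomorphic_intros)
  have u_hol: "u i holomorphic_on P" for i
    using slope_lead_hol by (cases "i = 0") (simp_all add: u_def[abs_def])
  have l_root: "slope_fun p (l i p) = 0" if "i < d" "p \<in> P" for i p
    using slope_taylor_at_root(3)[OF root(1)[OF that]] root(2)[OF that] by (simp add: l_def)
  have l_inj: "inj_on (\<lambda>i. l i p) {..<d}" if p: "p \<in> P" for p
  proof (rule inj_onI)
    fix i j assume ij: "i \<in> {..<d}" "j \<in> {..<d}" "l i p = l j p"
    then have "\<epsilon> i * \<omega> p = \<epsilon> j * \<omega> p"
      using inj_onD[OF L_inj _ root(1)[of i p] root(1)[of j p]] p by (simp add: l_def)
    moreover have "\<omega> p \<noteq> 0"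
    proof
      assume "\<omega> p = 0"
      then have "p - p0 = 0" using \<omega>(2)[of p] p d0(2) by (simp add: P_def)
      then show False using PD[OF p] by (simp add: near_p0_def)
    qed
    ultimately show "i = j" using bij_betw_imp_inj_on[OF \<epsilon>] ij by (auto dest: inj_onD)
  qed
  interpret local_web d a b c p0 \<beta> \<theta> P Q l
  proof
    show "open P" "open Q" "0 \<notin> Q" by (auto simp: P_def Q_def open_delete)
    show "holo2 (\<lambda>m. snd (\<theta> i m)) (P \<times> Q)" if "i < d" for i
      using holo2_fst[OF u_hol[of i], of Q] by (simp add: \<theta>_def P_def)
    show "l i holomorphic_on P" if "i < d" for i by (rule l_hol[OF that])
    show "snd (\<theta> i (p, q)) \<noteq> 0" if "i < d" "p \<in> P" "q \<in> Q" for i p q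
      using slope_lead_near_p0 PD that by (simp add: \<theta>_def u_def)
    show "fst (\<theta> i (p, q)) = - q * l i p * snd (\<theta> i (p, q))" for i p q
      by (simp add: \<theta>_def)
    show "(\<Prod>i<d. snd (\<theta> i (p, q))) = slope_lead p" for p q
      using d0 by (simp add: \<theta>_def u_def prod.delta)
    show "inj_on (\<lambda>i. l i p) {..<d}" if "p \<in> P" for p by (rule l_inj[OF that])
    show "slope_fun p z = slope_lead p * (\<Prod>i<d. z - l i p)" if "p \<in> P" for p z
      using slope_fun_eq_prod[of p "\<lambda>i. l i p" z] l_root l_inj that by blast
  qed
  show ?thesis
  proof (rule curvature_exists)
    show "(p1, q1) \<in> P \<times> Q" using r assms by (simp add: P_def Q_def)
    fix i assume i: "i < d"
    have "holo2 (\<lambda>m. - snd m) (P \<times> Q)"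
      by (rule holo2_snd[of "\<lambda>q. - q"]) (intro holomorphic_intros oQ)+
    moreover have "holo2 (\<lambda>m. l i (fst m) * u i (fst m)) (P \<times> Q)"
      by (rule holo2_fst[of "\<lambda>p. l i p * u i p"]) (intro holomorphic_intros l_hol[OF i] u_hol oP)+
    ultimately show "holo2 (\<lambda>m. fst (\<theta> i m)) (P \<times> Q)"
      unfolding \<theta>_def fst_conv by (rule holo2_mult)
  qed
qed

lemma curvature_formula:
  obtains G where "G holomorphic_on ball 0 (\<rho> ^ d)"
    "\<And>p1 q1 \<kappa>. p1 \<in> near_p0 \<Longrightarrow> q1 \<noteq> 0 \<Longrightarrow> curvature_at web_form d (p1, q1) \<kappa> \<Longrightarrow>
      \<kappa> = (deriv G (p1 - p0) - of_nat d * deriv branch_term 0 / (p1 - p0)\<^sup>2) / q1"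
proof -
  have "d \<ge> 2" using d3 by simp
  from sum_over_roots_Laurent[OF branch_term_hol this \<rho>]
  obtain G where G: "G holomorphic_on ball 0 (\<rho> ^ d)"
    "\<And>s. s \<noteq> 0 \<Longrightarrow> norm s < \<rho> ^ d \<Longrightarrow>
      (\<Sum>w | w ^ d = s. branch_term w / w ^ (d + 1)) = of_nat d * deriv branch_term 0 / s + G s"
    by blast
  have "\<kappa> = (deriv G (p1 - p0) - of_nat d * deriv branch_term 0 / (p1 - p0)\<^sup>2) / q1"
    if p1: "p1 \<in> near_p0" and q1: "q1 \<noteq> 0" and cur: "curvature_at web_form d (p1, q1) \<kappa>" for p1 q1 \<kappa>
  proof -
    obtain U \<theta> \<eta> where U: "(p1, q1) \<in> U" and fac: "local_factorization web_form d U \<theta>"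
      and eta: "\<And>r s t. r < s \<and> s < t \<and> t < d \<Longrightarrow> eta_form (\<theta> r) (\<theta> s) (\<theta> t) U (\<eta> r s t)"
      and \<kappa>: "\<kappa> = ext_d (\<lambda>z. \<Sum>(r, s, t)\<in>{(r, s, t). r < s \<and> s < t \<and> t < d}. \<eta> r s t z) (p1, q1)"
      using cur unfolding curvature_at_def by blast
    have "open (U \<inter> near_p0 \<times> (UNIV - {0}))"
      using fac open_near_p0 by (auto simp: local_factorization_def open_Times open_Int open_delete)
    moreover have "(p1, q1) \<in> U \<inter> near_p0 \<times> (UNIV - {0})" using U p1 q1 by simp
    ultimately obtain P Q' where PQ': "open P" "open Q'" "p1 \<in> P" "q1 \<in> Q'"
        "P \<times> Q' \<subseteq> U \<inter> near_p0 \<times> (UNIV - {0})"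
      using open_prod_elim[of "U \<inter> near_p0 \<times> (UNIV - {0})" "(p1, q1)"] by (metis mem_Sigma_iff)
    obtain r where r: "r > 0" "ball q1 r \<subseteq> Q'" using PQ' openE by blast
    define Q where "Q = ball q1 r"
    have PQ: "P \<times> Q \<subseteq> U" "P \<subseteq> near_p0" "0 \<notin> Q" "q1 \<in> Q" "open Q" "connected Q"
    proof -
      have "0 \<notin> Q'" "P \<subseteq> near_p0" "P \<times> Q' \<subseteq> U" using PQ'(3-5) by blast+
      then show "P \<times> Q \<subseteq> U" "P \<subseteq> near_p0" "0 \<notin> Q" using r(2) unfolding Q_def by blast+
    qed (use r in \<open>auto simp: Q_def\<close>)
    obtain l where lw: "local_web d a b c p0 \<beta> \<theta> P Q l"
      using local_web_of_factorization[OF fac PQ(1) PQ'(1) PQ(5,6,4,3)] slope_lead_near_p0 PQ(2) by blast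
    interpret local_web d a b c p0 \<beta> \<theta> P Q l by (fact lw)
    have rs: "root_sum l p = of_nat d * deriv branch_term 0 / (p - p0) + G (p - p0)" if p: "p \<in> P" for p
    proof -
      have "p \<in> near_p0" using p PQ by blast
      then show ?thesis
        using root_sum_eq[OF lw _ p] PQ(2,4) G(2)[of "p - p0"] by (auto simp: near_p0_def)
    qed
    have s0: "p1 - p0 \<noteq> 0" "p1 - p0 \<in> ball 0 (\<rho> ^ d)" using p1 by (auto simp: near_p0_def)
    have "(G has_field_derivative deriv G (p1 - p0)) (at (p1 - p0))"
      by (rule holomorphic_derivI[OF G(1) open_ball s0(2)])
    then have G': "((\<lambda>p. G (p - p0)) has_field_derivative deriv G (p1 - p0)) (at p1)"
    proof -
      have "((\<lambda>p. p - p0) has_field_derivative 1) (at p1)"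
        by (rule derivative_eq_intros refl | simp)+
      from DERIV_chain2[OF \<open>(G has_field_derivative deriv G (p1 - p0)) (at (p1 - p0))\<close> this]
      show ?thesis by simp
    qed
    have "((\<lambda>p. of_nat d * deriv branch_term 0 / (p - p0) + G (p - p0)) has_field_derivative
        deriv G (p1 - p0) - of_nat d * deriv branch_term 0 / (p1 - p0)\<^sup>2) (at p1)"
      by (rule derivative_eq_intros G' refl | use s0 in \<open>simp add: power2_eq_square\<close>)+
    then have "(root_sum l has_field_derivative
        deriv G (p1 - p0) - of_nat d * deriv branch_term 0 / (p1 - p0)\<^sup>2) (at p1)"
      by (rule has_field_derivative_transform_within_open[OF _ PQ'(1,3)]) (simp add: rs)
    moreover have "eta_form (\<theta> r) (\<theta> s) (\<theta> t) (P \<times> Q) (\<eta> r s t)"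
      if "r < s" "s < t" "t < d" for r s t
      using eta[of r s t] PQ(1) that unfolding eta_form_def by blast
    ultimately show ?thesis
      unfolding \<kappa> using PQ'(3) PQ(4) by (intro curvature_value)
  qed
  with G(1) show thesis using that by blast
qed

text \<open>
  The curvature is \<open>E'(p)/q\<close> with \<open>E\<close> the sum of a simple pole and a holomorphic function \<open>G\<close>. If the
  residue vanishes, \<open>G'(p - p0)/q\<close> extends it; otherwise \<open>(p - p0)\<^sup>2\<close> times the curvature has a nonzero
  limit at \<open>p0\<close>, which is impossible for a continuous extension.
\<close>

lemma curvature_holomorphic_iff_deriv_branch_term:
  assumes q0: "q0 \<noteq> 0"
  shows "curvature_holomorphic_at web_form d (p0, q0) \<longleftrightarrow> deriv branch_term 0 = 0"
proof -
  obtain G where G: "G holomorphic_on ball 0 (\<rho> ^ d)"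
    and cur: "\<And>p1 q1 \<kappa>. p1 \<in> near_p0 \<Longrightarrow> q1 \<noteq> 0 \<Longrightarrow> curvature_at web_form d (p1, q1) \<kappa> \<Longrightarrow>
      \<kappa> = (deriv G (p1 - p0) - of_nat d * deriv branch_term 0 / (p1 - p0)\<^sup>2) / q1"
    using curvature_formula by metis
  have \<rho>d: "\<rho> ^ d > 0" using \<rho> by simp
  show ?thesis
  proof
    assume "curvature_holomorphic_at web_form d (p0, q0)"
    then obtain Vn h where Vn: "open Vn" "(p0, q0) \<in> Vn" and h: "holo2 h Vn"
      and hc: "\<And>m \<kappa>. m \<in> Vn \<Longrightarrow> curvature_at web_form d m \<kappa> \<Longrightarrow> h m = \<kappa>"
      by (auto simp: curvature_holomorphic_at_def)
    have "isCont (\<lambda>p. h (p, q0)) p0"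
      by (rule DERIV_isCont[OF holo2_partial_derivatives(1)[OF h Vn(2)]])
    then have hl: "(\<lambda>p. h (p, q0)) \<midarrow>p0\<rightarrow> h (p0, q0)" by (simp add: isCont_def)
    have "isCont (deriv G) 0"
      using holomorphic_on_imp_continuous_on[OF holomorphic_deriv[OF G open_ball]] \<rho>d
      by (simp add: continuous_on_eq_continuous_at)
    then have "isCont (\<lambda>p. deriv G (p - p0)) p0"
      by (intro isCont_o2[of p0 "\<lambda>p. p - p0" "deriv G"]) (auto intro: continuous_intros)
    then have Gl: "(\<lambda>p. deriv G (p - p0)) \<midarrow>p0\<rightarrow> deriv G 0" by (simp add: isCont_def)
    have sl: "(\<lambda>p. (p - p0)\<^sup>2) \<midarrow>p0\<rightarrow> 0"
      by (rule tendsto_eq_intros refl | simp)+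
    have "(\<lambda>p. (p - p0)\<^sup>2 * (deriv G (p - p0) - q0 * h (p, q0))) \<midarrow>p0\<rightarrow> 0"
      using tendsto_mult[OF sl tendsto_diff[OF Gl tendsto_mult[OF tendsto_const[of q0] hl]]] by simp
    moreover have "\<forall>\<^sub>F p in at p0. (p - p0)\<^sup>2 * (deriv G (p - p0) - q0 * h (p, q0)) = of_nat d * deriv branch_term 0"
    proof -
      have "\<forall>\<^sub>F p in at p0. (p, q0) \<in> Vn"
      proof -
        have "isCont (\<lambda>p. (p, q0)) p0" by (intro continuous_intros)
        then show ?thesis using Vn by (auto simp: isCont_def dest: topological_tendstoD)
      qed
      moreover have "\<forall>\<^sub>F p in at p0. p \<in> near_p0"
        unfolding eventually_at using \<rho>d by (auto simp: near_p0_def dist_norm)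
      ultimately show ?thesis
      proof eventually_elim
        case (elim p)
        obtain \<kappa> where \<kappa>: "curvature_at web_form d (p, q0) \<kappa>" using curvature_exists_near[OF elim(2) q0] by blast
        have "q0 * h (p, q0) = deriv G (p - p0) - of_nat d * deriv branch_term 0 / (p - p0)\<^sup>2"
          using hc[OF elim(1) \<kappa>] cur[OF elim(2) q0 \<kappa>] q0 by simp
        moreover have "p - p0 \<noteq> 0" using elim(2) by (simp add: near_p0_def)
        ultimately show ?case by simp
      qed
    qed
    ultimately have "(\<lambda>p. of_nat d * deriv branch_term 0) \<midarrow>p0\<rightarrow> 0"
      by (rule Lim_transform_eventually)
    then have "of_nat d * deriv branch_term 0 = 0" using LIM_const_eq by blast
    then show "deriv branch_term 0 = 0" using d0 by simp
  next
    assume branch_term0: "deriv branch_term 0 = 0"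
    define P where "P = ball p0 (\<rho> ^ d)"
    define h where "h m = deriv G (fst m - p0) * inverse (snd m)" for m :: point2
    have "(\<lambda>p. deriv G (p - p0)) holomorphic_on P"
    proof -
      have "(\<lambda>p. p - p0) ` P \<subseteq> ball 0 (\<rho> ^ d)" by (auto simp: P_def dist_norm norm_minus_commute)
      moreover have "(\<lambda>p. p - p0) holomorphic_on P" by (intro holomorphic_intros)
      ultimately show ?thesis
        using holomorphic_on_compose_gen[OF _ holomorphic_deriv[OF G open_ball]]
        by (fastforce simp: o_def)
    qed
    then have "holo2 (\<lambda>m. deriv G (fst m - p0)) (P \<times> (UNIV - {0}))"
      by (rule holo2_fst) (simp add: P_def)
    moreover have "holo2 (\<lambda>m. inverse (snd m)) (P \<times> (UNIV - {0}))"
      by (rule holo2_snd) (auto intro!: holomorphic_intros simp: open_delete)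
    ultimately have "holo2 h (P \<times> (UNIV - {0}))" unfolding h_def by (rule holo2_mult)
    moreover have "open (P \<times> (UNIV - {0 :: complex}))" by (auto simp: P_def open_Times open_delete)
    moreover have "(p0, q0) \<in> P \<times> (UNIV - {0})" using q0 \<rho>d by (simp add: P_def)
    moreover have "h m = \<kappa>" if m: "m \<in> P \<times> (UNIV - {0})" and \<kappa>: "curvature_at web_form d m \<kappa>" for m \<kappa>
    proof -
      obtain p q where pq: "m = (p, q)" "p \<in> P" "q \<noteq> 0" using m by auto
      have "p \<noteq> p0" using no_curvature_on_dual_line \<kappa> pq(1) by blast
      then have "p \<in> near_p0" using pq(2) by (simp add: P_def near_p0_def dist_norm norm_minus_commute)
      then show ?thesis using cur[of p q \<kappa>] pq \<kappa> branch_term0 by (simp add: h_def divide_inverse)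
    qed
    ultimately show "curvature_holomorphic_at web_form d (p0, q0)"
      unfolding curvature_holomorphic_at_def by blast
  qed
qed

end

text \<open>
  The derivative is that of the form \<open>\<beta>\<close> along \<open>(1, p0)\<close> at the point \<open>(- b, a)\<close> of the inflection line. The
  coefficient \<open>rem_coeff 1 0\<close> is the same derivative at the point of the line where \<open>y = p0 x - 1\<close>,
  and the two differ by a power of the scaling factor.
\<close>

theorem (in dual_web) curvature_holomorphic_iff:
  assumes q0: "q0 \<noteq> 0"
  shows "curvature_holomorphic_at web_form d (p0, q0) \<longleftrightarrow>
    deriv (\<lambda>h. form_eval d \<beta> (- b + h) (a + p0 * h)) 0 = 0"
proof -
  define e where "e = a + b * p0"
  have e: "e \<noteq> 0" using e0 by (simp add: e_def)
  have "d \<ge> 2" and d0: "d > 0" "(0::complex) ^ d = 0" using d3 by auto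
  then obtain \<rho>1 g L where u: "\<rho>1 > 0" "g holomorphic_on ball 0 \<rho>1" "L holomorphic_on ball 0 \<rho>1"
    "inj_on L (ball 0 \<rho>1)"
    "\<And>w. w \<in> ball 0 \<rho>1 \<Longrightarrow> a + b * (p0 + w ^ d) \<noteq> 0"
    "\<And>w. w \<in> ball 0 \<rho>1 \<Longrightarrow> g w \<noteq> 0"
    "\<And>w. w \<in> ball 0 \<rho>1 \<Longrightarrow> (a + b * (p0 + w ^ d)) * L w = b + w * g w"
    "\<And>w. w \<in> ball 0 \<rho>1 \<Longrightarrow> c * g w ^ d = - form_eval d \<beta> (L w) ((p0 + w ^ d) * L w - 1)"
    using uniformisation[OF _ c0 e0 B0] by blast
  interpret u1: uniformised_web d a b c p0 \<beta> \<rho>1 g L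
    by unfold_locales (fact u)+
  have in0: "0 \<in> ball (0::complex) \<rho>1" using u(1) by simp
  have Z0: "u1.reduced1 0 \<noteq> 0"
    unfolding u1.reduced1_def d0(2) using u(6)[OF in0] c0 e0 d0(1) by simp
  have isC: "isCont f 0" if "f holomorphic_on ball 0 \<rho>1" for f :: "complex \<Rightarrow> complex"
    using holomorphic_on_imp_continuous_on[OF that] u(1) by (simp add: continuous_on_eq_continuous_at)
  obtain \<rho>2 where \<rho>2: "\<rho>2 > 0" "\<rho>2 \<le> \<rho>1" "\<And>w. w \<in> ball 0 \<rho>2 \<Longrightarrow> u1.reduced1 w \<noteq> 0"
    using nonzero_on_smaller_ball[OF isC[OF u1.reduced1_hol] Z0 u(1)] by blast
  have slope_lead_hol: "(\<lambda>w. slope_lead (p0 + w ^ d)) holomorphic_on ball 0 \<rho>1"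
    unfolding slope_lead_def by (intro holomorphic_intros)
  have "slope_lead (p0 + 0 ^ d) \<noteq> 0" unfolding slope_lead_def d0(2) using c0 e0 by simp
  then obtain \<rho> where \<rho>: "\<rho> > 0" "\<rho> \<le> \<rho>2" "\<And>w. w \<in> ball 0 \<rho> \<Longrightarrow> slope_lead (p0 + w ^ d) \<noteq> 0"
    using nonzero_on_smaller_ball[OF isC[OF slope_lead_hol] _ \<rho>2(1)] by blast
  have sub: "ball 0 \<rho> \<subseteq> ball (0::complex) \<rho>1" "ball 0 \<rho> \<subseteq> ball (0::complex) \<rho>2" using \<rho> \<rho>2 by auto
  interpret regular_web d a b c p0 \<beta> \<rho> g L
  proof unfold_locales
    show "g holomorphic_on ball 0 \<rho>" "L holomorphic_on ball 0 \<rho>" "inj_on L (ball 0 \<rho>)"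
      using u(2-4) sub(1) by (auto intro: holomorphic_on_subset inj_on_subset)
  qed (use \<rho> u(5-8) sub \<rho>2(3) in blast)+
  define \<phi> where "\<phi> h = form_eval d \<beta> (- b + h) (a + p0 * h)" for h
  have "\<phi> holomorphic_on UNIV" unfolding \<phi>_def by (intro holomorphic_intros)
  then have \<phi>': "(\<phi> has_field_derivative deriv \<phi> 0) (at 0)"
    using holomorphic_derivI[OF _ open_UNIV] by blast
  have L0: "L 0 = b / e" using u(7)[OF in0, unfolded d0(2)] e by (simp add: e_def field_simps)
  let ?t = "taylor_form d \<beta> (p0 + 0 ^ d) (L 0)"
  have t: "poly ?t h = (- 1 / e) ^ d * \<phi> (- e * h)" for h
  proof -
    have "L 0 + h = (- 1 / e) * (- b + (- e * h))" using e by (simp add: L0 field_simps)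
    moreover have "p0 * (L 0 + h) - 1 = (- 1 / e) * (a + p0 * (- e * h))"
      using e by (simp add: L0 field_simps) (simp add: e_def algebra_simps)
    ultimately show ?thesis
      unfolding poly_taylor_form d0(2) add_0_right \<phi>_def by (metis form_eval_scale)
  qed
  have "((\<lambda>h. (- 1 / e) ^ d * \<phi> (- e * h)) has_field_derivative (- 1 / e) ^ d * (deriv \<phi> 0 * (- e))) (at 0)"
    by (intro DERIV_cmult DERIV_chain2[of \<phi>]) (use \<phi>' in \<open>auto intro!: derivative_eq_intros\<close>)
  then have "(poly ?t has_field_derivative (- 1 / e) ^ d * (deriv \<phi> 0 * (- e))) (at 0)"
    by (simp add: t[abs_def])
  then have "poly (pderiv ?t) 0 = (- 1 / e) ^ d * (deriv \<phi> 0 * (- e))"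
    by (rule DERIV_unique[OF poly_DERIV])
  then have "rem_coeff 1 0 = (- 1 / e) ^ d * (deriv \<phi> 0 * (- e))"
    by (simp add: rem_coeff_def poly_0_coeff_0 coeff_pderiv)
  then show ?thesis
    using curvature_holomorphic_iff_deriv_branch_term[OF q0] deriv_branch_term_0[OF Z0] e
    by (simp add: \<phi>_def[abs_def])
qed

section \<open>Homogeneous foliations with an inflection line of maximal order\<close>

lemma eval2_add [simp]: "eval2 (P + R) x y = eval2 P x y + eval2 R x y"
  and eval2_diff [simp]: "eval2 (P - R) x y = eval2 P x y - eval2 R x y"
  and eval2_mult [simp]: "eval2 (P * R) x y = eval2 P x y * eval2 R x y"
  and eval2_power [simp]: "eval2 (P ^ n) x y = eval2 P x y ^ n"
  and eval2_pCons: "eval2 (pCons s P) x y = poly s y + x * eval2 P x y"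
  and eval2_0 [simp]: "eval2 0 x y = 0"
  by (simp_all add: eval2_def poly_power)

lemma eval2_Dx_pCons: "eval2 (Dx (pCons s P)) x y = eval2 P x y + x * eval2 (Dx P) x y"
  by (simp add: Dx_def pderiv_pCons eval2_pCons)

lemma eval2_Dy_pCons: "eval2 (Dy (pCons s P)) x y = poly (pderiv s) y + x * eval2 (Dy P) x y"
  by (simp add: Dy_def map_poly_pCons eval2_pCons)

lemma has_field_derivative_eval2:
  assumes x: "(x has_field_derivative x') (at t)" and y: "(y has_field_derivative y') (at t)"
  shows "((\<lambda>t. eval2 P (x t) (y t)) has_field_derivative
    x' * eval2 (Dx P) (x t) (y t) + y' * eval2 (Dy P) (x t) (y t)) (at t)"
proof (induction P)
  case 0
  then show ?case by (simp add: Dx_def Dy_def)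
next
  case (pCons s P)
  have s: "((\<lambda>t. poly s (y t)) has_field_derivative poly (pderiv s) (y t) * y') (at t)"
    by (rule DERIV_chain2[OF poly_DERIV y])
  show ?case
    unfolding eval2_pCons eval2_Dx_pCons eval2_Dy_pCons
    by (rule derivative_eq_intros s x pCons.IH refl | simp add: algebra_simps)+
qed

lemma eval2_eq_0_imp:
  assumes "\<And>x y. eval2 P x y = 0"
  shows "P = 0"
proof (rule ccontr)
  assume "P \<noteq> 0"
  have "poly P [:x:] = 0" for x
    using assms[of x] poly_all_0_iff_0[of "poly P [:x:]"] by (simp add: eval2_def)
  then have "range (\<lambda>x. [:x:]) \<subseteq> {z. poly P z = 0}" by auto
  moreover have "infinite (range (\<lambda>x::complex. [:x:]))"
    by (subst finite_image_iff) (auto simp: inj_def infinite_UNIV_char_0)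
  ultimately show False using poly_roots_finite[OF \<open>P \<noteq> 0\<close>] finite_subset by blast
qed

lemma eval2_eq_form_eval:
  assumes "homog d P"
  shows "eval2 P x y = form_eval d (\<lambda>i. coeff (coeff P i) (d - i)) x y"
proof -
  have zero: "coeff (coeff P i) j = 0" if "i + j \<noteq> d" for i j
    using assms that by (auto simp: homog_def)
  have inner: "(\<Sum>j\<le>degree (coeff P i). coeff (coeff P i) j * x ^ i * y ^ j) =
      (if i \<le> d then coeff (coeff P i) (d - i) * x ^ i * y ^ (d - i) else 0)" for i
  proof (cases "i \<le> d")
    case False
    then show ?thesis by (auto simp: zero)
  next
    case True
    have "(\<Sum>j\<le>degree (coeff P i). coeff (coeff P i) j * x ^ i * y ^ j) =
        (\<Sum>j\<in>{d - i}. coeff (coeff P i) j * x ^ i * y ^ j)"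
    proof (rule sum.mono_neutral_cong)
      fix j assume "j \<in> {d - i} - {..degree (coeff P i)}"
      then show "coeff (coeff P i) j * x ^ i * y ^ j = 0" by (simp add: coeff_eq_0)
    next
      fix j assume "j \<in> {..degree (coeff P i)} - {d - i}"
      then show "coeff (coeff P i) j * x ^ i * y ^ j = 0" using True by (subst zero) auto
    qed auto
    then show ?thesis using True by simp
  qed
  show ?thesis
    unfolding eval2_sum inner form_eval_def
    by (rule sum.mono_neutral_cong) (auto simp: coeff_eq_0)
qed

lemma form_eval_reverse: "form_eval d (\<lambda>i. \<beta> (d - i)) x y = form_eval d \<beta> y x"
  unfolding form_eval_def
  by (rule sum.reindex_bij_witness[of _ "\<lambda>i. d - i" "\<lambda>i. d - i"]) (auto simp: mult_ac)

lemma homog_Dx: assumes "homog d P" shows "homog (d - 1) (Dx P)"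
  unfolding homog_def
proof (intro allI impI)
  fix i j assume "coeff (coeff (Dx P) i) j \<noteq> 0"
  then have "coeff (coeff P (Suc i)) j \<noteq> 0"
    by (auto simp: Dx_def coeff_pderiv of_nat_poly simp del: of_nat_Suc)
  then show "i + j = d - 1" using assms by (force simp: homog_def)
qed

lemma homog_Dy: assumes "homog d P" shows "homog (d - 1) (Dy P)"
  unfolding homog_def
proof (intro allI impI)
  fix i j assume "coeff (coeff (Dy P) i) j \<noteq> 0"
  then have "coeff (coeff P i) (Suc j) \<noteq> 0"
    by (auto simp: Dy_def coeff_map_poly coeff_pderiv simp del: of_nat_Suc)
  then show "i + j = d - 1" using assms by (force simp: homog_def)
qed

lemma euler_identity:
  assumes "homog d P"
  shows "x * eval2 (Dx P) x y + y * eval2 (Dy P) x y = of_nat d * eval2 P x y"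
proof -
  have "((\<lambda>t. eval2 P (t * x) (t * y)) has_field_derivative
      x * eval2 (Dx P) (1 * x) (1 * y) + y * eval2 (Dy P) (1 * x) (1 * y)) (at 1)"
    by (rule has_field_derivative_eval2) (auto intro!: derivative_eq_intros)
  moreover have "((\<lambda>t. eval2 P (t * x) (t * y)) has_field_derivative of_nat d * eval2 P x y) (at 1)"
    unfolding eval2_homog[OF assms] by (auto intro!: derivative_eq_intros)
  ultimately show ?thesis by (auto dest: DERIV_unique)
qed

text \<open>
  If \<open>\<gamma>\<close> vanishes to order exactly \<open>k > 0\<close> at \<open>0\<close> and \<open>\<epsilon>\<close> does not vanish there, then their Wronskian
  vanishes to order exactly \<open>k - 1\<close>.
\<close>

lemma power_dvd_of_wronskian:
  fixes \<gamma> \<epsilon> :: "complex poly"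
  assumes \<epsilon>: "poly \<epsilon> 0 \<noteq> 0" and \<gamma>: "poly \<gamma> 0 = 0"
    and dv: "[:0, 1:] ^ n dvd \<gamma> * pderiv \<epsilon> - \<epsilon> * pderiv \<gamma>"
  shows "[:0, 1:] ^ (n + 1) dvd \<gamma>"
proof -
  let ?X = "[:0, 1 :: complex:]"
  have root: "?X dvd g" if "poly g 0 = 0" for g using that by (simp add: poly_eq_0_iff_dvd)
  have "?X ^ k dvd \<gamma>" if "k \<le> n + 1" for k
    using that
  proof (induction k)
    case (Suc k)
    then obtain g where g: "\<gamma> = ?X ^ k * g" by (auto elim: dvdE)
    show ?case
    proof (cases k)
      case 0
      then show ?thesis using root[OF \<gamma>] by simp
    next
      case k: (Suc m)
      define R where "R = ?X * (g * pderiv \<epsilon> - \<epsilon> * pderiv g) - smult (of_nat k) (\<epsilon> * g)"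
      have "pderiv ?X = 1" by (simp add: pderiv_pCons)
      then have "pderiv \<gamma> = ?X ^ k * pderiv g + smult (of_nat k) (?X ^ m) * g"
        unfolding g k by (simp only: pderiv_mult pderiv_power_Suc mult_1_left mult_1_right mult.commute add.commute)
      then have wr: "\<gamma> * pderiv \<epsilon> - \<epsilon> * pderiv \<gamma> = ?X ^ m * R"
        unfolding R_def by (simp add: g k algebra_simps)
      have "?X ^ Suc m dvd ?X ^ n" using Suc.prems k by (intro le_imp_power_dvd) simp
      from dvd_trans[OF this dv] have "?X ^ m * ?X dvd ?X ^ m * R"
        unfolding wr power_Suc2 .
      moreover have "?X ^ m \<noteq> 0" by simp
      ultimately have "?X dvd R" by (simp only: dvd_mult_cancel_left) blast
      then have "poly R 0 = 0" by (simp add: poly_eq_0_iff_dvd)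
      then have "poly g 0 = 0" using \<epsilon> k by (simp add: R_def del: of_nat_Suc)
      then have "?X dvd g" by (rule root)
      then show ?thesis unfolding g power_Suc2 by (rule mult_dvd_mono[OF dvd_refl])
    qed
  qed simp
  from this[OF order_refl] show ?thesis .
qed

lemma eval2_on_line_is_poly: "\<exists>r. \<forall>\<mu>. poly r \<mu> = eval2 P (x0 + \<mu> * x1) (y0 + \<mu> * y1)"
proof (induction P)
  case 0
  then show ?case by (intro exI[of _ 0]) simp
next
  case (pCons s P)
  then obtain r where "\<And>\<mu>. poly r \<mu> = eval2 P (x0 + \<mu> * x1) (y0 + \<mu> * y1)" by blast
  then show ?case
    by (intro exI[of _ "s \<circ>\<^sub>p [:y0, y1:] + [:x0, x1:] * r"]) (simp add: eval2_pCons poly_pcompose distrib_right mult.assoc)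
qed

lemma on_line_iff:
  assumes "(a, b) \<noteq> (0, 0 :: complex)"
  shows "a * x + b * y = 0 \<longleftrightarrow> (\<exists>r. x = r * (- b) \<and> y = r * a)"
proof
  assume h: "a * x + b * y = 0"
  show "\<exists>r. x = r * (- b) \<and> y = r * a"
  proof (cases "a = 0")
    case True
    then show ?thesis using assms h by (intro exI[of _ "- x / b"]) auto
  next
    case False
    then show ?thesis using h by (intro exI[of _ "y / a"]) (auto simp: field_simps add_eq_0_iff)
  qed
qed auto

locale inflection =
  fixes d :: nat and A B :: "complex poly poly" and a b :: complex
  assumes d3: "d \<ge> 3" and fol: "homogeneous_foliation d A B"
    and infl: "transverse_inflection_line A B a b (d - 1)"
begin

definition A0 :: complex where "A0 = eval2 A (- b) a"
definition B0 :: complex where "B0 = eval2 B (- b) a"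

lemma hA: "homog d A" and hB: "homog d B"
  using fol by (auto simp: homogeneous_foliation_def)

lemma ab: "(a, b) \<noteq> (0, 0)"
  using infl by (simp add: transverse_inflection_line_def)

lemma eval2_on_T:
  "homog n P \<Longrightarrow> eval2 P (r * (- b)) (r * a) = r ^ n * eval2 P (- b) a"
  by (rule eval2_homog)

text \<open>
  The point \<open>(- b, a)\<close> spans the line \<open>ax + by = 0\<close>, and \<open>\<omega>\<close> restricted to the line is this number times
  \<open>r ^ d\<close> at the point \<open>r (- b, a)\<close>.
\<close>

lemma transverse: "a * B0 - b * A0 \<noteq> 0"
proof
  assume h: "a * B0 - b * A0 = 0"
  have "invariant_line A B a b"
    unfolding invariant_line_def
  proof (intro allI impI)
    fix x y assume "a * x + b * y = 0"
    then obtain r where r: "x = r * (- b)" "y = r * a" using on_line_iff[OF ab] by blast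
    have "eval2 A x y * (- b) + eval2 B x y * a = r ^ d * (a * B0 - b * A0)"
      unfolding r eval2_on_T[OF hA] eval2_on_T[OF hB] by (simp add: A0_def B0_def algebra_simps)
    then show "eval2 A x y * (- b) + eval2 B x y * a = 0" using h by simp
  qed
  then show False using infl by (simp add: transverse_inflection_line_def)
qed

text \<open>
  The slope map is totally ramified over the inflection line. Along the affine line
  \<open>\<mu> \<mapsto> (- b, a) + \<mu> (x1, y1)\<close> with \<open>a * x1 + b * y1 = 1\<close> the Euler identity turns the Jacobian
  determinant \<open>D_inv A B\<close> into the Wronskian of \<open>\<gamma>\<close>, the restriction of the combination that vanishes
  at \<open>(- b, a)\<close>, and \<open>\<epsilon>\<close>, the restriction of one that does not. Divisibility by \<open>linform a b ^ (d - 1)\<close> then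
  forces the polynomial \<open>\<gamma>\<close>, whose degree is at most \<open>d\<close>, to be a multiple of \<open>\<mu> ^ d\<close>. The constant is
  not zero, since otherwise \<open>D_inv A B = 0\<close> would be divisible by \<open>linform a b ^ d\<close>.
\<close>

lemma flat_combination:
  obtains c where "c \<noteq> 0"
    "\<And>x y. B0 * eval2 A x y - A0 * eval2 B x y = c * (a * x + b * y) ^ d"
proof -
  define C where "C x y = B0 * eval2 A x y - A0 * eval2 B x y" for x y
  obtain e1 e2 where Ev: "e1 * A0 + e2 * B0 \<noteq> 0"
  proof (cases "A0 = 0")
    case True
    then show ?thesis using that[of 0 1] transverse by auto
  qed (use that[of 1 0] in auto)
  define Ev where "Ev = e1 * A0 + e2 * B0"
  obtain x1 y1 where v: "a * x1 + b * y1 = 1"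
  proof (cases "a = 0")
    case True
    then show ?thesis using that[of 0 "1 / b"] ab by auto
  qed (use that[of "1 / a" 0] in auto)
  let ?u1 = "\<lambda>\<mu>. - b + \<mu> * x1" and ?u2 = "\<lambda>\<mu>. a + \<mu> * y1"
  let ?lp = "\<lambda>P. form_poly d (\<lambda>i. coeff (coeff P i) (d - i)) [:- b, x1:] [:a, y1:]"
  have lp: "poly (?lp P) \<mu> = eval2 P (?u1 \<mu>) (?u2 \<mu>)" if "homog d P" for P \<mu>
    unfolding poly_form_poly eval2_eq_form_eval[OF that] by simp
  have lp': "poly (pderiv (?lp P)) \<mu> = x1 * eval2 (Dx P) (?u1 \<mu>) (?u2 \<mu>) + y1 * eval2 (Dy P) (?u1 \<mu>) (?u2 \<mu>)"
    if "homog d P" for P \<mu>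
  proof -
    have "((\<lambda>\<mu>. eval2 P (?u1 \<mu>) (?u2 \<mu>)) has_field_derivative
        x1 * eval2 (Dx P) (?u1 \<mu>) (?u2 \<mu>) + y1 * eval2 (Dy P) (?u1 \<mu>) (?u2 \<mu>)) (at \<mu>)"
      by (rule has_field_derivative_eval2) (auto intro!: derivative_eq_intros)
    then have "(poly (?lp P) has_field_derivative
        x1 * eval2 (Dx P) (?u1 \<mu>) (?u2 \<mu>) + y1 * eval2 (Dy P) (?u1 \<mu>) (?u2 \<mu>)) (at \<mu>)"
      by (simp add: lp[OF that, abs_def])
    then show ?thesis by (rule DERIV_unique[OF poly_DERIV])
  qed
  define \<gamma> where "\<gamma> = smult B0 (?lp A) - smult A0 (?lp B)"
  define \<epsilon> where "\<epsilon> = smult e1 (?lp A) + smult e2 (?lp B)"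
  have \<gamma>: "poly \<gamma> \<mu> = C (?u1 \<mu>) (?u2 \<mu>)" for \<mu>
    by (simp add: \<gamma>_def lp hA hB C_def)
  have "linform a b ^ (d - 1) dvd D_inv A B"
    using infl by (simp add: transverse_inflection_line_def)
  then obtain R where R: "D_inv A B = linform a b ^ (d - 1) * R" by (auto elim: dvdE)
  obtain r where r: "\<And>\<mu>. poly r \<mu> = eval2 R (?u1 \<mu>) (?u2 \<mu>)"
    using eval2_on_line_is_poly[of R "- b" x1 a y1] by blast
  have "poly (smult (of_nat d) (\<gamma> * pderiv \<epsilon> - \<epsilon> * pderiv \<gamma>)) \<mu> =
      poly (smult (- Ev) ([:0, 1:] ^ (d - 1) * r)) \<mu>" for \<mu>
  proof -
    let ?x = "?u1 \<mu>" and ?y = "?u2 \<mu>"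
    have "a * ?x + b * ?y = \<mu> * (a * x1 + b * y1)" by (simp add: algebra_simps)
    then have "eval2 (D_inv A B) ?x ?y = \<mu> ^ (d - 1) * poly r \<mu>"
      unfolding R by (simp add: eval2_linform v r)
    moreover have "poly (smult (of_nat d) (\<gamma> * pderiv \<epsilon> - \<epsilon> * pderiv \<gamma>)) \<mu> =
        - Ev * eval2 (D_inv A B) ?x ?y"
    proof -
      define Ax Ay Bx By where "Ax = eval2 (Dx A) ?x ?y" and "Ay = eval2 (Dy A) ?x ?y"
        and "Bx = eval2 (Dx B) ?x ?y" and "By = eval2 (Dy B) ?x ?y"
      define X Y where "X = ?x" and "Y = ?y"
      have eu: "of_nat d * poly (?lp A) \<mu> = X * Ax + Y * Ay"
        "of_nat d * poly (?lp B) \<mu> = X * Bx + Y * By"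
        using euler_identity[OF hA, of ?x ?y] euler_identity[OF hB, of ?x ?y]
        by (simp_all add: lp hA hB Ax_def Ay_def Bx_def By_def X_def Y_def)
      have det: "X * y1 - Y * x1 = - 1" using v by (simp add: X_def Y_def algebra_simps)
      have "poly (smult (of_nat d) (\<gamma> * pderiv \<epsilon> - \<epsilon> * pderiv \<gamma>)) \<mu> =
          (B0 * (of_nat d * poly (?lp A) \<mu>) - A0 * (of_nat d * poly (?lp B) \<mu>)) *
            (e1 * poly (pderiv (?lp A)) \<mu> + e2 * poly (pderiv (?lp B)) \<mu>) -
          (e1 * (of_nat d * poly (?lp A) \<mu>) + e2 * (of_nat d * poly (?lp B) \<mu>)) *
            (B0 * poly (pderiv (?lp A)) \<mu> - A0 * poly (pderiv (?lp B)) \<mu>)"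
        by (simp add: \<gamma>_def \<epsilon>_def pderiv_add pderiv_diff pderiv_smult) (simp add: algebra_simps)
      also have "\<dots> = Ev * (X * y1 - Y * x1) * (Ax * By - Ay * Bx)"
        unfolding eu unfolding lp'[OF hA] lp'[OF hB]
        unfolding Ax_def[symmetric] Ay_def[symmetric] Bx_def[symmetric] By_def[symmetric] Ev_def
        by algebra
      finally show ?thesis unfolding det
        by (simp add: D_inv_def Ax_def Ay_def Bx_def By_def)
    qed
    ultimately show ?thesis by (simp add: poly_power)
  qed
  then have eq: "smult (of_nat d) (\<gamma> * pderiv \<epsilon> - \<epsilon> * pderiv \<gamma>) = smult (- Ev) ([:0, 1:] ^ (d - 1) * r)"
    using poly_eq_poly_eq_iff by blast
  then have "[:0, 1:] ^ (d - 1) dvd smult (of_nat d) (\<gamma> * pderiv \<epsilon> - \<epsilon> * pderiv \<gamma>)"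
    by (simp add: dvd_smult)
  then have "[:0, 1:] ^ (d - 1) dvd \<gamma> * pderiv \<epsilon> - \<epsilon> * pderiv \<gamma>"
    using d3 by (simp add: dvd_smult_iff)
  moreover have "poly \<epsilon> 0 \<noteq> 0" using Ev by (simp add: \<epsilon>_def lp hA hB A0_def B0_def)
  moreover have "poly \<gamma> 0 = 0" by (simp add: \<gamma> C_def A0_def B0_def)
  ultimately have "[:0, 1:] ^ (d - 1 + 1) dvd \<gamma>" by (intro power_dvd_of_wronskian)
  then obtain k where k: "\<gamma> = [:0, 1:] ^ d * k" using d3 by (auto elim: dvdE)
  have deg: "degree \<gamma> \<le> d"
    unfolding \<gamma>_def by (intro degree_diff_le order_trans[OF degree_smult_le] form_poly_linear_top)
  have "degree k = 0"
  proof (cases "k = 0")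
    case False
    then have "degree \<gamma> = d + degree k"
      unfolding k by (subst degree_mult_eq) (auto simp: degree_linear_power)
    then show ?thesis using deg by simp
  qed simp
  then obtain c where c: "k = [:c:]" by (rule degree_eq_zeroE)
  have \<gamma>c: "poly \<gamma> \<mu> = c * \<mu> ^ d" for \<mu> by (simp add: k c poly_power)
  have scale: "C (s * x) (s * y) = s ^ d * C x y" for s x y
    by (simp add: C_def eval2_homog[OF hA] eval2_homog[OF hB] algebra_simps)
  have Cv: "C x1 y1 = c"
  proof -
    have "coeff \<gamma> d = C x1 y1"
      by (simp add: \<gamma>_def form_poly_linear_top C_def eval2_eq_form_eval[OF hA] eval2_eq_form_eval[OF hB])
    moreover have "coeff \<gamma> d = c" unfolding k c by (simp add: coeff_linear_power)
    ultimately show ?thesis by simp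
  qed
  have C: "C x y = c * (a * x + b * y) ^ d" for x y
  proof -
    define s m where "s = x1 * y - y1 * x" and "m = a * x + b * y"
    have "x = (a * x1 + b * y1) * x" "y = (a * x1 + b * y1) * y" unfolding v by simp_all
    then have xy: "x = s * (- b) + m * x1" "y = s * a + m * y1"
      by (simp_all add: s_def m_def algebra_simps)
    show ?thesis
    proof (cases "s = 0")
      case True
      then have "x = m * x1" "y = m * y1" using xy by auto
      then have "C x y = m ^ d * c" using scale[of m x1 y1] Cv by simp
      then show ?thesis by (simp add: m_def)
    next
      case False
      have "x = s * (?u1 (m / s))" "y = s * (?u2 (m / s))"
        using False by (subst xy, simp add: algebra_simps)+
      then have "C x y = s ^ d * poly \<gamma> (m / s)" using scale by (metis \<gamma>)
      also have "\<dots> = c * m ^ d" using False by (simp add: \<gamma>c power_divide)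
      finally show ?thesis by (simp add: m_def)
    qed
  qed
  have "c \<noteq> 0"
  proof
    assume c0: "c = 0"
    have "eval2 (D_inv A B) x y = 0" for x y
    proof -
      have g: "B0 * (x' * eval2 (Dx A) x y + y' * eval2 (Dy A) x y) -
          A0 * (x' * eval2 (Dx B) x y + y' * eval2 (Dy B) x y) = 0" for x' y'
      proof -
        have "((\<lambda>t. C (x + t * x') (y + t * y')) has_field_derivative
          B0 * (x' * eval2 (Dx A) (x + 0 * x') (y + 0 * y') + y' * eval2 (Dy A) (x + 0 * x') (y + 0 * y')) -
          A0 * (x' * eval2 (Dx B) (x + 0 * x') (y + 0 * y') + y' * eval2 (Dy B) (x + 0 * x') (y + 0 * y'))) (at 0)"
          unfolding C_def
          by (intro DERIV_diff DERIV_cmult has_field_derivative_eval2) (auto intro!: derivative_eq_intros)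
        moreover have "((\<lambda>t. C (x + t * x') (y + t * y')) has_field_derivative 0) (at 0)"
          unfolding C c0 by simp
        ultimately show ?thesis by (auto dest: DERIV_unique)
      qed
      have "Ev * eval2 (D_inv A B) x y =
          (B0 * eval2 (Dx A) x y - A0 * eval2 (Dx B) x y) * (e1 * eval2 (Dy A) x y + e2 * eval2 (Dy B) x y) -
          (B0 * eval2 (Dy A) x y - A0 * eval2 (Dy B) x y) * (e1 * eval2 (Dx A) x y + e2 * eval2 (Dx B) x y)"
        by (simp add: Ev_def D_inv_def) algebra
      also have "\<dots> = 0" using g[of 1 0] g[of 0 1] by simp
      finally show ?thesis using Ev by (simp add: Ev_def)
    qed
    then have "D_inv A B = 0" by (rule eval2_eq_0_imp)
    then show False using infl by (simp add: transverse_inflection_line_def)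
  qed
  then show thesis using that[of c] C by (simp add: C_def)
qed

end

section \<open>The Gauss image and the two charts of the dual plane\<close>

text \<open>
  The point \<open>(p0, 0)\<close>, at which the equation of the slopes degenerates, is the finite exception.
\<close>

lemma (in dual_web) curvature_holomorphic_along_iff:
  assumes sub: "S \<subseteq> {p0} \<times> UNIV" and sup: "{p0} \<times> (UNIV - {0}) \<subseteq> S"
  shows "curvature_holomorphic_along web_form d S \<longleftrightarrow>
    deriv (\<lambda>h. form_eval d \<beta> (- b + h) (a + p0 * h)) 0 = 0" (is "_ \<longleftrightarrow> ?flat")
proof
  assume "curvature_holomorphic_along web_form d S"
  then obtain Fin where Fin: "finite Fin" "\<And>m. m \<in> S - Fin \<Longrightarrow> curvature_holomorphic_at web_form d m"
    by (auto simp: curvature_holomorphic_along_def)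
  have "infinite (UNIV - {0 :: complex})" by (simp add: infinite_UNIV_char_0)
  then have "infinite (UNIV - {0} - snd ` Fin)" using Fin(1) by (intro Diff_infinite_finite) auto
  then obtain q where "q \<in> UNIV - {0} - snd ` Fin" by (metis ex_in_conv finite.emptyI)
  then have "q \<noteq> 0" "(p0, q) \<in> S - Fin" using sup by force+
  then show ?flat using Fin(2) curvature_holomorphic_iff by blast
next
  assume flat: ?flat
  show "curvature_holomorphic_along web_form d S"
    unfolding curvature_holomorphic_along_def
  proof (intro exI[of _ "{(p0, 0)}"] conjI ballI)
    fix m assume "m \<in> S - {(p0, 0)}"
    then obtain q where "m = (p0, q)" "q \<noteq> 0" using sub by auto
    then show "curvature_holomorphic_at web_form d m" using flat curvature_holomorphic_iff by blast
  qed simp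
qed

context inflection begin

lemma domega_vanishes_iff:
  "domega_vanishes_on A B a b \<longleftrightarrow> eval2 (Dx B) (- b) a = eval2 (Dy A) (- b) a"
proof
  assume "domega_vanishes_on A B a b"
  then have "eval2 (Dx B - Dy A) (- b) a = 0"
    unfolding domega_vanishes_on_def by (simp add: mult.commute)
  then show "eval2 (Dx B) (- b) a = eval2 (Dy A) (- b) a" by simp
next
  assume h: "eval2 (Dx B) (- b) a = eval2 (Dy A) (- b) a"
  show "domega_vanishes_on A B a b"
    unfolding domega_vanishes_on_def
  proof (intro allI impI)
    fix x y assume "a * x + b * y = 0"
    then obtain r where r: "x = r * (- b)" "y = r * a" using on_line_iff[OF ab] by blast
    show "eval2 (Dx B - Dy A) x y = 0"
      unfolding r eval2_diff eval2_on_T[OF homog_Dx[OF hB]] eval2_on_T[OF homog_Dy[OF hA]] h by simp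
  qed
qed

text \<open>
  The combination in \<open>flat_combination\<close> vanishes to order \<open>d > 1\<close> on the line, so its gradient is zero
  there.
\<close>

lemma flat_gradient:
  "B0 * eval2 (Dx A) (- b) a = A0 * eval2 (Dx B) (- b) a"
  "B0 * eval2 (Dy A) (- b) a = A0 * eval2 (Dy B) (- b) a"
proof -
  obtain c where c: "\<And>x y. B0 * eval2 A x y - A0 * eval2 B x y = c * (a * x + b * y) ^ d"
    using flat_combination by metis
  obtain n where n: "d = Suc (Suc n)" using d3 by (intro that[of "d - 2"]) auto
  have "B0 * (x' * eval2 (Dx A) (- b) a + y' * eval2 (Dy A) (- b) a) -
      A0 * (x' * eval2 (Dx B) (- b) a + y' * eval2 (Dy B) (- b) a) = 0" for x' y'
  proof -
    have "((\<lambda>t. B0 * eval2 A (- b + t * x') (a + t * y') - A0 * eval2 B (- b + t * x') (a + t * y'))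
      has_field_derivative
      B0 * (x' * eval2 (Dx A) (- b + 0 * x') (a + 0 * y') + y' * eval2 (Dy A) (- b + 0 * x') (a + 0 * y')) -
      A0 * (x' * eval2 (Dx B) (- b + 0 * x') (a + 0 * y') + y' * eval2 (Dy B) (- b + 0 * x') (a + 0 * y'))) (at 0)"
      by (intro DERIV_diff DERIV_cmult has_field_derivative_eval2) (auto intro!: derivative_eq_intros)
    moreover have "((\<lambda>t. c * (a * (- b + t * x') + b * (a + t * y')) ^ d) has_field_derivative 0) (at 0)"
      unfolding n by (rule derivative_eq_intros refl | simp)+
    ultimately show ?thesis unfolding c by (auto dest: DERIV_unique)
  qed
  from this[of 1 0] this[of 0 1] show
    "B0 * eval2 (Dx A) (- b) a = A0 * eval2 (Dx B) (- b) a"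
    "B0 * eval2 (Dy A) (- b) a = A0 * eval2 (Dy B) (- b) a"
    by simp_all
qed

lemma gauss_image_subset:
  assumes "(u, v, w) \<in> gauss_image A B (proj_line a b)"
  shows "u * B0 = v * A0"
proof -
  let ?Z = "{m :: triple. fst m * B0 = fst (snd m) * A0}"
  have "closed ?Z" by (intro closed_Collect_eq continuous_intros)
  moreover have "{(c * u, c * v, c * w) | c u v w m. c \<noteq> 0 \<and> m \<in> proj_line a b \<and>
      proj_form A B m = (u, v, w) \<and> (u, v, w) \<noteq> (0, 0, 0)} \<subseteq> ?Z"
  proof
    fix t assume "t \<in> {(c * u, c * v, c * w) | c u v w m. c \<noteq> 0 \<and> m \<in> proj_line a b \<and>
      proj_form A B m = (u, v, w) \<and> (u, v, w) \<noteq> (0, 0, 0)}"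
    then obtain c u v w x y z where t: "t = (c * u, c * v, c * w)"
      and m: "(x, y, z) \<in> proj_line a b" and f: "proj_form A B (x, y, z) = (u, v, w)"
      by (clarify) (metis prod_cases3)
    obtain r where r: "x = r * (- b)" "y = r * a"
      using m on_line_iff[OF ab] by (auto simp: proj_line_def)
    have "eval2 A x y = r ^ d * A0" "eval2 B x y = r ^ d * B0"
      unfolding r eval2_on_T[OF hA] eval2_on_T[OF hB] by (simp_all add: A0_def B0_def)
    then show "t \<in> ?Z" using f by (auto simp: t)
  qed
  ultimately have "gauss_image A B (proj_line a b) \<subseteq> ?Z"
    unfolding gauss_image_def using closure_minimal by blast
  then show ?thesis using assms by auto
qed

text \<open>
  At \<open>(- b, a, z)\<close> the tangent line is \<open>(z A0, z B0, - (a B0 - b A0))\<close>; the choice of \<open>z\<close> and of the scaling factor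
  reaches every dual point proportional to \<open>(A0, B0)\<close> in the first two coordinates whose third one is not
  zero.
\<close>

lemma gauss_image_mem:
  assumes "\<alpha> \<noteq> 0" "w \<noteq> 0"
  shows "(\<alpha> * A0, \<alpha> * B0, w) \<in> gauss_image A B (proj_line a b)"
proof -
  define \<nu> where "\<nu> = a * B0 - b * A0"
  have \<nu>: "\<nu> \<noteq> 0" using transverse by (simp add: \<nu>_def)
  define \<kappa> where "\<kappa> = - w / \<nu>"
  define z where "z = \<alpha> / \<kappa>"
  have \<kappa>: "\<kappa> \<noteq> 0" using assms \<nu> by (simp add: \<kappa>_def)
  have "(- b, a, z) \<in> proj_line a b" using ab by (auto simp: proj_line_def)
  moreover have "proj_form A B (- b, a, z) = (z * A0, z * B0, - \<nu>)"
    by (simp add: A0_def[symmetric] B0_def[symmetric] \<nu>_def)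
  moreover have "(\<alpha> * A0, \<alpha> * B0, w) = (\<kappa> * (z * A0), \<kappa> * (z * B0), \<kappa> * (- \<nu>))"
    using \<kappa> \<nu> by (simp add: z_def \<kappa>_def)
  moreover have "(z * A0, z * B0, - \<nu>) \<noteq> (0, 0, 0)" using \<nu> by simp
  ultimately have "(\<alpha> * A0, \<alpha> * B0, w) \<in> {(c * u, c * v, c * w) | c u v w m. c \<noteq> 0 \<and> m \<in> proj_line a b \<and>
      proj_form A B m = (u, v, w) \<and> (u, v, w) \<noteq> (0, 0, 0)}"
    using \<kappa> by blast
  from subsetD[OF closure_subset this] show ?thesis
    using assms(2) unfolding gauss_image_def by (simp only: Diff_iff) simp
qed

text \<open>
  If \<open>B0 = 0\<close> the inflection line has tangents of infinite slope and its dual curve does not meet this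
  chart.
\<close>

lemma curvature_leg_y_iff:
  "curvature_holomorphic_along (leg_y A B) d {(p, q). (p, -1, -q) \<in> gauss_image A B (proj_line a b)} \<longleftrightarrow>
    B0 = 0 \<or> domega_vanishes_on A B a b"
proof (cases "B0 = 0")
  case True
  have "A0 \<noteq> 0" using transverse True by auto
  then have "{(p, q). (p, -1, -q) \<in> gauss_image A B (proj_line a b)} = {}"
    using gauss_image_subset True by fastforce
  then show ?thesis using True by (auto simp: curvature_holomorphic_along_def)
next
  case False
  obtain c where c: "c \<noteq> 0" "\<And>x y. B0 * eval2 A x y - A0 * eval2 B x y = c * (a * x + b * y) ^ d"
    using flat_combination by metis
  define p0 where "p0 = - A0 / B0"
  define \<beta> where "\<beta> i = coeff (coeff B i) (d - i)" for i
  have \<beta>: "form_eval d \<beta> x y = eval2 B x y" for x y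
    using eval2_eq_form_eval[OF hB] by (simp add: \<beta>_def[abs_def])
  interpret dual_web d a b "c / B0" p0 \<beta>
  proof
    show "3 \<le> d" "c / B0 \<noteq> 0" using d3 c False by auto
    show "a + b * p0 \<noteq> 0" using transverse False by (auto simp: p0_def field_simps)
    show "form_eval d \<beta> (- b) a \<noteq> 0" using False by (simp add: \<beta> B0_def)
  qed
  have web_form: "web_form = leg_y A B"
  proof (intro ext)
    fix m t :: "complex \<times> complex"
    obtain p q \<xi> \<zeta> where m: "m = (p, q)" "t = (\<xi>, \<zeta>)" by (metis surj_pair)
    define y where "y = p * \<zeta> - q * \<xi>"
    have "c / B0 * (a * \<zeta> + b * y) ^ d = eval2 A \<zeta> y + p0 * eval2 B \<zeta> y"
      using c(2)[of \<zeta> y, symmetric] False by (simp add: p0_def field_simps)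
    moreover have "web_form m t = c / B0 * (a * \<zeta> + b * y) ^ d + (p - p0) * eval2 B \<zeta> y"
      unfolding web_form_def m y_def by (simp add: \<beta>)
    moreover have "leg_y A B m t = eval2 A \<zeta> y + p * eval2 B \<zeta> y" by (simp add: m y_def)
    ultimately show "web_form m t = leg_y A B m t" by (simp add: algebra_simps)
  qed
  have "curvature_holomorphic_along (leg_y A B) d {(p, q). (p, -1, -q) \<in> gauss_image A B (proj_line a b)} \<longleftrightarrow>
      deriv (\<lambda>h. form_eval d \<beta> (- b + h) (a + p0 * h)) 0 = 0"
    unfolding web_form[symmetric]
  proof (rule curvature_holomorphic_along_iff)
    show "{(p, q). (p, -1, -q) \<in> gauss_image A B (proj_line a b)} \<subseteq> {p0} \<times> UNIV"
      using gauss_image_subset False by (fastforce simp: p0_def field_simps)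
    have "(p0, -1, -q) \<in> gauss_image A B (proj_line a b)" if "q \<noteq> 0" for q
      using gauss_image_mem[of "- 1 / B0" "- q"] that False by (simp add: p0_def)
    then show "{p0} \<times> (UNIV - {0}) \<subseteq> {(p, q). (p, -1, -q) \<in> gauss_image A B (proj_line a b)}" by auto
  qed
  also have "deriv (\<lambda>h. form_eval d \<beta> (- b + h) (a + p0 * h)) 0 =
      eval2 (Dx B) (- b) a + p0 * eval2 (Dy B) (- b) a"
  proof -
    have "((\<lambda>h. eval2 B (- b + h) (a + p0 * h)) has_field_derivative
        1 * eval2 (Dx B) (- b + 0) (a + p0 * 0) + p0 * eval2 (Dy B) (- b + 0) (a + p0 * 0)) (at 0)"
      by (rule has_field_derivative_eval2) (auto intro!: derivative_eq_intros)
    then show ?thesis unfolding \<beta> by (simp add: DERIV_imp_deriv)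
  qed
  also have "\<dots> = eval2 (Dx B) (- b) a - eval2 (Dy A) (- b) a"
    using flat_gradient(2) False by (simp add: p0_def field_simps)
  finally show ?thesis using False domega_vanishes_iff by simp
qed

text \<open>
  Exchanging \<open>x\<close> and \<open>y\<close> exchanges \<open>a\<close> and \<open>b\<close> and makes \<open>A\<close> play the role of \<open>B\<close>.
\<close>

lemma curvature_leg_x_iff:
  "curvature_holomorphic_along (leg_x A B) d {(p, q). (-1, p, -q) \<in> gauss_image A B (proj_line a b)} \<longleftrightarrow>
    A0 = 0 \<or> domega_vanishes_on A B a b"
proof (cases "A0 = 0")
  case True
  have "B0 \<noteq> 0" using transverse True by auto
  then have "{(p, q). (-1, p, -q) \<in> gauss_image A B (proj_line a b)} = {}"
    using gauss_image_subset True by fastforce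
  then show ?thesis using True by (auto simp: curvature_holomorphic_along_def)
next
  case False
  obtain c where c: "c \<noteq> 0" "\<And>x y. B0 * eval2 A x y - A0 * eval2 B x y = c * (a * x + b * y) ^ d"
    using flat_combination by metis
  define p0 where "p0 = - B0 / A0"
  define \<beta> where "\<beta> i = coeff (coeff A (d - i)) (d - (d - i))" for i
  have \<beta>: "form_eval d \<beta> x y = eval2 A y x" for x y
    unfolding \<beta>_def using form_eval_reverse[of d "\<lambda>i. coeff (coeff A i) (d - i)" x y]
    by (simp add: eval2_eq_form_eval[OF hA])
  have neg: "eval2 P b (- a) = (- 1) ^ n * eval2 P (- b) a" if "homog n P" for n P
    using eval2_on_T[OF that, of "-1"] by simp
  interpret dual_web d b a "- c / A0" p0 \<beta>
  proof
    show "3 \<le> d" "- c / A0 \<noteq> 0" using d3 c False by auto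
    show "b + a * p0 \<noteq> 0" using transverse False by (auto simp: p0_def field_simps)
    show "form_eval d \<beta> (- a) b \<noteq> 0" using False neg[OF hA] by (simp add: \<beta> A0_def)
  qed
  have web_form: "web_form = leg_x A B"
  proof (intro ext)
    fix m t :: "complex \<times> complex"
    obtain p q \<xi> \<zeta> where m: "m = (p, q)" "t = (\<xi>, \<zeta>)" by (metis surj_pair)
    define x where "x = p * \<zeta> - q * \<xi>"
    have "- c / A0 * (b * \<zeta> + a * x) ^ d = - (c * (a * x + b * \<zeta>) ^ d) / A0"
      by (simp add: add.commute)
    also have "\<dots> = eval2 B x \<zeta> + p0 * eval2 A x \<zeta>"
      unfolding c(2)[symmetric] p0_def using False by (simp add: field_simps)
    finally have "- c / A0 * (b * \<zeta> + a * x) ^ d = eval2 B x \<zeta> + p0 * eval2 A x \<zeta>" .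
    moreover have "web_form m t = - c / A0 * (b * \<zeta> + a * x) ^ d + (p - p0) * eval2 A x \<zeta>"
      unfolding web_form_def m x_def by (simp add: \<beta>)
    moreover have "leg_x A B m t = eval2 B x \<zeta> + p * eval2 A x \<zeta>" by (simp add: m x_def)
    ultimately show "web_form m t = leg_x A B m t" by (simp add: algebra_simps)
  qed
  have "curvature_holomorphic_along (leg_x A B) d {(p, q). (-1, p, -q) \<in> gauss_image A B (proj_line a b)} \<longleftrightarrow>
      deriv (\<lambda>h. form_eval d \<beta> (- a + h) (b + p0 * h)) 0 = 0"
    unfolding web_form[symmetric]
  proof (rule curvature_holomorphic_along_iff)
    show "{(p, q). (-1, p, -q) \<in> gauss_image A B (proj_line a b)} \<subseteq> {p0} \<times> UNIV"
      using gauss_image_subset False by (fastforce simp: p0_def field_simps)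
    have "(-1, p0, -q) \<in> gauss_image A B (proj_line a b)" if "q \<noteq> 0" for q
      using gauss_image_mem[of "- 1 / A0" "- q"] that False by (simp add: p0_def)
    then show "{p0} \<times> (UNIV - {0}) \<subseteq> {(p, q). (-1, p, -q) \<in> gauss_image A B (proj_line a b)}" by auto
  qed
  also have "deriv (\<lambda>h. form_eval d \<beta> (- a + h) (b + p0 * h)) 0 =
      p0 * eval2 (Dx A) b (- a) + eval2 (Dy A) b (- a)"
  proof -
    have "((\<lambda>h. eval2 A (b + p0 * h) (- a + h)) has_field_derivative
        p0 * eval2 (Dx A) (b + p0 * 0) (- a + 0) + 1 * eval2 (Dy A) (b + p0 * 0) (- a + 0)) (at 0)"
      by (rule has_field_derivative_eval2) (auto intro!: derivative_eq_intros)
    then show ?thesis unfolding \<beta> by (simp add: DERIV_imp_deriv)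
  qed
  also have "\<dots> = (- 1) ^ (d - 1) * (p0 * eval2 (Dx A) (- b) a + eval2 (Dy A) (- b) a)"
    unfolding neg[OF homog_Dx[OF hA]] neg[OF homog_Dy[OF hA]] by (simp add: algebra_simps)
  also have "p0 * eval2 (Dx A) (- b) a = - eval2 (Dx B) (- b) a"
    using flat_gradient(1) False by (simp add: p0_def field_simps)
  finally show ?thesis using False domega_vanishes_iff by (auto simp: add_eq_0_iff2)
qed

end

theorem mainTheorem8:
  fixes d :: nat and A B :: "complex poly poly" and a b :: complex
  assumes "d \<ge> 3"
    and "homogeneous_foliation d A B"
    and "transverse_inflection_line A B a b (d - 1)"
  shows "legendre_curvature_holomorphic_along A B d (gauss_image A B (proj_line a b)) \<longleftrightarrow>
         domega_vanishes_on A B a b"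
proof -
  interpret inflection d A B a b
    using assms by unfold_locales
  have "A0 \<noteq> 0 \<or> B0 \<noteq> 0" using transverse by auto
  then show ?thesis
    unfolding legendre_curvature_holomorphic_along_def curvature_leg_x_iff curvature_leg_y_iff by auto
qed

end
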